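(* Let $V:\mathbb{R}^n\to\mathbb{R}^n$ be smooth, $\mathbb{Z}^n$-periodic, with $\operatorname{div} V=0$ and $\int_{\mathbb{T}^n}V\,dx=0$. Assume that $V$ is not constantly zero. Then there exists $\varepsilon_0>0$ such that for every $\varepsilon\in(0,\varepsilon_0)$ the level set $S_\varepsilon=\{p\in\mathbb{R}^n : \alpha_\varepsilon(p)=1\}$ is not round; equivalently, the function $\alpha_\varepsilon$ is not Euclidean, i.e. there is no constant $c>0$ with $\alpha_\varepsilon(p)=c|p|$ for all $p\in\mathbb{R}^n$. Here $\alpha_\varepsilon$ is the effective burning velocity associated with the flow velocity $\varepsilon V$.
   Context: $\mathbb{T}^n=\mathbb{R}^n/\mathbb{Z}^n$. For a smooth, $\mathbb{Z}^n$-periodic, divergence-free, mean-zero vector field $W:\mathbb{R}^n\to\mathbb{R}^n$, the effective Hamiltonian $\overline H:\mathbb{R}^n\to\mathbb{R}$ associated with $W$ is defined as follows: for each $p\in\mathbb{R}^n$, $\overline H(p)$ is the unique real constant such that the cell problem $$|p+Du|^2+W(x)\cdot(p+Du)=\overline H(p)\quad\text{in }\mathbb{T}^n$$ admits a periodic viscosity solution $u\in C^{0,1}(\mathbb{T}^n)$. The effective burning velocity associated with the flow velocity $W$ is $$\alpha(p)=\inf_{\lambda>0}\frac{1+\overline H(\lambda p)}{\lambda},\qquad p\in\mathbb{R}^n.$$ $\alpha_\varepsilon$ denotes this function for $W=\varepsilon V$. *)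

theory Defs
  imports "HOL-Analysis.Analysis"
begin

definition partial_deriv ::
  "'n::finite \<Rightarrow> (real^'n \<Rightarrow> 'b::real_normed_vector) \<Rightarrow> real^'n \<Rightarrow> 'b" where
  "partial_deriv i f x = frechet_derivative f (at x) (axis i 1)"

primrec Ck :: "nat \<Rightarrow> (real^'n::finite \<Rightarrow> 'b::real_normed_vector) \<Rightarrow> bool" where
  "Ck 0 f \<longleftrightarrow> continuous_on UNIV f"
| "Ck (Suc k) f \<longleftrightarrow> f differentiable_on UNIV \<and> (\<forall>i. Ck k (partial_deriv i f))"

definition smooth :: "(real^'n::finite \<Rightarrow> 'b::real_normed_vector) \<Rightarrow> bool" where
  "smooth f \<longleftrightarrow> (\<forall>k. Ck k f)"

text \<open>Functions on the torus are represented by their periodic lifts to the whole space.\<close>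

definition Zn_periodic :: "(real^'n::finite \<Rightarrow> 'b) \<Rightarrow> bool" where
  "Zn_periodic f \<longleftrightarrow> (\<forall>x k. (\<forall>i. k $ i \<in> \<int>) \<longrightarrow> f (x + k) = f x)"

definition divergence :: "(real^'n::finite \<Rightarrow> real^'n) \<Rightarrow> real^'n \<Rightarrow> real" where
  "divergence V x = (\<Sum>i\<in>UNIV. partial_deriv i V x $ i)"

definition torus_integral :: "(real^'n::finite \<Rightarrow> real^'n) \<Rightarrow> real^'n" where
  "torus_integral V = integral (cbox 0 1) V"

text \<open>Viscosity solutions of the first-order equation \<open>F x (Du) = c\<close> on the whole space,
  in the sense of Crandall and Lions: continuous functions tested at points of local
  extremum of \<open>u - \<phi>\<close> by continuously differentiable \<open>\<phi>\<close> with gradient \<open>g\<close>.\<close>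

definition C1_with_gradient ::
  "(real^'n::finite \<Rightarrow> real) \<Rightarrow> (real^'n \<Rightarrow> real^'n) \<Rightarrow> bool" where
  "C1_with_gradient \<phi> g \<longleftrightarrow> (\<forall>x. GDERIV \<phi> x :> g x) \<and> continuous_on UNIV g"

definition viscosity_subsolution ::
  "(real^'n::finite \<Rightarrow> real^'n \<Rightarrow> real) \<Rightarrow> real \<Rightarrow> (real^'n \<Rightarrow> real) \<Rightarrow> bool" where
  "viscosity_subsolution F c u \<longleftrightarrow>
     (\<forall>\<phi> g x. C1_with_gradient \<phi> g \<and> (\<forall>\<^sub>F y in nhds x. u y - \<phi> y \<le> u x - \<phi> x)
        \<longrightarrow> F x (g x) \<le> c)"

definition viscosity_supersolution ::
  "(real^'n::finite \<Rightarrow> real^'n \<Rightarrow> real) \<Rightarrow> real \<Rightarrow> (real^'n \<Rightarrow> real) \<Rightarrow> bool" where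
  "viscosity_supersolution F c u \<longleftrightarrow>
     (\<forall>\<phi> g x. C1_with_gradient \<phi> g \<and> (\<forall>\<^sub>F y in nhds x. u x - \<phi> x \<le> u y - \<phi> y)
        \<longrightarrow> c \<le> F x (g x))"

definition viscosity_solution ::
  "(real^'n::finite \<Rightarrow> real^'n \<Rightarrow> real) \<Rightarrow> real \<Rightarrow> (real^'n \<Rightarrow> real) \<Rightarrow> bool" where
  "viscosity_solution F c u \<longleftrightarrow> continuous_on UNIV u \<and>
     viscosity_subsolution F c u \<and> viscosity_supersolution F c u"

definition cell_problem_solution ::
  "(real^'n::finite \<Rightarrow> real^'n) \<Rightarrow> real^'n \<Rightarrow> real \<Rightarrow> (real^'n \<Rightarrow> real) \<Rightarrow> bool" where
  "cell_problem_solution W p c u \<longleftrightarrow>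
     Zn_periodic u \<and> (\<exists>L. L-lipschitz_on UNIV u) \<and>
     viscosity_solution (\<lambda>x q. (norm (p + q))\<^sup>2 + W x \<bullet> (p + q)) c u"

definition effective_Hamiltonian ::
  "(real^'n::finite \<Rightarrow> real^'n) \<Rightarrow> real^'n \<Rightarrow> real" where
  "effective_Hamiltonian W p = (THE c. \<exists>u. cell_problem_solution W p c u)"

definition burning_velocity ::
  "(real^'n::finite \<Rightarrow> real^'n) \<Rightarrow> real^'n \<Rightarrow> real" where
  "burning_velocity W p = (INF t\<in>{0<..}. (1 + effective_Hamiltonian W (t *\<^sub>R p)) / t)"

text \<open>Round means a sphere about the origin; since the burning velocity is positively homogeneous
  of degree one, this is what matches \<open>Euclidean\<close> for its unit level set.\<close>

definition round_set :: "(real^'n::finite) set \<Rightarrow> bool" where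
  "round_set S \<longleftrightarrow> (\<exists>r>0. S = sphere 0 r)"

definition Euclidean_fun :: "(real^'n::finite \<Rightarrow> real) \<Rightarrow> bool" where
  "Euclidean_fun a \<longleftrightarrow> (\<exists>c>0. \<forall>p. a p = c * norm p)"

end

theory Submission
  imports Defs "HOL-Complex_Analysis.Great_Picard"
begin

text \<open>
  For a nonzero integer vector \<open>k\<close>, let \<open>F_k(x)\<close> be the integral of \<open>V(x + tk) \<bullet> k\<close> over
  \<open>t \<in> [0,1]\<close>. To first order in \<open>\<epsilon>\<close>, the value \<open>\<alpha>_\<epsilon>(k)\<close> is \<open>2|k| + \<epsilon> max F_k\<close>, and already this
  first-order term is not proportional to \<open>|k|\<close>.

  If all \<open>F_k\<close> were nonpositive, they would vanish identically. Every Fourier coefficient of \<open>V\<close> at a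
  frequency \<open>m\<close> would then be orthogonal to all integer vectors orthogonal to \<open>m\<close>, and by
  incompressibility also to \<open>m\<close> itself, so \<open>V\<close> would be zero. Hence some \<open>F_k\<close> is positive somewhere.
  On the other hand, the closed line in a direction such as \<open>(1, N, N^2, \<dots>)\<close> is so well distributed
  over the torus that \<open>F_k / |k|\<close> is uniformly as small as we like.

  The two first-order estimates come from viscosity arguments: the upper bound from testing the
  supersolution property with a smooth corrector, the lower bound from a penalized maximum of the
  subsolution along a closed line. The cell problem is solved by Perron's method for the discounted
  equation \<open>\<lambda>u + H(x, Du) = 0\<close>, followed by \<open>\<lambda> \<rightarrow> 0\<close>, and its constant is unique by doubling of
  variables.
\<close>

section \<open>Test functions and viscosity subsolutions\<close>

text \<open>Without flow, (1 + t^2 |k|^2) / t is minimal at t = 1 / |k| with value 2 |k|. Per unit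
  length all directions then agree, and only the term linear in \<epsilon> can separate two of them;
  so both estimates have to be sharp in that term, with errors quadratic in \<epsilon>. Integer
  directions make this possible: along a closed line, V \<bullet> k minus its average has an
  explicit periodic primitive, so the corrector meets no small divisors. In the lower bound the
  unknown gradient of the solution is absorbed by completing a square, at a cost quadratic in
  \<epsilon>. Perron's supremum is formed without semicontinuous envelopes, because coercivity gives
  all competitors one Lipschitz constant.\<close>

lemma C1_add:
  "C1_with_gradient f f' \<Longrightarrow> C1_with_gradient g g' \<Longrightarrow>
    C1_with_gradient (\<lambda>x. f x + g x) (\<lambda>x. f' x + g' x)"
  by (auto simp: C1_with_gradient_def intro!: GDERIV_add continuous_intros)

lemma C1_const: "C1_with_gradient (\<lambda>x. c) (\<lambda>x. 0)"
  by (auto simp: C1_with_gradient_def intro!: GDERIV_const)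

lemma C1_scale:
  "C1_with_gradient f f' \<Longrightarrow> C1_with_gradient (\<lambda>x. c * f x) (\<lambda>x. c *\<^sub>R f' x)"
  unfolding C1_with_gradient_def gderiv_def
  by (auto intro!: continuous_intros derivative_eq_intros)

lemma C1_dist2:
  "C1_with_gradient (\<lambda>y. A * (norm (y - x0))\<^sup>2) (\<lambda>y. (2 * A) *\<^sub>R (y - x0))"
  unfolding C1_with_gradient_def gderiv_def power2_norm_eq_inner
  by (auto intro!: continuous_intros derivative_eq_intros ext simp: inner_commute algebra_simps)

lemma C1_continuous: "C1_with_gradient f f' \<Longrightarrow> continuous_on S f"
  unfolding C1_with_gradient_def gderiv_def
  by (meson continuous_at_imp_continuous_on has_derivative_continuous)

lemma C1_gradient_zero_at_max:
  assumes "C1_with_gradient f g" "\<forall>\<^sub>F y in nhds x. f y \<le> f x"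
  shows "g x = 0"
proof -
  have "(f has_derivative (\<lambda>h. h \<bullet> g x)) (at x)"
    using assms(1) unfolding C1_with_gradient_def gderiv_def by auto
  moreover obtain S where "open S" "x \<in> S" "\<And>y. y \<in> S \<Longrightarrow> f y \<le> f x"
    using assms(2) unfolding eventually_nhds by auto
  ultimately have "(\<lambda>h. h \<bullet> g x) = (\<lambda>h. 0)"
    by (metis differential_zero_maxmin)
  then show ?thesis by (metis inner_eq_zero_iff)
qed

lemma C1_gradient_eq_at_max:
  assumes "C1_with_gradient f f'" "C1_with_gradient g g'" "\<forall>\<^sub>F y in nhds x. f y - g y \<le> f x - g x"
  shows "f' x = g' x"
proof -
  have "C1_with_gradient (\<lambda>x. f x + (-1) * g x) (\<lambda>x. f' x + (-1) *\<^sub>R g' x)"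
    by (intro C1_add C1_scale assms)
  from C1_gradient_zero_at_max[OF this, of x] assms(3) show ?thesis by simp
qed

text \<open>The existence step behind every doubling of variables: \<open>a\<close> is a base point,
  compact up to periodicity, and \<open>z\<close> the displacement to the second point, which the
  penalty keeps bounded because \<open>f\<close> is bounded.\<close>

lemma penalized_max_exists:
  fixes f :: "'a::metric_space \<Rightarrow> 'b::euclidean_space \<Rightarrow> real"
  assumes cont: "continuous_on UNIV (\<lambda>(a, z). f a z)"
    and bdd: "\<And>a z. \<bar>f a z\<bar> \<le> B" and K: "compact K" "K \<noteq> {}"
    and per: "\<And>a. \<exists>a'\<in>K. \<forall>z. f a z = f a' z" and A: "A > 0"
  obtains a z where "\<And>a' z'. f a' z' - A * (norm z')\<^sup>2 \<le> f a z - A * (norm z)\<^sup>2"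
proof -
  \<comment> \<open>Beyond this radius the penalty is at least \<open>A * R = 2 * B + A\<close>,
    more than the oscillation of \<open>f\<close>. The summand 1 gives \<open>R \<ge> 1\<close>,
    hence \<open>R \<le> R\<^sup>2\<close>.\<close>
  define R where "R = 2 * B / A + 1"
  obtain a0 where a0: "a0 \<in> K" using K by auto
  have B0: "B \<ge> 0" using bdd[of a0 0] by linarith
  have R1: "R \<ge> 1" using B0 A by (simp add: R_def)
  have "continuous_on (K \<times> cball 0 R) (\<lambda>p. f (fst p) (snd p) - A * (norm (snd p))\<^sup>2)"
    using cont by (intro continuous_intros)
      (auto simp: split_beta intro: continuous_on_subset)
  moreover have "compact (K \<times> cball (0::'b) R)" "K \<times> cball (0::'b) R \<noteq> {}"
    using K R1 by (auto simp: compact_Times)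
  ultimately obtain p where p: "p \<in> K \<times> cball 0 R"
    "\<And>q. q \<in> K \<times> cball 0 R \<Longrightarrow> f (fst q) (snd q) - A * (norm (snd q))\<^sup>2
       \<le> f (fst p) (snd p) - A * (norm (snd p))\<^sup>2"
    using continuous_attains_sup[of "K \<times> cball 0 R"] by blast
  show ?thesis
  proof (rule that[of "fst p" "snd p"])
    fix a' z'
    obtain a1 where a1: "a1 \<in> K" "\<And>z. f a' z = f a1 z" using per by blast
    show "f a' z' - A * (norm z')\<^sup>2 \<le> f (fst p) (snd p) - A * (norm (snd p))\<^sup>2"
    proof (cases "norm z' \<le> R")
      case True
      then show ?thesis using p(2)[of "(a1, z')"] a1 by auto
    next
      case False
      then have "R * 1 \<le> norm z' * norm z'" using R1 by (intro mult_mono) auto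
      then have "A * R \<le> A * (norm z')\<^sup>2" using A by (simp add: power2_eq_square)
      moreover have "A * R = 2 * B + A" using A by (simp add: R_def field_simps)
      moreover have "f a1 0 \<le> f (fst p) (snd p) - A * (norm (snd p))\<^sup>2"
        using p(2)[of "(a1, 0)"] a1 R1 by auto
      ultimately show ?thesis using bdd[of a1 0] bdd[of a' z'] A by linarith
    qed
  qed
qed

text \<open>The value \<open>u x\<close> is an argument of \<open>G\<close> so that the discounted
  equation and the cell problem are both instances. Supersolutions enter through \<open>- u\<close>
  with the gradient negated, so each stability argument is made once.\<close>

definition general_subsolution :: "(real^'n::finite \<Rightarrow> real \<Rightarrow> real^'n \<Rightarrow> real) \<Rightarrow> (real^'n \<Rightarrow> real) \<Rightarrow> bool" where
  "general_subsolution G u \<longleftrightarrow> (\<forall>\<phi> g x. C1_with_gradient \<phi> g \<and> (\<forall>\<^sub>F y in nhds x. u y - \<phi> y \<le> u x - \<phi> x)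
        \<longrightarrow> G x (u x) (g x) \<le> 0)"

lemma general_subsolutionD:
  "general_subsolution G u \<Longrightarrow> C1_with_gradient \<phi> g \<Longrightarrow> (\<forall>\<^sub>F y in nhds x. u y - \<phi> y \<le> u x - \<phi> x)
    \<Longrightarrow> G x (u x) (g x) \<le> 0"
  unfolding general_subsolution_def by blast

lemma general_subsolution_mono:
  assumes "general_subsolution G u" "\<And>x q. G x (u x) q \<le> 0 \<Longrightarrow> G' x (u x) q \<le> 0"
  shows "general_subsolution G' u"
  using assms unfolding general_subsolution_def by blast

lemma C1_minus_iff:
  "C1_with_gradient (\<lambda>x. - f x) (\<lambda>x. - g x) \<longleftrightarrow> C1_with_gradient f g"
  using C1_scale[of f g "-1"] C1_scale[of "\<lambda>x. - f x" "\<lambda>x. - g x" "-1"] by auto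

lemma viscosity_subsolution_general_subsolution:
  "viscosity_subsolution F c u \<longleftrightarrow> general_subsolution (\<lambda>x r q. F x q - c) u"
  by (simp add: viscosity_subsolution_def general_subsolution_def)

lemma viscosity_supersolution_general_subsolution:
  "viscosity_supersolution F c u \<longleftrightarrow> general_subsolution (\<lambda>x r q. c - F x (- q)) (\<lambda>x. - u x)"
proof
  assume L: "viscosity_supersolution F c u"
  show "general_subsolution (\<lambda>x r q. c - F x (- q)) (\<lambda>x. - u x)"
    unfolding general_subsolution_def
  proof (intro allI impI, elim conjE)
    fix \<phi> g x assume *: "C1_with_gradient \<phi> g" "\<forall>\<^sub>F y in nhds x. - u y - \<phi> y \<le> - u x - \<phi> x"
    have "C1_with_gradient (\<lambda>x. - \<phi> x) (\<lambda>x. - g x)" using * by (simp add: C1_minus_iff)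
    moreover have "\<forall>\<^sub>F y in nhds x. u x - - \<phi> x \<le> u y - - \<phi> y"
      using *(2) by eventually_elim linarith
    ultimately have "c \<le> F x (- g x)" using L unfolding viscosity_supersolution_def by blast
    then show "c - F x (- g x) \<le> 0" by simp
  qed
next
  assume R: "general_subsolution (\<lambda>x r q. c - F x (- q)) (\<lambda>x. - u x)"
  show "viscosity_supersolution F c u"
    unfolding viscosity_supersolution_def
  proof (intro allI impI, elim conjE)
    fix \<phi> g x assume *: "C1_with_gradient \<phi> g" "\<forall>\<^sub>F y in nhds x. u x - \<phi> x \<le> u y - \<phi> y"
    have "C1_with_gradient (\<lambda>x. - \<phi> x) (\<lambda>x. - g x)" using * by (simp add: C1_minus_iff)
    moreover have "\<forall>\<^sub>F y in nhds x. - u y - - \<phi> y \<le> - u x - - \<phi> x"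
      using *(2) by eventually_elim linarith
    ultimately show "c \<le> F x (g x)" using general_subsolutionD[OF R, of "\<lambda>x. - \<phi> x" "\<lambda>x. - g x" x] by auto
  qed
qed

text \<open>The quadratic term makes the maximum at \<open>x0\<close> strict, so maxima of nearby functions lie nearby.\<close>
lemma strict_perturbation_max:
  fixes x0 :: "'a::euclidean_space"
  assumes \<phi>: "continuous_on (cball x0 r) \<phi>" and v: "continuous_on (cball x0 r) v" and r: "r > 0"
    and max: "\<And>y. y \<in> cball x0 r \<Longrightarrow> u y - \<phi> y \<le> u x0 - \<phi> x0"
    and low: "v x0 \<ge> u x0 - \<eta>" and up: "\<And>y. y \<in> cball x0 r \<Longrightarrow> v y \<le> u y + \<eta>"
    and \<eta>: "2 * \<eta> < r\<^sup>2"
  obtains y where "(norm (y - x0))\<^sup>2 \<le> 2 * \<eta>"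
    "\<forall>\<^sub>F z in nhds y. v z - (\<phi> z + 1 * (norm (z - x0))\<^sup>2) \<le> v y - (\<phi> y + 1 * (norm (y - x0))\<^sup>2)"
    "\<bar>v y - u x0\<bar> \<le> \<eta> + \<bar>\<phi> y - \<phi> x0\<bar>"
proof -
  have cont: "continuous_on (cball x0 r) (\<lambda>z. v z - (\<phi> z + 1 * (norm (z - x0))\<^sup>2))"
    by (intro continuous_intros \<phi> v)
  then obtain y where y: "y \<in> cball x0 r"
    "\<And>z. z \<in> cball x0 r \<Longrightarrow> v z - (\<phi> z + 1 * (norm (z - x0))\<^sup>2) \<le> v y - (\<phi> y + 1 * (norm (y - x0))\<^sup>2)"
    using continuous_attains_sup[OF compact_cball _ cont] r by auto
  have y0: "v x0 - \<phi> x0 \<le> v y - (\<phi> y + 1 * (norm (y - x0))\<^sup>2)" using y(2)[of x0] r by simp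
  \<comment> \<open>Comparison with \<open>x0\<close> loses one \<open>\<eta>\<close> at
    \<open>x0\<close> and one at \<open>y\<close>; maximality of \<open>u - \<phi>\<close> at
    \<open>x0\<close> leaves just these to bound the quadratic term.\<close>
  have n: "(norm (y - x0))\<^sup>2 \<le> 2 * \<eta>" using y0 low up[OF y(1)] max[OF y(1)] by linarith
  then have "(norm (y - x0))\<^sup>2 < r\<^sup>2" using \<eta> by linarith
  then have "norm (y - x0) < r" using r by (simp add: power2_less_imp_less)
  then have "y \<in> ball x0 r" by (simp add: dist_norm norm_minus_commute)
  then have "\<forall>\<^sub>F z in nhds y. z \<in> ball x0 r" by (intro eventually_nhds_in_open) auto
  then have *: "\<forall>\<^sub>F z in nhds y. v z - (\<phi> z + 1 * (norm (z - x0))\<^sup>2) \<le> v y - (\<phi> y + 1 * (norm (y - x0))\<^sup>2)"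
    by (rule eventually_mono) (use y in auto)
  have "\<bar>v y - u x0\<bar> \<le> \<eta> + \<bar>\<phi> y - \<phi> x0\<bar>"
    using y0 low up[OF y(1)] max[OF y(1)] zero_le_power2[of "norm (y - x0)"] by linarith
  with n * that show ?thesis by blast
qed

text \<open>Stability in a form that serves two uses: in Perron's method \<open>v\<close> is a
  single competitor close to the supremum at \<open>x0\<close>, and for vanishing discount it is a
  uniform approximation. Hence closeness from below is asked at \<open>x0\<close> alone.\<close>

lemma general_subsolution_of_approximations:
  assumes G: "continuous_on UNIV (\<lambda>(x, r, q). G x r q)"
    and approx: "\<And>x0 \<eta>. \<eta> > 0 \<Longrightarrow> \<exists>v. continuous_on UNIV v \<and> general_subsolution (\<lambda>x r q. G x r q - \<eta>) v \<and>
        v x0 \<ge> u x0 - \<eta> \<and> (\<forall>y. v y \<le> u y + \<eta>)"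
  shows "general_subsolution G u"
  unfolding general_subsolution_def
proof (intro allI impI, elim conjE)
  fix \<phi> g x0
  assume \<phi>: "C1_with_gradient \<phi> g" and ev: "\<forall>\<^sub>F y in nhds x0. u y - \<phi> y \<le> u x0 - \<phi> x0"
  obtain r where r: "r > 0" and max: "\<And>y. y \<in> cball x0 r \<Longrightarrow> u y - \<phi> y \<le> u x0 - \<phi> x0"
    using ev unfolding eventually_nhds by (metis open_contains_cball subsetD)
  \<comment> \<open>The factor \<open>r\<^sup>2 / 4\<close> gives
    \<open>2 * \<eta> n < r\<^sup>2\<close>, which keeps the perturbed maximum points inside the
    ball.\<close>
  define \<eta> where "\<eta> n = r\<^sup>2 / 4 * inverse (real (Suc n))" for n
  have \<eta>0: "\<eta> n > 0" for n using r by (simp add: \<eta>_def)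
  have \<eta>r: "2 * \<eta> n < r\<^sup>2" for n
  proof -
    have "\<eta> n \<le> r\<^sup>2 / 4 * 1" unfolding \<eta>_def by (intro mult_left_mono) (auto simp: divide_simps)
    moreover have "r\<^sup>2 > 0" using r by simp
    ultimately show ?thesis by linarith
  qed
  have \<eta>lim: "\<eta> \<longlonglongrightarrow> 0"
    unfolding \<eta>_def using tendsto_mult_right_zero[OF LIMSEQ_inverse_real_of_nat] by blast
  \<comment> \<open>Here \<open>s\<close> is the value of the approximation at its maximum point
    \<open>y\<close>. Once it is named, the approximating functions disappear and continuity of
    \<open>G\<close> gives the limit.\<close>
  have "\<exists>y s. (norm (y - x0))\<^sup>2 \<le> 2 * \<eta> n \<and> \<bar>s - u x0\<bar> \<le> \<eta> n + \<bar>\<phi> y - \<phi> x0\<bar>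
      \<and> G y s (g y + (2 * 1) *\<^sub>R (y - x0)) \<le> \<eta> n" for n
  proof -
    obtain v where v: "continuous_on UNIV v" "general_subsolution (\<lambda>x r q. G x r q - \<eta> n) v"
        "v x0 \<ge> u x0 - \<eta> n" "\<And>y. v y \<le> u y + \<eta> n"
      using approx[OF \<eta>0, of n x0] by blast
    obtain y where y: "(norm (y - x0))\<^sup>2 \<le> 2 * \<eta> n"
      "\<forall>\<^sub>F z in nhds y. v z - (\<phi> z + 1 * (norm (z - x0))\<^sup>2) \<le> v y - (\<phi> y + 1 * (norm (y - x0))\<^sup>2)"
      "\<bar>v y - u x0\<bar> \<le> \<eta> n + \<bar>\<phi> y - \<phi> x0\<bar>"
      by (rule strict_perturbation_max[OF C1_continuous[OF \<phi>] continuous_on_subset[OF v(1)] r max v(3) v(4) \<eta>r])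
        auto
    show ?thesis
      using y general_subsolutionD[OF v(2) C1_add[OF \<phi> C1_dist2] y(2)] by auto
  qed
  then obtain y s where y: "\<And>n. (norm (y n - x0))\<^sup>2 \<le> 2 * \<eta> n"
    and s: "\<And>n. \<bar>s n - u x0\<bar> \<le> \<eta> n + \<bar>\<phi> (y n) - \<phi> x0\<bar>"
    and Gn: "\<And>n. G (y n) (s n) (g (y n) + (2 * 1) *\<^sub>R (y n - x0)) \<le> \<eta> n"
    by metis
  have "(\<lambda>n. 2 * \<eta> n) \<longlonglongrightarrow> 0" using tendsto_mult_right_zero[OF \<eta>lim] .
  then have "(\<lambda>n. (norm (y n - x0))\<^sup>2) \<longlonglongrightarrow> 0"
    by (rule Lim_null_comparison[rotated]) (use y in auto)
  then have "(\<lambda>n. norm (y n - x0)) \<longlonglongrightarrow> 0" by simp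
  then have ylim: "y \<longlonglongrightarrow> x0" using LIM_zero_iff tendsto_norm_zero_iff by blast
  have "(\<lambda>n. \<phi> (y n)) \<longlonglongrightarrow> \<phi> x0"
    by (rule continuous_on_tendsto_compose[OF C1_continuous[OF \<phi>, of UNIV] ylim]) auto
  then have "(\<lambda>n. \<phi> (y n) - \<phi> x0) \<longlonglongrightarrow> 0" by (simp add: LIM_zero_iff)
  then have "(\<lambda>n. \<eta> n + \<bar>\<phi> (y n) - \<phi> x0\<bar>) \<longlonglongrightarrow> 0"
    using tendsto_add[OF \<eta>lim tendsto_rabs_zero] by simp
  then have "(\<lambda>n. \<bar>s n - u x0\<bar>) \<longlonglongrightarrow> 0"
    by (rule Lim_null_comparison[rotated]) (use s in auto)
  then have slim: "s \<longlonglongrightarrow> u x0" using LIM_zero_iff tendsto_rabs_zero_iff by blast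
  have "(\<lambda>n. g (y n)) \<longlonglongrightarrow> g x0"
    using \<phi> unfolding C1_with_gradient_def
    by (auto intro: continuous_on_tendsto_compose[OF _ ylim])
  then have "(\<lambda>n. g (y n) + (2 * 1) *\<^sub>R (y n - x0)) \<longlonglongrightarrow> g x0 + (2 * 1) *\<^sub>R (x0 - x0)"
    by (intro tendsto_intros ylim)
  then have "(\<lambda>n. (y n, s n, g (y n) + (2 * 1) *\<^sub>R (y n - x0))) \<longlonglongrightarrow> (x0, u x0, g x0)"
    by (intro tendsto_Pair ylim slim) auto
  from continuous_on_tendsto_compose[OF G this]
  have "(\<lambda>n. G (y n) (s n) (g (y n) + (2 * 1) *\<^sub>R (y n - x0))) \<longlonglongrightarrow> G x0 (u x0) (g x0)" by auto
  then show "G x0 (u x0) (g x0) \<le> 0"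
    using \<eta>lim Gn by (meson LIMSEQ_le)
qed

text \<open>Only quadratic test functions are needed: one such test at scale \<open>d\<close> reduces the increment over a
  distance \<open>d\<close> to one over a distance \<open>d / 2\<close> at cost \<open>K d\<close>, and the costs sum to \<open>2 K d\<close>.\<close>
lemma general_subsolution_lipschitz:
  assumes u: "continuous_on UNIV u" and bdd: "\<And>x. \<bar>u x\<bar> \<le> B" and K: "K > 0"
    and sub: "general_subsolution (\<lambda>x r q. norm q - K) u"
  shows "u z - u x \<le> 2 * K * norm (z - x)"
proof (cases "z = x")
  case True then show ?thesis by simp
next
  case False
  define d where "d = norm (z - x)"
  have d: "d > 0" using False by (simp add: d_def)
  have step: "\<exists>y. norm (y - x) \<le> e / 2 \<and> u w \<le> u y + K * e" if w: "norm (w - x) \<le> e" and e: "e > 0" for w e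
  proof -
    \<comment> \<open>At the maximum the test gradient has length
      \<open>2 * A * norm (y - x) \<le> K\<close>; this \<open>A\<close> turns that into the
      distance \<open>e / 2\<close>.\<close>
    define A where "A = K / e"
    have A: "A > 0" using K e by (simp add: A_def)
    \<comment> \<open>The base point stays fixed at \<open>x\<close>, so the first variable is a
      dummy ranging over the one-point compact set containing 0.\<close>
    have c: "continuous_on UNIV (\<lambda>(a::real, z). u (x + z))"
      unfolding split_beta by (rule continuous_on_compose2[OF u]) (auto intro!: continuous_intros)
    obtain a z where m: "\<And>a' z'. u (x + z') - A * (norm z')\<^sup>2 \<le> u (x + z) - A * (norm z)\<^sup>2"
      by (rule penalized_max_exists[OF c _ compact_insert[OF compact_empty, of 0] _ _ A])
         (use bdd in auto)
    define y where "y = x + z"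
    have "\<forall>\<^sub>F t in nhds y. u t - A * (norm (t - x))\<^sup>2 \<le> u y - A * (norm (y - x))\<^sup>2"
      by (rule always_eventually) (use m[of "_ - x"] in \<open>auto simp: y_def\<close>)
    from general_subsolutionD[OF sub C1_dist2 this]
    have "norm ((2 * A) *\<^sub>R (y - x)) \<le> K" by simp
    then have "2 * A * norm (y - x) \<le> K" using A by simp
    then have "norm (y - x) \<le> e / 2" using K e by (simp add: A_def field_simps)
    moreover have "u w - A * (norm (w - x))\<^sup>2 \<le> u y - A * (norm z)\<^sup>2"
      using m[of "w - x"] by (simp add: y_def)
    moreover have "A * (norm (w - x))\<^sup>2 \<le> A * e\<^sup>2"
      using w A by (intro mult_left_mono power_mono) auto
    moreover have "A * e\<^sup>2 = K * e" using e by (simp add: A_def power2_eq_square)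
    moreover have "A * (norm z)\<^sup>2 \<ge> 0" using A by simp
    ultimately show ?thesis by (intro exI[of _ y]) linarith
  qed
  have iter: "\<exists>y. norm (y - x) \<le> d / 2 ^ n \<and> u z \<le> u y + 2 * K * d * (1 - 1 / 2 ^ n)" for n
  proof (induction n)
    case 0
    then show ?case by (intro exI[of _ z]) (auto simp: d_def)
  next
    case (Suc n)
    then obtain y where y: "norm (y - x) \<le> d / 2 ^ n" "u z \<le> u y + 2 * K * d * (1 - 1 / 2 ^ n)" by blast
    obtain y' where y': "norm (y' - x) \<le> d / 2 ^ n / 2" "u y \<le> u y' + K * (d / 2 ^ n)"
      using step[OF y(1)] d by auto
    have "2 * K * d * (1 - 1 / 2 ^ n) + K * (d / 2 ^ n) = 2 * K * d * (1 - 1 / 2 ^ Suc n)"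
      by (simp add: field_simps)
    then show ?case using y y' by (intro exI[of _ y']) auto
  qed
  \<comment> \<open>The halving only approaches \<open>x\<close>; continuity of \<open>u\<close> at
    \<open>x\<close> closes the remaining gap.\<close>
  have "u z \<le> u x + 2 * K * d + e" if e: "e > 0" for e
  proof -
    obtain \<delta> where \<delta>: "\<delta> > 0" "\<And>y. dist y x < \<delta> \<Longrightarrow> dist (u y) (u x) < e"
      using u e unfolding continuous_on_iff by (metis UNIV_I)
    obtain n where n: "d / 2 ^ n < \<delta>"
      using real_arch_pow_inv[of "\<delta> / d" "1/2"] d \<delta> by (auto simp: field_simps power_divide)
    obtain y where y: "norm (y - x) \<le> d / 2 ^ n" "u z \<le> u y + 2 * K * d * (1 - 1 / 2 ^ n)"
      using iter by blast
    have "dist (u y) (u x) < e" using \<delta>(2)[of y] y(1) n by (simp add: dist_norm)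
    then have "u y < u x + e" by (simp add: dist_norm abs_less_iff)
    moreover have "2 * K * d * (1 - 1 / 2 ^ n) \<le> 2 * K * d * 1"
      using K d by (intro mult_left_mono) auto
    ultimately show ?thesis using y(2) by linarith
  qed
  then show ?thesis using d_def field_le_epsilon by (metis add.commute diff_le_eq)
qed

section \<open>Perron's method for the discounted problem\<close>

lemma C1_translate:
  assumes "C1_with_gradient f g"
  shows "C1_with_gradient (\<lambda>x. f (x + a)) (\<lambda>x. g (x + a))"
  unfolding C1_with_gradient_def
proof
  have g: "continuous_on UNIV g" using assms by (simp add: C1_with_gradient_def)
  show "continuous_on UNIV (\<lambda>x. g (x + a))"
    by (rule continuous_on_compose2[OF g]) (auto intro!: continuous_intros)
  show "\<forall>x. GDERIV (\<lambda>x. f (x + a)) x :> g (x + a)"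
  proof
    fix x
    have "(f has_derivative (\<lambda>h. h \<bullet> g (x + a))) (at (x + a))"
      using assms by (auto simp: C1_with_gradient_def gderiv_def)
    then have "((\<lambda>x. f (x + a)) has_derivative (\<lambda>h. h \<bullet> g (x + a))) (at x)"
      by (auto intro!: has_derivative_eq_rhs[OF has_derivative_compose[of "\<lambda>x. x + a" "\<lambda>h. h"]]
          derivative_eq_intros)
    then show "GDERIV (\<lambda>x. f (x + a)) x :> g (x + a)" by (simp add: gderiv_def)
  qed
qed

lemma eventually_nhds_translate:
  fixes x a :: "'a::real_normed_vector"
  assumes "\<forall>\<^sub>F y in nhds x. P y"
  shows "\<forall>\<^sub>F y in nhds (x + a). P (y - a)"
proof -
  have "((\<lambda>y. y - a) \<longlongrightarrow> (x + a) - a) (nhds (x + a))"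
    by (intro tendsto_diff tendsto_const filterlim_ident)
  then have "filterlim (\<lambda>y. y - a) (nhds x) (nhds (x + a))" by simp
  with assms show ?thesis by (simp add: filterlim_iff)
qed

lemma general_subsolution_translate:
  assumes v: "general_subsolution G v" and G: "\<And>x. G (x + k) = G x"
  shows "general_subsolution G (\<lambda>x. v (x + k))"
  unfolding general_subsolution_def
proof (intro allI impI, elim conjE)
  fix \<phi> g x
  assume \<phi>: "C1_with_gradient \<phi> g" and ev: "\<forall>\<^sub>F y in nhds x. v (y + k) - \<phi> y \<le> v (x + k) - \<phi> x"
  have "\<forall>\<^sub>F y in nhds (x + k). v y - \<phi> (y + - k) \<le> v (x + k) - \<phi> (x + k + - k)"
    using eventually_nhds_translate[OF ev, of k] by simp
  from general_subsolutionD[OF v C1_translate[OF \<phi>] this] show "G x (v (x + k)) (g x) \<le> 0"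
    by (simp add: G)
qed

lemma general_subsolution_shift_values:
  assumes "general_subsolution (\<lambda>x r. F x) u"
  shows "general_subsolution (\<lambda>x r. F x) (\<lambda>x. u x - a)"
  using assms unfolding general_subsolution_def by (simp add: algebra_simps)

text \<open>Perron's bump: a subsolution that fails to be a supersolution at \<open>x0\<close> is not maximal.\<close>
lemma general_subsolution_bump:
  assumes Gc: "continuous_on UNIV (\<lambda>(x, r, q). G x r q)"
    and G: "\<And>x q r s. r \<le> s \<Longrightarrow> G x r q \<le> G x s q"
    and u: "general_subsolution G u" "continuous_on UNIV u" "u x0 < B" "\<And>x. u x \<le> B"
    and \<phi>: "C1_with_gradient \<phi> g" and ev: "\<forall>\<^sub>F y in nhds x0. u x0 - \<phi> x0 \<le> u y - \<phi> y"
    and neg: "G x0 (u x0) (g x0) < 0"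
  obtains w where "general_subsolution G w" "continuous_on UNIV w" "\<And>x. u x \<le> w x" "\<And>x. w x \<le> B" "u x0 < w x0"
proof -
  \<comment> \<open>The function touching \<open>u\<close> from below, raised by
    \<open>\<eta>\<close> and bent down quadratically: it exceeds \<open>u\<close> at
    \<open>x0\<close>, but near \<open>x0\<close> it lies below \<open>u\<close> once the squared
    distance exceeds \<open>\<eta>\<close>.\<close>
  define b where "b \<eta> y = \<phi> y + (-1) * (norm (y - x0))\<^sup>2 + (u x0 - \<phi> x0 + \<eta>)" for \<eta> y
  define gb where "gb y = g y + (2 * (-1)) *\<^sub>R (y - x0) + 0" for y
  have b: "C1_with_gradient (b \<eta>) gb" for \<eta>
    unfolding b_def gb_def by (intro C1_add C1_dist2 C1_const \<phi>)
  have gbc: "continuous_on UNIV gb" using b unfolding C1_with_gradient_def by auto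
  have bc: "continuous_on UNIV (\<lambda>p. b (fst p) (snd p))"
    unfolding b_def
    by (intro continuous_intros continuous_on_compose2[OF C1_continuous[OF \<phi>, of UNIV]]) auto
  have Gc': "continuous_on UNIV (\<lambda>p. G (snd p) (b (fst p) (snd p)) (gb (snd p)))"
  proof -
    have "continuous_on UNIV (\<lambda>p. (snd p, b (fst p) (snd p), gb (snd p)))"
      by (intro continuous_intros bc continuous_on_compose2[OF gbc]) auto
    from continuous_on_compose2[OF Gc this] show ?thesis by simp
  qed
  \<comment> \<open>Staying below \<open>B\<close> and satisfying the strict inequality are open
    conditions on \<open>(\<eta>, y)\<close> jointly, and both hold at \<open>(0, x0)\<close>. This
    yields one range of \<open>\<eta>\<close> and one ball that suit each other.\<close>
  have 1: "\<forall>\<^sub>F p in nhds (0, x0). p \<in> {p. b (fst p) (snd p) < B}"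
    by (intro eventually_nhds_in_open open_Collect_less bc continuous_on_const) (simp add: b_def u)
  have 2: "\<forall>\<^sub>F p in nhds (0, x0). p \<in> {p. G (snd p) (b (fst p) (snd p)) (gb (snd p)) < 0}"
    by (intro eventually_nhds_in_open open_Collect_less Gc' continuous_on_const)
      (simp add: b_def gb_def neg)
  obtain P Q where PQ: "\<forall>\<^sub>F y in nhds (0::real). P y" "\<forall>\<^sub>F y in nhds x0. Q y"
    "\<And>\<eta> y. P \<eta> \<Longrightarrow> Q y \<Longrightarrow> b \<eta> y < B \<and> G y (b \<eta> y) (gb y) < 0"
    using eventually_conj[OF 1 2] unfolding nhds_prod eventually_prod_filter by auto
  obtain e where e: "e > 0" "\<And>\<eta>. \<bar>\<eta>\<bar> < e \<Longrightarrow> P \<eta>"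
    using PQ(1) unfolding eventually_nhds_metric by (auto simp: dist_norm)
  obtain r where r: "r > 0" "\<And>y. y \<in> ball x0 r \<Longrightarrow> Q y \<and> u x0 - \<phi> x0 \<le> u y - \<phi> y"
    using eventually_conj[OF PQ(2) ev] unfolding eventually_nhds_metric by (auto simp: dist_commute)
  \<comment> \<open>\<open>\<eta> < r\<^sup>2\<close> makes the bump sink below \<open>u\<close>
    before the boundary of the ball, so the two branches of \<open>w\<close> agree on an overlap and
    \<open>w\<close> is continuous.\<close>
  define \<eta> where "\<eta> = min (e / 2) (r\<^sup>2 / 2)"
  have \<eta>: "\<eta> > 0" "\<eta> < e" "\<eta> < r\<^sup>2" using e(1) r(1) by (auto simp: \<eta>_def min_def)
  have bB: "b \<eta> y < B \<and> G y (b \<eta> y) (gb y) < 0" if "y \<in> ball x0 r" for y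
    using PQ(3) e(2)[of \<eta>] r(2)[OF that] \<eta> by auto
  have bu: "b \<eta> y < u y" if "y \<in> ball x0 r" "(norm (y - x0))\<^sup>2 > \<eta>" for y
    using r(2)[OF that(1)] that(2) by (simp add: b_def)
  define w where "w y = (if y \<in> ball x0 r then max (u y) (b \<eta> y) else u y)" for y
  define T where "T = {y. (norm (y - x0))\<^sup>2 > \<eta>}"
  have T: "open T" unfolding T_def by (intro open_Collect_less continuous_intros)
  have wT: "w y = u y" if "y \<in> T" for y using bu[of y] that by (auto simp: w_def T_def)
  have cov: "ball x0 r \<union> T = UNIV"
  proof -
    have "y \<in> T" if "\<not> norm (y - x0) < r" for y
    proof -
      have "r\<^sup>2 \<le> (norm (y - x0))\<^sup>2" using that r(1) by (intro power_mono) auto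
      then show ?thesis using \<eta> by (simp add: T_def)
    qed
    then have "y \<in> ball x0 r \<or> y \<in> T" for y
      by (metis dist_commute dist_norm mem_ball)
    then show ?thesis by blast
  qed
  have "continuous_on (ball x0 r) (\<lambda>y. max (u y) (b \<eta> y))"
    by (intro continuous_intros C1_continuous[OF b] continuous_on_subset[OF u(2)]) auto
  then have "continuous_on (ball x0 r) w" by (rule continuous_on_eq) (auto simp: w_def)
  moreover have "continuous_on T w"
    by (rule continuous_on_eq[OF continuous_on_subset[OF u(2)]]) (auto simp: wT)
  ultimately have "continuous_on (ball x0 r \<union> T) w" using T by (intro continuous_on_open_Un) auto
  then have wc: "continuous_on UNIV w" by (simp add: cov)
  have uw: "u y \<le> w y" for y by (auto simp: w_def)
  have wB: "w y \<le> B" for y using bB[of y] u(4)[of y] by (auto simp: w_def max_def)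
  have "general_subsolution G w"
    unfolding general_subsolution_def
  proof (intro allI impI, elim conjE)
    fix \<psi> h y
    assume \<psi>: "C1_with_gradient \<psi> h" and ev: "\<forall>\<^sub>F z in nhds y. w z - \<psi> z \<le> w y - \<psi> y"
    show "G y (w y) (h y) \<le> 0"
    proof (cases "w y = u y")
      case True
      have "\<forall>\<^sub>F z in nhds y. u z - \<psi> z \<le> u y - \<psi> y"
        using ev by eventually_elim (use True uw in \<open>smt (verit)\<close>)
      from general_subsolutionD[OF u(1) \<psi> this] show ?thesis by (simp add: True)
    next
      case False
      then have y: "y \<in> ball x0 r" "w y = b \<eta> y" by (auto simp: w_def max_def split: if_splits)
      have "\<forall>\<^sub>F z in nhds y. z \<in> ball x0 r" using y(1) by (intro eventually_nhds_in_open) auto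
      then have "\<forall>\<^sub>F z in nhds y. b \<eta> z - \<psi> z \<le> b \<eta> y - \<psi> y"
        using ev by eventually_elim (use y in \<open>auto simp: w_def\<close>)
      from C1_gradient_eq_at_max[OF b \<psi> this] bB[OF y(1)] y(2) show ?thesis by simp
    qed
  qed
  moreover have "u x0 < w x0" using r(1) \<eta>(1) by (simp add: w_def b_def)
  ultimately show ?thesis using wc uw wB that by blast
qed

lemma lipschitz_onI_diff:
  fixes u :: "'a::real_normed_vector \<Rightarrow> real"
  assumes "\<And>x y. u x - u y \<le> L * norm (x - y)" "L \<ge> 0"
  shows "L-lipschitz_on UNIV u"
proof (rule lipschitz_onI)
  fix x y
  show "dist (u x) (u y) \<le> L * dist x y"
    using assms(1)[of x y] assms(1)[of y x] by (auto simp: dist_norm norm_minus_commute)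
qed (use assms in auto)

text \<open>The constants \<open>- M / l\<close> and \<open>M / l\<close> act as barriers. A
  competitor above the lower one satisfies \<open>H x q \<le> M\<close> at its test gradients, so
  coercivity bounds those gradients by \<open>K\<close>. The resulting Lipschitz constant does not
  depend on \<open>l\<close>, which is what the passage to vanishing discount relies on.\<close>

lemma perron_discounted:
  fixes H :: "real^'n::finite \<Rightarrow> real^'n \<Rightarrow> real"
  assumes H: "continuous_on UNIV (\<lambda>(x, q). H x q)" and l: "l > 0" and K: "K > 0"
    and M: "\<And>x. \<bar>H x 0\<bar> \<le> M" and coercive: "\<And>x q. H x q \<le> M \<Longrightarrow> norm q \<le> K"
    and per: "\<And>x k. (\<forall>i. k $ i \<in> \<int>) \<Longrightarrow> H (x + k) = H x"
  obtains u where "general_subsolution (\<lambda>x r q. l * r + H x q) u" "general_subsolution (\<lambda>x r q. l * r - H x (- q)) (\<lambda>x. - u x)"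
    "\<And>x. \<bar>l * u x\<bar> \<le> M" "\<And>x y. u x - u y \<le> 2 * K * norm (x - y)" "Zn_periodic u"
proof -
  define G where "G x r q = l * r + H x q" for x r q
  define S where "S = {v. continuous_on UNIV v \<and> (\<forall>x. - M \<le> l * v x \<and> l * v x \<le> M) \<and> general_subsolution G v}"
  have M0: "M \<ge> 0" using M[of 0] by linarith
  have Gc: "continuous_on UNIV (\<lambda>(x, r, q). G x r q)"
    unfolding G_def split_beta
    by (intro continuous_intros continuous_on_compose2[OF H[unfolded split_beta], where f="\<lambda>p. (fst p, snd (snd p))", simplified])
  have Gmono: "r \<le> s \<Longrightarrow> G x r q \<le> G x s q" for x r s q
    using l by (simp add: G_def)
  have "general_subsolution G (\<lambda>x. - M / l)"
    unfolding general_subsolution_def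
  proof (intro allI impI, elim conjE)
    fix \<phi> g and x :: "real^'n"
    assume *: "C1_with_gradient \<phi> g" "\<forall>\<^sub>F y in nhds x. - M / l - \<phi> y \<le> - M / l - \<phi> x"
    have "g x = 0" using C1_gradient_eq_at_max[OF C1_const *] by simp
    then show "G x (- M / l) (g x) \<le> 0" using M[of x] l by (auto simp: G_def)
  qed
  then have S0: "(\<lambda>x. - M / l) \<in> S" using l M0 by (auto simp: S_def)
  have lip: "v x - v y \<le> 2 * K * norm (x - y)" if "v \<in> S" for v x y
  proof (rule general_subsolution_lipschitz[OF _ _ K])
    show "continuous_on UNIV v" using that by (simp add: S_def)
    show "\<bar>v x\<bar> \<le> M / l" for x
    proof -
      have "- M \<le> l * v x" "l * v x \<le> M" using that by (auto simp: S_def)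
      then have "\<bar>l * v x\<bar> \<le> M" by linarith
      then show ?thesis using l by (simp add: abs_mult field_simps)
    qed
    show "general_subsolution (\<lambda>x r q. norm q - K) v"
    proof (rule general_subsolution_mono)
      show "general_subsolution G v" using that by (simp add: S_def)
      fix x q assume "G x (v x) q \<le> 0"
      moreover have "- M \<le> l * v x" using that by (auto simp: S_def)
      ultimately have "H x q \<le> M" by (simp add: G_def)
      then show "norm q - K \<le> 0" using coercive by simp
    qed
  qed
  define u where "u x = (SUP v\<in>S. v x)" for x
  have bdd: "bdd_above ((\<lambda>v. v x) ` S)" for x
    by (rule bdd_aboveI[of _ "M / l"]) (use l in \<open>auto simp: S_def field_simps\<close>)
  have up: "v x \<le> u x" if "v \<in> S" for v x
    unfolding u_def by (rule cSUP_upper[OF that bdd])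
  have least: "u x \<le> c" if "\<And>v. v \<in> S \<Longrightarrow> v x \<le> c" for x c
    unfolding u_def by (rule cSUP_least) (use S0 that in auto)
  have ulip: "u x - u y \<le> 2 * K * norm (x - y)" for x y
  proof -
    have "u x \<le> u y + 2 * K * norm (x - y)"
    proof (rule least)
      fix v assume "v \<in> S"
      from lip[OF this, of x y] up[OF this, of y] show "v x \<le> u y + 2 * K * norm (x - y)" by linarith
    qed
    then show ?thesis by simp
  qed
  have "(2 * K)-lipschitz_on UNIV u" using ulip K by (intro lipschitz_onI_diff) auto
  then have uc: "continuous_on UNIV u" by (rule lipschitz_on_continuous_on)
  have uM: "u x \<le> M / l" for x
    by (rule least) (use l in \<open>auto simp: S_def field_simps\<close>)
  have uM': "- M / l \<le> u x" for x using up[OF S0] .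
  have sub: "general_subsolution G u"
  proof (rule general_subsolution_of_approximations[OF Gc])
    fix x0 :: "real^'n" and \<eta> :: real assume \<eta>: "\<eta> > 0"
    have "\<exists>v\<in>S. u x0 - \<eta> < v x0"
      unfolding u_def using less_cSUP_iff[OF _ bdd, of "u x0 - \<eta>" x0] S0 \<eta>
      by (auto simp: u_def)
    then obtain v where v: "v \<in> S" "u x0 - \<eta> < v x0" by blast
    have "general_subsolution (\<lambda>x r q. G x r q - \<eta>) v"
      by (rule general_subsolution_mono[of G]) (use v \<eta> in \<open>auto simp: S_def\<close>)
    moreover have "v y \<le> u y + \<eta>" for y using up[OF v(1), of y] \<eta> by linarith
    ultimately show "\<exists>v. continuous_on UNIV v \<and> general_subsolution (\<lambda>x r q. G x r q - \<eta>) v \<and>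
        u x0 - \<eta> \<le> v x0 \<and> (\<forall>y. v y \<le> u y + \<eta>)"
      using v by (intro exI[of _ v]) (auto simp: S_def)
  qed
  have sup: "general_subsolution (\<lambda>x r q. l * r - H x (- q)) (\<lambda>x. - u x)"
    unfolding general_subsolution_def
  proof (intro allI impI, elim conjE)
    fix \<phi> g x0
    assume \<phi>: "C1_with_gradient \<phi> g" and ev: "\<forall>\<^sub>F y in nhds x0. - u y - \<phi> y \<le> - u x0 - \<phi> x0"
    show "l * - u x0 - H x0 (- g x0) \<le> 0"
    proof (rule ccontr)
      assume "\<not> ?thesis"
      then have neg: "G x0 (u x0) (- g x0) < 0" by (simp add: G_def)
      have \<phi>': "C1_with_gradient (\<lambda>x. - \<phi> x) (\<lambda>x. - g x)" using \<phi> by (simp add: C1_minus_iff)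
      have ev': "\<forall>\<^sub>F y in nhds x0. u x0 - - \<phi> x0 \<le> u y - - \<phi> y"
        using ev by eventually_elim linarith
      \<comment> \<open>The bump needs room below the upper barrier. At a contact point
        \<open>u\<close> is maximal, so the test gradient vanishes and
        \<open>H x0 0 \<ge> - M\<close> contradicts \<open>neg\<close>.\<close>
      have "u x0 \<noteq> M / l"
      proof
        assume eq: "u x0 = M / l"
        have "\<forall>\<^sub>F y in nhds x0. - \<phi> y \<le> - \<phi> x0"
          using ev' by eventually_elim (use uM eq in \<open>smt (verit)\<close>)
        then have "- g x0 = 0" by (rule C1_gradient_zero_at_max[OF \<phi>'])
        then show False using neg eq M[of x0] l by (simp add: G_def)
      qed
      then have "u x0 < M / l" using uM[of x0] by linarith
      then obtain w where w: "general_subsolution G w" "continuous_on UNIV w" "\<And>x. u x \<le> w x" "\<And>x. w x \<le> M / l" "u x0 < w x0"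
        using general_subsolution_bump[OF Gc Gmono sub uc _ uM \<phi>' ev' neg] by blast
      have "- M / l \<le> w x" for x using uM'[of x] w(3)[of x] by linarith
      then have "w \<in> S" using w l by (auto simp: S_def field_simps)
      then show False using up[of w x0] w(5) by simp
    qed
  qed
  \<comment> \<open>Integer translations map the family of competitors into itself, and the
    inequality for both \<open>k\<close> and \<open>- k\<close> gives periodicity of the
    supremum.\<close>
  have tr: "u (x + k) \<le> u x" if k: "\<forall>i. k $ i \<in> \<int>" for x k
  proof (rule least)
    fix v assume v: "v \<in> S"
    have vc: "continuous_on UNIV v" using v by (auto simp: S_def)
    have "G (x + k) = G x" for x by (intro ext) (simp add: G_def per[OF k])
    then have "general_subsolution G (\<lambda>x. v (x + k))" using v by (intro general_subsolution_translate) (auto simp: S_def)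
    then have "(\<lambda>x. v (x + k)) \<in> S"
      using v
      by (auto simp: S_def intro!: continuous_on_compose2[OF vc] continuous_intros)
    from up[OF this, of x] show "v (x + k) \<le> u x" .
  qed
  have "Zn_periodic u"
    unfolding Zn_periodic_def
  proof (intro allI impI)
    fix x k :: "real^'n" assume k: "\<forall>i. k $ i \<in> \<int>"
    then have "\<forall>i. (- k) $ i \<in> \<int>" by auto
    from tr[OF this, of "x + k"] tr[OF k, of x] show "u (x + k) = u x" by simp
  qed
  moreover have "\<bar>l * u x\<bar> \<le> M" for x using uM[of x] uM'[of x] l by (auto simp: abs_le_iff field_simps)
  ultimately show ?thesis using that[of u] sub[unfolded G_def[abs_def]] sup ulip by blast
qed

section \<open>Periodic functions and reduction to the unit cube\<close>

definition integer_part :: "real^'n::finite \<Rightarrow> real^'n" where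
  "integer_part x = (\<chi> i. of_int \<lfloor>x $ i\<rfloor>)"

lemma integer_part_int: "integer_part x $ i \<in> \<int>"
  by (simp add: integer_part_def)

lemma diff_integer_part_mem: "x - integer_part x \<in> cbox 0 1"
  unfolding mem_box_cart integer_part_def by (auto simp: algebra_simps) linarith

lemma Zn_periodic_integer_part: "Zn_periodic f \<Longrightarrow> f (x - integer_part x) = f x"
  using integer_part_int unfolding Zn_periodic_def by (metis add.commute diff_add_cancel)

lemma integer_part_add:
  assumes "\<forall>i. k $ i \<in> \<int>" shows "integer_part (x + k) = integer_part x + k"
proof (rule vec_eq_iff[THEN iffD2], rule allI)
  fix i
  obtain m where "k $ i = of_int m" using assms by (auto elim: Ints_cases)
  then show "integer_part (x + k) $ i = (integer_part x + k) $ i" by (simp add: integer_part_def)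
qed

lemma Zn_periodic_bounded:
  fixes f :: "real^'n::finite \<Rightarrow> 'b::real_normed_vector"
  assumes "continuous_on UNIV f" "Zn_periodic f"
  obtains B where "B > 0" "\<And>x. norm (f x) \<le> B"
proof -
  have "compact (f ` cbox 0 1)"
    by (intro compact_continuous_image continuous_on_subset[OF assms(1)]) auto
  then obtain B where B: "B > 0" "\<And>y. y \<in> f ` cbox 0 1 \<Longrightarrow> norm y \<le> B"
    using bounded_pos[of "f ` cbox 0 1"] compact_imp_bounded by blast
  show ?thesis
  proof (rule that[OF B(1)])
    fix x show "norm (f x) \<le> B"
      using B(2)[of "f (x - integer_part x)"] diff_integer_part_mem[of x] Zn_periodic_integer_part[OF assms(2), of x]
      by (metis image_eqI)
  qed
qed

section \<open>The cell problem\<close>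

text \<open>Vanishing discount. Subtracting \<open>U n 0\<close> leaves uniformly bounded,
  equi-Lipschitz functions, to which Arzela-Ascoli applies on the cube; the subtracted value times
  the discount stays between \<open>- M\<close> and \<open>M\<close> and supplies the constant along
  a further subsequence.\<close>

lemma ergodic_problem_solution:
  fixes H :: "real^'n::finite \<Rightarrow> real^'n \<Rightarrow> real"
  assumes H: "continuous_on UNIV (\<lambda>(x, q). H x q)" and K: "K > 0"
    and M: "\<And>x. \<bar>H x 0\<bar> \<le> M" and coercive: "\<And>x q. H x q \<le> M \<Longrightarrow> norm q \<le> K"
    and per: "\<And>x k. (\<forall>i. k $ i \<in> \<int>) \<Longrightarrow> H (x + k) = H x"
  obtains c u where "general_subsolution (\<lambda>x r q. H x q - c) u" "general_subsolution (\<lambda>x r q. c - H x (- q)) (\<lambda>x. - u x)"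
    "(2 * K)-lipschitz_on UNIV u" "Zn_periodic u"
proof -
  define l where "l n = inverse (real (Suc n))" for n
  have l0: "l n > 0" for n by (simp add: l_def)
  have llim: "l \<longlonglongrightarrow> 0" unfolding l_def by (rule LIMSEQ_inverse_real_of_nat)
  have "\<exists>u. general_subsolution (\<lambda>x r q. l n * r + H x q) u \<and> general_subsolution (\<lambda>x r q. l n * r - H x (- q)) (\<lambda>x. - u x)
    \<and> (\<forall>x. \<bar>l n * u x\<bar> \<le> M) \<and> (\<forall>x y. u x - u y \<le> 2 * K * norm (x - y)) \<and> Zn_periodic u" for n
    by (rule perron_discounted[OF H l0[of n] K M coercive per]) auto
  then obtain U where Usub: "\<And>n. general_subsolution (\<lambda>x r q. l n * r + H x q) (U n)"
    and Usup: "\<And>n. general_subsolution (\<lambda>x r q. l n * r - H x (- q)) (\<lambda>x. - U n x)"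
    and UM: "\<And>n x. \<bar>l n * U n x\<bar> \<le> M"
    and Ulip: "\<And>n x y. U n x - U n y \<le> 2 * K * norm (x - y)" and Uper: "\<And>n. Zn_periodic (U n)"
    by metis
  define w where "w n x = U n x - U n 0" for n x
  have wlip: "w n x - w n y \<le> 2 * K * norm (x - y)" for n x y
    using Ulip[of n x y] by (simp add: w_def)
  have wlip': "\<bar>w n x - w n y\<bar> \<le> 2 * K * norm (x - y)" for n x y
    using wlip[of n x y] wlip[of n y x] by (simp add: norm_minus_commute abs_le_iff)
  have wper: "Zn_periodic (w n)" for n using Uper[of n] by (auto simp: Zn_periodic_def w_def)
  obtain R where R: "R > 0" "\<And>x. x \<in> cbox 0 (1::real^'n) \<Longrightarrow> norm x \<le> R"
    using bounded_pos[of "cbox 0 (1::real^'n)"] by auto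
  have wR: "\<bar>w n x\<bar> \<le> 2 * K * R" for n x
  proof -
    have "\<bar>w n (x - integer_part x) - w n 0\<bar> \<le> 2 * K * norm (x - integer_part x)" using wlip'[of n "x - integer_part x" 0] by simp
    also have "\<dots> \<le> 2 * K * R" using R(2)[OF diff_integer_part_mem] K by (intro mult_left_mono) auto
    finally show ?thesis using Zn_periodic_integer_part[OF wper] by (simp add: w_def)
  qed
  obtain g k where k: "strict_mono (k :: nat \<Rightarrow> nat)"
    and g: "\<And>e. 0 < e \<Longrightarrow> \<exists>N. \<forall>n x. n \<ge> N \<and> x \<in> cbox 0 1 \<longrightarrow> norm (w (k n) x - g x) < e"
  proof (rule Arzela_Ascoli[of "cbox 0 (1::real^'n)" w "2 * K * R"])
    show "\<exists>d>0. \<forall>n y. y \<in> cbox 0 1 \<and> norm (x - y) < d \<longrightarrow> norm (w n x - w n y) < e"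
      if "e > 0" for e :: real and x
    proof (intro exI[of _ "e / (2 * K)"] conjI allI impI, goal_cases)
      case 1 then show ?case using that K by simp
    next
      case (2 n y)
      then have "2 * K * norm (x - y) < e" using K by (simp add: field_simps)
      then show ?case using wlip'[of n x y] by simp
    qed
  qed (use wR in auto)
  define a where "a n = l (k n) * U (k n) 0" for n
  have "a n \<in> {-M..M}" for n using UM[of "k n" 0] by (auto simp: a_def abs_le_iff)
  then obtain c' r where r: "strict_mono (r :: nat \<Rightarrow> nat)" "(a \<circ> r) \<longlonglongrightarrow> c'"
    using compact_imp_seq_compact[OF compact_Icc, of "-M" M] unfolding seq_compact_def by metis
  define u where "u x = g (x - integer_part x)" for x
  have unif: "\<exists>N. \<forall>n\<ge>N. \<forall>x. \<bar>w (k (r n)) x - u x\<bar> < e" if e: "e > 0" for e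
  proof -
    obtain N where N: "\<And>n x. n \<ge> N \<Longrightarrow> x \<in> cbox 0 1 \<Longrightarrow> norm (w (k n) x - g x) < e"
      using g[OF e] by blast
    have "\<bar>w (k (r n)) x - u x\<bar> < e" if "n \<ge> N" for n x
    proof -
      have "r n \<ge> N" using seq_suble[OF r(1), of n] that by linarith
      then show ?thesis
        using N[of "r n" "x - integer_part x"] diff_integer_part_mem[of x] Zn_periodic_integer_part[OF wper, of "k (r n)" x]
        by (simp add: u_def)
    qed
    then show ?thesis by blast
  qed
  have "u x - u y \<le> 2 * K * norm (x - y)" for x y
  proof (rule field_le_epsilon)
    fix e :: real assume "e > 0"
    then obtain N where N: "\<And>x. \<bar>w (k (r N)) x - u x\<bar> < e / 2" using unif[of "e / 2"] by auto
    show "u x - u y \<le> 2 * K * norm (x - y) + e"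
      using N[of x] N[of y] wlip[of "k (r N)" x y] unfolding abs_less_iff by linarith
  qed
  then have ulip: "(2 * K)-lipschitz_on UNIV u" using K by (intro lipschitz_onI_diff) auto
  have uper: "Zn_periodic u"
    unfolding Zn_periodic_def u_def by (auto simp: integer_part_add)
  have main: "\<exists>n. \<forall>x. \<bar>w n x - u x\<bar> \<le> \<eta> \<and> \<bar>l n * U n x - c'\<bar> \<le> \<eta>" if \<eta>: "\<eta> > 0" for \<eta>
  proof -
    obtain N1 where N1: "\<And>n x. n \<ge> N1 \<Longrightarrow> \<bar>w (k (r n)) x - u x\<bar> < \<eta>" using unif[OF \<eta>] by blast
    have "\<forall>\<^sub>F n in sequentially. dist ((a \<circ> r) n) c' < \<eta> / 2" using tendstoD[OF r(2), of "\<eta> / 2"] \<eta> by simp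
    then obtain N2 where N2: "\<And>n. n \<ge> N2 \<Longrightarrow> \<bar>a (r n) - c'\<bar> < \<eta> / 2"
      unfolding eventually_sequentially by (auto simp: dist_norm)
    \<comment> \<open>Since \<open>w\<close> is bounded by \<open>2 * K * R\<close>, this makes
      \<open>l m * w m x\<close> at most \<open>\<eta> / 2\<close> uniformly in
      \<open>x\<close>.\<close>
    have "\<forall>\<^sub>F n in sequentially. l n < \<eta> / (4 * K * R)"
      using llim \<eta> K R(1) by (intro order_tendstoD) auto
    then obtain N3 where N3: "\<And>n. n \<ge> N3 \<Longrightarrow> l n < \<eta> / (4 * K * R)"
      unfolding eventually_sequentially by auto
    define n where "n = max N1 (max N2 N3)"
    define m where "m = k (r n)"
    have "m \<ge> n" unfolding m_def using seq_suble[OF r(1), of n] seq_suble[OF k, of "r n"] by linarith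
    then have lm: "l m < \<eta> / (4 * K * R)" using N3[of m] by (simp add: n_def)
    have "\<bar>l m * U m x - c'\<bar> \<le> \<eta>" for x
    proof -
      have "l m * U m x - c' = l m * w m x + (a (r n) - c')"
        by (simp add: a_def w_def m_def algebra_simps)
      moreover have "\<bar>l m * w m x\<bar> \<le> \<eta> / 2"
      proof -
        have "\<bar>l m * w m x\<bar> = l m * \<bar>w m x\<bar>" using l0[of m] by (simp add: abs_mult)
        also have "\<dots> \<le> \<eta> / (4 * K * R) * (2 * K * R)"
          using lm wR l0[of m] \<eta> K R(1) by (intro mult_mono) auto
        also have "\<dots> = \<eta> / 2" using K R(1) by (simp add: field_simps)
        finally show ?thesis .
      qed
      moreover have "\<bar>a (r n) - c'\<bar> < \<eta> / 2" using N2[of n] by (simp add: n_def)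
      ultimately show ?thesis by linarith
    qed
    moreover have "\<bar>w m x - u x\<bar> \<le> \<eta>" for x using N1[of n x] by (simp add: n_def m_def)
    ultimately show ?thesis by blast
  qed
  have wc: "continuous_on UNIV (w n)" for n
    by (rule lipschitz_on_continuous_on[OF lipschitz_onI_diff[OF wlip]]) (use K in auto)
  have Hc: "continuous_on UNIV (\<lambda>(x, r::real, q). H x q + c')"
    unfolding split_beta
    by (intro continuous_intros continuous_on_compose2[OF H[unfolded split_beta], where f="\<lambda>p. (fst p, snd (snd p))", simplified])
  have Hc': "continuous_on UNIV (\<lambda>(x, r::real, q). - c' - H x (- q))"
    unfolding split_beta
    by (intro continuous_intros continuous_on_compose2[OF H[unfolded split_beta], where f="\<lambda>p. (fst p, - snd (snd p))", simplified])
  show ?thesis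
  \<comment> \<open>In the limit the discount term \<open>l n * U n x\<close> becomes
    \<open>c'\<close>, so the Hamiltonian equals \<open>- c'\<close>.\<close>
  proof (rule that[of "- c'" u])
    show "general_subsolution (\<lambda>x r q. H x q - - c') u"
      unfolding diff_minus_eq_add
    proof (rule general_subsolution_of_approximations[OF Hc])
      fix x0 :: "real^'n" and \<eta> :: real assume "\<eta> > 0"
      then obtain n where n: "\<And>x. \<bar>w n x - u x\<bar> \<le> \<eta>" "\<And>x. \<bar>l n * U n x - c'\<bar> \<le> \<eta>"
        using main by blast
      have "general_subsolution (\<lambda>x r q. H x q + c' - \<eta>) (U n)"
        by (rule general_subsolution_mono[OF Usub[of n]]) (use n(2) in \<open>smt (verit)\<close>)
      from general_subsolution_shift_values[OF this, of "U n 0"]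
      have "general_subsolution (\<lambda>x r q. H x q + c' - \<eta>) (w n)" by (simp add: w_def[abs_def])
      moreover have "w n y \<le> u y + \<eta>" "u y - \<eta> \<le> w n y" for y using n(1)[of y] by linarith+
      ultimately show "\<exists>v. continuous_on UNIV v \<and> general_subsolution (\<lambda>x r q. H x q + c' - \<eta>) v \<and>
        u x0 - \<eta> \<le> v x0 \<and> (\<forall>y. v y \<le> u y + \<eta>)"
        using wc by blast
    qed
    show "general_subsolution (\<lambda>x r q. - c' - H x (- q)) (\<lambda>x. - u x)"
    proof (rule general_subsolution_of_approximations[OF Hc'])
      fix x0 :: "real^'n" and \<eta> :: real assume "\<eta> > 0"
      then obtain n where n: "\<And>x. \<bar>w n x - u x\<bar> \<le> \<eta>" "\<And>x. \<bar>l n * U n x - c'\<bar> \<le> \<eta>"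
        using main by blast
      have "general_subsolution (\<lambda>x r q. - c' - H x (- q) - \<eta>) (\<lambda>x. - U n x)"
      proof (rule general_subsolution_mono[OF Usup[of n]])
        fix x q assume "l n * - U n x - H x (- q) \<le> 0"
        then show "- c' - H x (- q) - \<eta> \<le> 0" using n(2)[of x] by (simp add: abs_le_iff)
      qed
      from general_subsolution_shift_values[OF this, of "- U n 0"]
      have "general_subsolution (\<lambda>x r q. - c' - H x (- q) - \<eta>) (\<lambda>x. - w n x)" by (simp add: w_def[abs_def])
      moreover have "- w n y \<le> - u y + \<eta>" "- u y - \<eta> \<le> - w n y" for y using n(1)[of y] by linarith+
      moreover have "continuous_on UNIV (\<lambda>x. - w n x)" by (intro continuous_intros wc)
      ultimately show "\<exists>v. continuous_on UNIV v \<and> general_subsolution (\<lambda>x r q. - c' - H x (- q) - \<eta>) v \<and>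
        - u x0 - \<eta> \<le> v x0 \<and> (\<forall>y. v y \<le> - u y + \<eta>)"
        by blast
    qed
  qed (use ulip uper in auto)
qed

lemma cell_problem_solution_exists:
  fixes W :: "real^'n::finite \<Rightarrow> real^'n"
  assumes W: "continuous_on UNIV W" "Zn_periodic W"
  shows "\<exists>c u. cell_problem_solution W p c u"
proof -
  define H where "H x q = (norm (p + q))\<^sup>2 + W x \<bullet> (p + q)" for x q
  obtain B where B: "B > 0" "\<And>x. norm (W x) \<le> B" using Zn_periodic_bounded[OF W] by blast
  have WB: "\<bar>W x \<bullet> v\<bar> \<le> B * norm v" for x v
    using Cauchy_Schwarz_ineq2[of "W x" v] mult_right_mono[OF B(2)[of x], of "norm v"] by auto
  define M where "M = (norm p)\<^sup>2 + B * norm p"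
  have M0: "M \<ge> 0" using B by (simp add: M_def)
  \<comment> \<open>If \<open>norm (p + q)\<close> exceeded \<open>B + M + 1\<close>, then
    \<open>norm (p + q) * (norm (p + q) - B)\<close> would be at least \<open>M + 1\<close>; the
    last summand passes from \<open>p + q\<close> to \<open>q\<close>.\<close>
  define K where "K = B + M + 1 + norm p"
  have K: "K > 0" using B M0 by (simp add: K_def add_pos_nonneg add_nonneg_pos)
  have Hc: "continuous_on UNIV (\<lambda>(x, q). H x q)"
    unfolding H_def split_beta
    by (intro continuous_intros continuous_on_compose2[OF W(1)]) auto
  have H0: "\<bar>H x 0\<bar> \<le> M" for x
  proof -
    have "H x 0 = (norm p)\<^sup>2 + W x \<bullet> p" by (simp add: H_def)
    then show ?thesis
      using WB[of x p] zero_le_power2[of "norm p"] unfolding M_def by linarith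
  qed
  have co: "norm q \<le> K" if "H x q \<le> M" for x q
  proof -
    have 1: "norm (p + q) * (norm (p + q) - B) \<le> M"
      using that WB[of x "p + q"] unfolding H_def
      by (simp add: algebra_simps power2_eq_square abs_le_iff)
    have "norm (p + q) \<le> B + M + 1"
    proof (rule ccontr)
      assume "\<not> ?thesis"
      then have "1 * (M + 1) \<le> norm (p + q) * (norm (p + q) - B)"
        using M0 B(1) by (intro mult_mono) auto
      then show False using 1 by simp
    qed
    then show ?thesis using norm_triangle_ineq4[of "p + q" p] by (simp add: K_def)
  qed
  have Hper: "H (x + k) = H x" if "\<forall>i. k $ i \<in> \<int>" for x k
    using W(2) that by (auto simp: H_def Zn_periodic_def)
  obtain c u where "general_subsolution (\<lambda>x r q. H x q - c) u" "general_subsolution (\<lambda>x r q. c - H x (- q)) (\<lambda>x. - u x)"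
    "(2 * K)-lipschitz_on UNIV u" "Zn_periodic u"
    by (rule ergodic_problem_solution[OF Hc K H0 co Hper])
  then show ?thesis
    unfolding cell_problem_solution_def viscosity_solution_def viscosity_subsolution_general_subsolution
      viscosity_supersolution_general_subsolution H_def
    by (blast intro: lipschitz_on_continuous_on)
qed

section \<open>Uniqueness and bounds for the effective Hamiltonian\<close>

text \<open>Stands in for letting the penalty parameter \<open>A\<close> tend to infinity.\<close>

lemma le_zero_if_le_divide:
  fixes d C :: real
  assumes "\<And>A. A > 0 \<Longrightarrow> d \<le> C / A"
  shows "d \<le> 0"
proof (rule ccontr)
  assume d: "\<not> d \<le> 0"
  then have "C > 0" using assms[of 1] by simp
  then show False using assms[of "2 * C / d"] d by (simp add: field_simps)
qed

lemma cell_problem_solutionD: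
  assumes "cell_problem_solution W p c u"
  shows "general_subsolution (\<lambda>x r q. (norm (p + q))\<^sup>2 + W x \<bullet> (p + q) - c) u"
    "general_subsolution (\<lambda>x r q. c - ((norm (p - q))\<^sup>2 + W x \<bullet> (p - q))) (\<lambda>x. - u x)"
    "Zn_periodic u" "continuous_on UNIV u" "\<exists>L. L-lipschitz_on UNIV u"
  using assms
  unfolding cell_problem_solution_def viscosity_solution_def viscosity_subsolution_general_subsolution
      viscosity_supersolution_general_subsolution by auto

text \<open>At a penalized maximum of \<open>u1 x - u2 (x + z)\<close> both equations are tested
  with the same gradient \<open>q\<close>. The quadratic terms cancel, and what remains is the
  difference of \<open>W\<close> at two points whose distance is of order 1 / A.\<close>

lemma cell_problem_constant_le:
  assumes L: "L-lipschitz_on UNIV W"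
    and s1: "cell_problem_solution W p c1 u1" and s2: "cell_problem_solution W p c2 u2"
  shows "c2 \<le> c1"
proof -
  note u1 = cell_problem_solutionD[OF s1] and u2 = cell_problem_solutionD[OF s2]
  obtain B1 where B1: "B1 > 0" "\<And>x. norm (u1 x) \<le> B1" using Zn_periodic_bounded[OF u1(4,3)] by blast
  obtain B2 where B2: "B2 > 0" "\<And>x. norm (u2 x) \<le> B2" using Zn_periodic_bounded[OF u2(4,3)] by blast
  obtain L2 where L2: "L2-lipschitz_on UNIV u2" using u2(5) by blast
  have L20: "L2 \<ge> 0" and L0: "L \<ge> 0" using L2 L by (auto dest: lipschitz_on_nonneg)
  have "c2 - c1 \<le> L * L2 * (norm p + 2 * L2) / A" if A: "A > 0" for A
  proof -
    have c: "continuous_on UNIV (\<lambda>(x, z). u1 x - u2 (x + z))"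
      unfolding split_beta
      by (intro continuous_intros continuous_on_compose2[OF u1(4)] continuous_on_compose2[OF u2(4)]) auto
    have b: "\<bar>u1 x - u2 (x + z)\<bar> \<le> B1 + B2" for x z
      using B1(2)[of x] B2(2)[of "x + z"] by (simp add: abs_le_iff)
    have per: "\<exists>a'\<in>cbox 0 1. \<forall>z. u1 a - u2 (a + z) = u1 a' - u2 (a' + z)" for a
    proof (rule bexI[OF _ diff_integer_part_mem[of a]], rule allI)
      fix z
      have "u2 (a + z) = u2 (a - integer_part a + z)"
        using u2(3) integer_part_int[of a] unfolding Zn_periodic_def
        by (metis add.commute add_diff_eq diff_add_cancel)
      then show "u1 a - u2 (a + z) = u1 (a - integer_part a) - u2 (a - integer_part a + z)"
        by (simp add: Zn_periodic_integer_part[OF u1(3)])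
    qed
    obtain x z where m: "\<And>x' z'. u1 x' - u2 (x' + z') - A * (norm z')\<^sup>2 \<le> u1 x - u2 (x + z) - A * (norm z)\<^sup>2"
      by (rule penalized_max_exists[OF c b compact_cbox _ per A]) (auto simp: interval_ne_empty_cart)
    define q where "q = (2 * A) *\<^sub>R (x - (x + z))"
    have "\<forall>\<^sub>F x' in nhds x. u1 x' - A * (norm (x' - (x + z)))\<^sup>2 \<le> u1 x - A * (norm (x - (x + z)))\<^sup>2"
    proof (rule always_eventually, rule allI)
      fix x'
      show "u1 x' - A * (norm (x' - (x + z)))\<^sup>2 \<le> u1 x - A * (norm (x - (x + z)))\<^sup>2"
        using m[of x' "x + z - x'"] by (simp add: norm_minus_commute)
    qed
    from general_subsolutionD[OF u1(1) C1_dist2 this]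
    have 1: "(norm (p + q))\<^sup>2 + W x \<bullet> (p + q) \<le> c1" by (simp add: q_def)
    have "\<forall>\<^sub>F y in nhds (x + z). - u2 y - A * (norm (y - x))\<^sup>2 \<le> - u2 (x + z) - A * (norm (x + z - x))\<^sup>2"
    proof (rule always_eventually, rule allI)
      fix y
      show "- u2 y - A * (norm (y - x))\<^sup>2 \<le> - u2 (x + z) - A * (norm (x + z - x))\<^sup>2"
        using m[of x "y - x"] by simp
    qed
    from general_subsolutionD[OF u2(2) C1_dist2 this]
    have 2: "c2 \<le> (norm (p + q))\<^sup>2 + W (x + z) \<bullet> (p + q)" by (simp add: q_def)
    \<comment> \<open>Comparison with displacement 0 brings in the Lipschitz constant of
      \<open>u2\<close>, which bounds both the distance \<open>norm z\<close> and the gradient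
      \<open>q\<close>.\<close>
    have "A * (norm z)\<^sup>2 \<le> u2 x - u2 (x + z)" using m[of x 0] by simp
    also have "\<dots> \<le> L2 * norm z"
      using lipschitz_onD[OF L2, of x "x + z"] by (simp add: dist_norm abs_le_iff)
    finally have "A * norm z \<le> L2 \<or> norm z = 0" by (auto simp: power2_eq_square)
    then have Az: "A * norm z \<le> L2" using L20 by auto
    then have z: "norm z \<le> L2 / A" using A by (simp add: field_simps)
    have q: "norm q \<le> 2 * L2" using Az A by (simp add: q_def)
    have "c2 - c1 \<le> (W (x + z) - W x) \<bullet> (p + q)" using 1 2 by (simp add: inner_diff_left)
    also have "\<dots> \<le> norm (W (x + z) - W x) * norm (p + q)" by (rule norm_cauchy_schwarz)
    also have "\<dots> \<le> (L * (L2 / A)) * (norm p + 2 * L2)"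
    proof (rule mult_mono)
      have "norm (W (x + z) - W x) \<le> L * norm z"
        using lipschitz_onD[OF L, of "x + z" x] by (simp add: dist_norm)
      also have "\<dots> \<le> L * (L2 / A)" using z L0 by (intro mult_left_mono) auto
      finally show "norm (W (x + z) - W x) \<le> L * (L2 / A)" .
      show "norm (p + q) \<le> norm p + 2 * L2" using norm_triangle_ineq[of p q] q by linarith
    qed (use L0 L20 A in auto)
    finally show ?thesis by simp
  qed
  from le_zero_if_le_divide[OF this] show ?thesis by simp
qed

lemma effective_Hamiltonian_solution:
  assumes "L-lipschitz_on UNIV W" "Zn_periodic W"
  shows "\<exists>u. cell_problem_solution W p (effective_Hamiltonian W p) u"
  unfolding effective_Hamiltonian_def
proof (rule theI'[of "\<lambda>c. \<exists>u. cell_problem_solution W p c u"])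
  show "\<exists>!c. \<exists>u. cell_problem_solution W p c u"
    using cell_problem_solution_exists[OF lipschitz_on_continuous_on[OF assms(1)] assms(2)]
      cell_problem_constant_le[OF assms(1)] by (meson order_antisym)
qed

lemma cell_problem_upper_bound:
  assumes s: "cell_problem_solution W p c u" and \<phi>: "C1_with_gradient \<phi> g" "Zn_periodic \<phi>"
    and b: "\<And>x. (norm (p + g x))\<^sup>2 + W x \<bullet> (p + g x) \<le> b"
  shows "c \<le> b"
proof -
  note u = cell_problem_solutionD[OF s]
  have "continuous_on (cbox 0 1) (\<lambda>x. u x - \<phi> x)"
    by (intro continuous_intros C1_continuous[OF \<phi>(1)] continuous_on_subset[OF u(4)]) auto
  then obtain x where x: "\<And>y. y \<in> cbox 0 1 \<Longrightarrow> u x - \<phi> x \<le> u y - \<phi> y"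
    using continuous_attains_inf[of "cbox 0 1" "\<lambda>x. u x - \<phi> x"] by (auto simp: interval_ne_empty_cart)
  have "u x - \<phi> x \<le> u y - \<phi> y" for y
    using x[OF diff_integer_part_mem[of y]] by (simp add: Zn_periodic_integer_part[OF u(3)] Zn_periodic_integer_part[OF \<phi>(2)])
  then have "\<forall>\<^sub>F y in nhds x. - u y - - \<phi> y \<le> - u x - - \<phi> x"
    by (intro always_eventually allI) (simp add: algebra_simps)
  from general_subsolutionD[OF u(2) C1_minus_iff[THEN iffD2, OF \<phi>(1)] this] b[of x] show ?thesis by simp
qed

text \<open>At a maximum of \<open>u\<close> constants are test functions. The bound does not see
  the direction of \<open>p\<close>; it serves to make the infimum in the burning velocity bounded
  below and positive.\<close>

lemma cell_problem_lower_bound: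
  assumes s: "cell_problem_solution W p c u" and B: "\<And>x. norm (W x) \<le> B"
  shows "(norm p)\<^sup>2 - B * norm p \<le> c"
proof -
  note u = cell_problem_solutionD[OF s]
  obtain x where x: "\<And>y. y \<in> cbox 0 1 \<Longrightarrow> u y \<le> u x"
    using continuous_attains_sup[OF compact_cbox _ continuous_on_subset[OF u(4)], of 0 1]
    by (auto simp: interval_ne_empty_cart)
  have "u y \<le> u x" for y using x[OF diff_integer_part_mem[of y]] by (simp add: Zn_periodic_integer_part[OF u(3)])
  then have "\<forall>\<^sub>F y in nhds x. u y - 0 \<le> u x - 0" by simp
  from general_subsolutionD[OF u(1) C1_const this] have "(norm p)\<^sup>2 + W x \<bullet> p \<le> c" by simp
  moreover have "- (W x \<bullet> p) \<le> B * norm p"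
    using Cauchy_Schwarz_ineq2[of "W x" p] mult_right_mono[OF B[of x], of "norm p"] by simp
  ultimately show ?thesis by linarith
qed

text \<open>For smooth \<open>u\<close> one would average the equation along the line: k \<bullet>
  Du averages to 0, W \<bullet> k to \<open>F x0\<close>, and |Du|^2 + W \<bullet> Du \<ge> - |W|^2
  / 4. A viscosity subsolution may fail to be differentiable on the whole line, so the average is
  replaced by a maximum of u + \<Psi> / 2 on it: there 2 k \<bullet> Du = F x0 - W \<bullet> k, and
  W \<bullet> k cancels.\<close>

lemma cell_problem_lower_bound_line:
  fixes W :: "real^'n::finite \<Rightarrow> real^'n"
  assumes s: "cell_problem_solution W (l *\<^sub>R k) c u" and l: "l \<ge> 0"
    and B: "\<And>x. norm (W x) \<le> B" and L: "L-lipschitz_on UNIV W"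
    and k: "\<forall>i. k $ i \<in> \<int>" and \<Psi>: "C1_with_gradient \<Psi> G" "Zn_periodic \<Psi>"
    and eq: "\<And>x. G x \<bullet> k = W x \<bullet> k - F x" and F: "\<And>t. F (x0 + t *\<^sub>R k) = F x0"
  shows "l\<^sup>2 * (norm k)\<^sup>2 + l * F x0 - B\<^sup>2 / 4 \<le> c"
proof -
  note u = cell_problem_solutionD[OF s]
  obtain B1 where B1: "B1 > 0" "\<And>x. norm (u x) \<le> B1" using Zn_periodic_bounded[OF u(4,3)] by blast
  have \<Psi>c: "continuous_on UNIV \<Psi>" by (rule C1_continuous[OF \<Psi>(1)])
  obtain B2 where B2: "B2 > 0" "\<And>x. norm (\<Psi> x) \<le> B2" using Zn_periodic_bounded[OF \<Psi>c \<Psi>(2)] by blast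
  obtain L2 where L2: "L2-lipschitz_on UNIV u" using u(5) by blast
  have L20: "L2 \<ge> 0" and L0: "L \<ge> 0" using L2 L by (auto dest: lipschitz_on_nonneg)
  define \<gamma> where "\<gamma> t = x0 + t *\<^sub>R k" for t
  have "l\<^sup>2 * (norm k)\<^sup>2 + l * F x0 - B\<^sup>2 / 4 - c \<le> l * norm k * L * L2 / A" if A: "A > 0" for A
  proof -
    \<comment> \<open>The base point \<open>\<gamma> t\<close> stays on the line, where the
      derivative of \<open>\<Psi>\<close> along \<open>k\<close> is known; \<open>z\<close> leads
      off the line, because the subsolution has to be tested in a full neighbourhood.\<close>
    define f where "f t z = u (\<gamma> t + z) + 1 / 2 * \<Psi> (\<gamma> t)" for t z
    have c: "continuous_on UNIV (\<lambda>(t, z). f t z)"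
      unfolding split_beta f_def \<gamma>_def
      by (intro continuous_intros continuous_on_compose2[OF u(4)] continuous_on_compose2[OF \<Psi>c]) auto
    have b: "\<bar>f t z\<bar> \<le> B1 + 1 / 2 * B2" for t z
      using B1(2)[of "\<gamma> t + z"] B2(2)[of "\<gamma> t"] by (simp add: f_def abs_le_iff)
    have per: "\<exists>t'\<in>{0..1}. \<forall>z. f t z = f t' z" for t
    proof (intro bexI allI)
      show "t - of_int \<lfloor>t\<rfloor> \<in> {0..1}" by (auto simp: algebra_simps) linarith
      fix z
      have int: "\<forall>i. (of_int \<lfloor>t\<rfloor> *\<^sub>R k) $ i \<in> \<int>" using k by auto
      have g: "\<gamma> t = \<gamma> (t - of_int \<lfloor>t\<rfloor>) + of_int \<lfloor>t\<rfloor> *\<^sub>R k"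
        by (simp add: \<gamma>_def algebra_simps)
      have "\<gamma> t + z = \<gamma> (t - of_int \<lfloor>t\<rfloor>) + z + of_int \<lfloor>t\<rfloor> *\<^sub>R k"
        by (simp add: \<gamma>_def algebra_simps)
      then have "u (\<gamma> t + z) = u (\<gamma> (t - of_int \<lfloor>t\<rfloor>) + z)"
        using u(3) int unfolding Zn_periodic_def by metis
      moreover have "\<Psi> (\<gamma> t) = \<Psi> (\<gamma> (t - of_int \<lfloor>t\<rfloor>))"
        using \<Psi>(2) int g unfolding Zn_periodic_def by metis
      ultimately show "f t z = f (t - of_int \<lfloor>t\<rfloor>) z" by (simp add: f_def)
    qed
    obtain t z where m: "\<And>t' z'. f t' z' - A * (norm z')\<^sup>2 \<le> f t z - A * (norm z)\<^sup>2"
      by (rule penalized_max_exists[OF c b compact_Icc _ per A]) auto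
    define q where "q = (2 * A) *\<^sub>R z"
    define x where "x = \<gamma> t + z"
    have "\<forall>\<^sub>F y in nhds x. u y - A * (norm (y - \<gamma> t))\<^sup>2 \<le> u x - A * (norm (x - \<gamma> t))\<^sup>2"
    proof (rule always_eventually, rule allI)
      fix y
      show "u y - A * (norm (y - \<gamma> t))\<^sup>2 \<le> u x - A * (norm (x - \<gamma> t))\<^sup>2"
        using m[of t "y - \<gamma> t"] by (simp add: x_def f_def)
    qed
    from general_subsolutionD[OF u(1) C1_dist2 this]
    have 1: "(norm (l *\<^sub>R k + q))\<^sup>2 + W x \<bullet> (l *\<^sub>R k + q) \<le> c" by (simp add: q_def x_def)
    \<comment> \<open>Moving the base point while the tested point \<open>\<gamma> t + z\<close>
      stays fixed removes \<open>u\<close> from the comparison. The rest is differentiable in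
      \<open>s\<close>, and its critical point equation determines
      \<open>q \<bullet> k\<close>.\<close>
    define h where "h s = 1 / 2 * \<Psi> (x0 + s *\<^sub>R k) - A * (norm (z - (s - t) *\<^sub>R k))\<^sup>2" for s
    have "(\<Psi> has_derivative (\<lambda>v. v \<bullet> G (x0 + t *\<^sub>R k))) (at (x0 + t *\<^sub>R k))"
      using \<Psi>(1) by (auto simp: C1_with_gradient_def gderiv_def)
    moreover have "((\<lambda>s. x0 + s *\<^sub>R k) has_derivative (\<lambda>s. s *\<^sub>R k)) (at t)"
      by (auto intro!: derivative_eq_intros)
    ultimately have "((\<lambda>s. \<Psi> (x0 + s *\<^sub>R k)) has_derivative (\<lambda>s. (s *\<^sub>R k) \<bullet> G (x0 + t *\<^sub>R k))) (at t)"
      by (rule has_derivative_compose[rotated])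
    then have d\<Psi>: "((\<lambda>s. \<Psi> (x0 + s *\<^sub>R k)) has_real_derivative (G (x0 + t *\<^sub>R k) \<bullet> k)) (at t)"
      unfolding has_field_derivative_def
      by (rule has_derivative_eq_rhs) (auto simp: inner_commute)
    have "((\<lambda>s. (norm (z - (s - t) *\<^sub>R k))\<^sup>2) has_real_derivative (- 2 * (z \<bullet> k))) (at t)"
      unfolding power2_norm_eq_inner has_field_derivative_def
      by (rule has_derivative_eq_rhs, (rule derivative_intros)+) (simp add: fun_eq_iff inner_commute)
    then have dh: "(h has_real_derivative (1 / 2 * (G (x0 + t *\<^sub>R k) \<bullet> k) - A * (- 2 * (z \<bullet> k)))) (at t)"
      unfolding h_def by (intro DERIV_diff DERIV_cmult d\<Psi>)
    have hm: "h s \<le> h t" for s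
    proof -
      have e: "\<gamma> s + (z - (s - t) *\<^sub>R k) = \<gamma> t + z" by (simp add: \<gamma>_def algebra_simps)
      have "u (\<gamma> t + z) + h s \<le> u (\<gamma> t + z) + h t"
        using m[of s "z - (s - t) *\<^sub>R k"] unfolding f_def e by (simp add: h_def \<gamma>_def)
      then show ?thesis by simp
    qed
    have "1 / 2 * (G (x0 + t *\<^sub>R k) \<bullet> k) - A * (- 2 * (z \<bullet> k)) = 0"
      by (rule DERIV_local_max[OF dh, of 1]) (use hm in auto)
    then have qk: "2 * (q \<bullet> k) = F x0 - W (\<gamma> t) \<bullet> k"
      using eq[of "\<gamma> t"] F[of t] by (simp add: q_def \<gamma>_def field_simps)
    have "A * (norm z)\<^sup>2 \<le> u (\<gamma> t + z) - u (\<gamma> t)" using m[of t 0] by (simp add: f_def)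
    also have "\<dots> \<le> L2 * norm z"
      using lipschitz_onD[OF L2, of "\<gamma> t + z" "\<gamma> t"] by (simp add: dist_norm abs_le_iff)
    finally have "A * norm z \<le> L2 \<or> norm z = 0" by (auto simp: power2_eq_square)
    then have "A * norm z \<le> L2" using L20 by auto
    then have z: "norm z \<le> L2 / A" using A by (simp add: field_simps)
    have sq: "(norm (q + (1/2) *\<^sub>R W x))\<^sup>2 \<ge> 0" by simp
    \<comment> \<open>After completing the square, the remaining terms contain \<open>q\<close> only
      through \<open>q \<bullet> k\<close>; dropping the square costs a quarter of
      \<open>(norm (W x))\<^sup>2\<close>.\<close>
    have exp: "(norm (l *\<^sub>R k + q))\<^sup>2 + W x \<bullet> (l *\<^sub>R k + q) =
      (norm (q + (1/2) *\<^sub>R W x))\<^sup>2 + l\<^sup>2 * (norm k)\<^sup>2 + l * (2 * (q \<bullet> k)) + l * (W x \<bullet> k) - (norm (W x))\<^sup>2 / 4"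
      unfolding power2_norm_eq_inner
      by (simp add: inner_simps inner_commute power2_eq_square algebra_simps)
    have WB: "(norm (W x))\<^sup>2 \<le> B\<^sup>2" using B[of x] by (intro power_mono) auto
    have "l * (W (\<gamma> t) \<bullet> k - W x \<bullet> k) \<le> l * (norm k * L * L2 / A)"
    proof (rule mult_left_mono[OF _ l])
      have "W (\<gamma> t) \<bullet> k - W x \<bullet> k = (W (\<gamma> t) - W x) \<bullet> k" by (simp add: inner_diff_left)
      also have "\<dots> \<le> norm (W (\<gamma> t) - W x) * norm k" by (rule norm_cauchy_schwarz)
      also have "\<dots> \<le> (L * (L2 / A)) * norm k"
      proof (rule mult_right_mono)
        have "norm (W (\<gamma> t) - W x) \<le> L * norm z"
          using lipschitz_onD[OF L, of "\<gamma> t" x] by (simp add: dist_norm x_def)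
        also have "\<dots> \<le> L * (L2 / A)" using z L0 by (intro mult_left_mono) auto
        finally show "norm (W (\<gamma> t) - W x) \<le> L * (L2 / A)" .
      qed simp
      finally show "W (\<gamma> t) \<bullet> k - W x \<bullet> k \<le> norm k * L * L2 / A" by (simp add: algebra_simps)
    qed
    moreover have "l * (2 * (q \<bullet> k)) = l * F x0 - l * (W (\<gamma> t) \<bullet> k)" unfolding qk by (simp add: algebra_simps)
    ultimately have "l * F x0 - l * (norm k * L * L2 / A) \<le> l * (2 * (q \<bullet> k)) + l * (W x \<bullet> k)"
      by (simp add: right_diff_distrib)
    moreover have "l * (norm k * L * L2 / A) = l * norm k * L * L2 / A" by simp
    ultimately show ?thesis using 1 exp sq WB by linarith
  qed
  from le_zero_if_le_divide[OF this] show ?thesis by simp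
qed

section \<open>Averages over the torus and along lines\<close>

lemma periodic_int_multiple:
  fixes f :: "'a::real_vector \<Rightarrow> 'b"
  assumes per: "\<And>x. f (x + b) = f x"
  shows "f (x + of_int m *\<^sub>R b) = f x"
proof (induction m arbitrary: x rule: int_induct[where k = 0])
  case base then show ?case by simp
next
  case (step1 i)
  have "f (x + of_int (i + 1) *\<^sub>R b) = f (x + of_int i *\<^sub>R b + b)" by (simp add: algebra_simps)
  then show ?case using per step1 by simp
next
  case (step2 i)
  have "f (x + of_int i *\<^sub>R b) = f (x + of_int (i - 1) *\<^sub>R b + b)" by (simp add: algebra_simps)
  then show ?case using per step2 by simp
qed

text \<open>For \<open>s\<close> between 0 and 1 the shifted cube is cut at height 1 in direction
  \<open>b\<close>, and the overhanging slab is moved back by one period. Other \<open>s\<close>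
  reduce to their fractional part.\<close>

lemma integral_unit_cube_shift:
  fixes f :: "'a::euclidean_space \<Rightarrow> 'b::banach"
  assumes f: "continuous_on UNIV f" and b: "b \<in> Basis" and per: "\<And>x. f (x + b) = f x"
  shows "integral (cbox 0 One) (\<lambda>x. f (x + s *\<^sub>R b)) = integral (cbox 0 One) f"
proof -
  have main: "integral (cbox 0 One) (\<lambda>x. f (x + s *\<^sub>R b)) = integral (cbox 0 One) f"
    if s: "0 \<le> s" "s \<le> 1" for s
  proof -
    have int: "f integrable_on cbox u v" for u v
      by (rule integrable_continuous[OF continuous_on_subset[OF f]]) auto
    have bi: "b \<bullet> i = (if i = b then 1 else 0)" if "i \<in> Basis" for i
      using inner_Basis[OF b that] by auto
    have "integral (cbox 0 One) (\<lambda>x. f (x + s *\<^sub>R b)) = integral (cbox 0 One) (f \<circ> (+) (s *\<^sub>R b))"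
      by (simp add: o_def add.commute)
    also have "\<dots> = integral (cbox (0 + s *\<^sub>R b) (One + s *\<^sub>R b)) f"
      by (rule integral_shift_cbox_plus)
    also have "\<dots> = integral (cbox (0 + s *\<^sub>R b) (One + s *\<^sub>R b) \<inter> {x. x \<bullet> b \<le> 1}) f
        + integral (cbox (0 + s *\<^sub>R b) (One + s *\<^sub>R b) \<inter> {x. x \<bullet> b \<ge> 1}) f"
      by (rule integral_split[OF int b])
    also have "cbox (0 + s *\<^sub>R b) (One + s *\<^sub>R b) \<inter> {x. x \<bullet> b \<le> 1} = cbox 0 One \<inter> {x. x \<bullet> b \<ge> s}"
      using s b by (auto simp: mem_box inner_add_left bi split: if_splits) (smt (verit))+
    also have "cbox (0 + s *\<^sub>R b) (One + s *\<^sub>R b) \<inter> {x. x \<bullet> b \<ge> 1} = cbox (0 + b) (One + (s - 1) *\<^sub>R b + b)"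
      using s b by (auto simp: mem_box inner_add_left bi split: if_splits) (smt (verit))+
    also have "integral \<dots> f = integral (cbox 0 (One + (s - 1) *\<^sub>R b)) (f \<circ> (+) b)"
      by (rule integral_shift_cbox_plus[symmetric])
    also have "f \<circ> (+) b = f" using per by (auto simp: o_def add.commute)
    also have "cbox 0 (One + (s - 1) *\<^sub>R b) = cbox 0 One \<inter> {x. x \<bullet> b \<le> s}"
      using s b by (auto simp: mem_box inner_add_left bi split: if_splits) (smt (verit))+
    also have "integral (cbox 0 One \<inter> {x. s \<le> x \<bullet> b}) f + integral (cbox 0 One \<inter> {x. x \<bullet> b \<le> s}) f
        = integral (cbox 0 One) f"
      by (subst integral_split[OF int b, of 0 One s]) (simp add: add.commute)
    finally show ?thesis .
  qed
  have "f (x + s *\<^sub>R b) = f (x + frac s *\<^sub>R b)" for x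
  proof -
    have "x + s *\<^sub>R b = x + frac s *\<^sub>R b + of_int \<lfloor>s\<rfloor> *\<^sub>R b"
      by (simp add: frac_def algebra_simps)
    then show ?thesis by (simp only: periodic_int_multiple[of f b, OF per])
  qed
  then show ?thesis using main[of "frac s"] by (simp add: frac_lt_1 less_imp_le)
qed

text \<open>Connects the sum of \<open>Basis\<close> vectors in the shift lemma with the constant
  vector in the torus integral.\<close>

lemma One_vec: "(One :: real^'n::finite) = 1"
proof (rule vec_eq_iff[THEN iffD2], rule allI)
  fix i :: 'n
  have "(One :: real^'n) \<bullet> axis i 1 = 1"
    using inner_sum_left_Basis[of "axis i 1 :: real^'n" "\<lambda>_. 1"] by (simp add: axis_in_Basis_iff)
  then show "(One :: real^'n) $ i = 1 $ i" by (simp only: cart_eq_inner_axis[symmetric] one_index)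
qed

definition mean :: "(real^'n::finite \<Rightarrow> 'b::real_normed_vector) \<Rightarrow> 'b" where
  "mean f = integral (cbox 0 1) f"

text \<open>For integer \<open>k\<close> and periodic \<open>f\<close> this averages over a closed
  line of the torus; with \<open>f x = V x \<bullet> k\<close> it is the F_k of the
  overview.\<close>

definition line_avg :: "real^'n::finite \<Rightarrow> (real^'n \<Rightarrow> 'b::real_normed_vector) \<Rightarrow> real^'n \<Rightarrow> 'b" where
  "line_avg k f x = integral {0..1} (\<lambda>t. f (x + t *\<^sub>R k))"

lemma Zn_periodicD: "Zn_periodic f \<Longrightarrow> (\<And>i. k $ i \<in> \<int>) \<Longrightarrow> f (x + k) = f x"
  unfolding Zn_periodic_def by blast

lemma mean_translate:
  fixes f :: "real^'n::finite \<Rightarrow> 'b::banach"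
  assumes f: "continuous_on UNIV f" "Zn_periodic f"
  shows "mean (\<lambda>x. f (x + a)) = mean f"
proof -
  have "mean (\<lambda>x. f (x + (\<Sum>i\<in>S. a $ i *\<^sub>R axis i 1))) = mean f" if "finite S" for S
    using that
  proof induction
    case empty then show ?case by simp
  next
    case (insert i S)
    define h where "h x = f (x + (\<Sum>i\<in>S. a $ i *\<^sub>R axis i 1))" for x
    have h: "continuous_on UNIV h" unfolding h_def
      by (rule continuous_on_compose2[OF f(1)]) (auto intro!: continuous_intros)
    have hp: "h (x + axis i 1) = h x" for x
    proof -
      have "f (y + axis i 1) = f y" for y
        by (rule Zn_periodicD[OF f(2)]) (auto simp: axis_def)
      from this[of "x + (\<Sum>i\<in>S. a $ i *\<^sub>R axis i 1)"] show ?thesis by (simp add: h_def add_ac)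
    qed
    have "mean (\<lambda>x. f (x + (\<Sum>i\<in>insert i S. a $ i *\<^sub>R axis i 1))) = mean (\<lambda>x. h (x + a $ i *\<^sub>R axis i 1))"
      using insert by (simp add: h_def add.assoc)
    also have "\<dots> = mean h"
      using integral_unit_cube_shift[OF h _ hp, of "a $ i"] by (simp add: mean_def One_vec axis_in_Basis_iff)
    finally show ?case using insert by (simp add: h_def[abs_def])
  qed
  from this[of UNIV] show ?thesis
    using basis_expansion[of a] by (simp add: scalar_mult_eq_scaleR)
qed

lemma integral_periodic_shift:
  fixes h :: "real \<Rightarrow> 'b::banach"
  assumes h: "continuous_on UNIV h" "\<And>t. h (t + 1) = h t"
  shows "integral {0..1} (\<lambda>t. h (t + s)) = integral {0..1} h"
  using integral_unit_cube_shift[OF h(1), of 1 s] h(2) by simp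

lemma line_avg_shift:
  fixes f :: "real^'n::finite \<Rightarrow> 'b::banach"
  assumes f: "continuous_on UNIV f" and per: "\<And>x. f (x + k) = f x"
  shows "line_avg k f (x + s *\<^sub>R k) = line_avg k f x"
proof -
  have "line_avg k f (x + s *\<^sub>R k) = integral {0..1} (\<lambda>t. f (x + (t + s) *\<^sub>R k))"
    by (simp add: line_avg_def algebra_simps)
  also have "\<dots> = line_avg k f x"
    unfolding line_avg_def
  proof (rule integral_periodic_shift)
    show "continuous_on UNIV (\<lambda>t. f (x + t *\<^sub>R k))"
      by (rule continuous_on_compose2[OF f]) (auto intro!: continuous_intros)
    show "f (x + (t + 1) *\<^sub>R k) = f (x + t *\<^sub>R k)" for t
      using per[of "x + t *\<^sub>R k"] by (simp add: algebra_simps)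
  qed
  finally show ?thesis .
qed

lemma continuous_on_line:
  fixes f :: "real^'n::finite \<Rightarrow> 'b::topological_space"
  assumes "continuous_on UNIV f"
  shows "continuous_on S (\<lambda>t. f (x + t *\<^sub>R k))"
  by (rule continuous_on_compose2[OF assms]) (auto intro!: continuous_intros)

lemma integrable_on_line:
  fixes f :: "real^'n::finite \<Rightarrow> 'b::banach"
  assumes "continuous_on UNIV f"
  shows "(\<lambda>t. f (x + t *\<^sub>R k)) integrable_on {a..b}"
  by (intro integrable_continuous_real continuous_on_line assms)

lemma mean_integral_swap:
  fixes F :: "real^'n::finite \<Rightarrow> real \<Rightarrow> 'b::banach"
  assumes "continuous_on UNIV (\<lambda>(x, t). F x t)"
  shows "mean (\<lambda>x. integral {0..1} (F x)) = integral {0..1} (\<lambda>t. mean (\<lambda>x. F x t))"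
  using integral_swap_continuous[OF continuous_on_subset[OF assms], of 0 0 1 1] by (simp add: mean_def)

lemma mean_line_avg:
  fixes f :: "real^'n::finite \<Rightarrow> 'b::banach"
  assumes f: "continuous_on UNIV f" "Zn_periodic f"
  shows "mean (line_avg k f) = mean f"
proof -
  have "continuous_on UNIV (\<lambda>(x, t::real). f (x + t *\<^sub>R k))"
    unfolding split_beta by (rule continuous_on_compose2[OF f(1)]) (auto intro!: continuous_intros)
  from mean_integral_swap[OF this] show ?thesis
    by (simp add: line_avg_def[abs_def] mean_translate[OF f])
qed

lemma Zn_periodic_line_avg: "Zn_periodic f \<Longrightarrow> Zn_periodic (line_avg k f)"
  unfolding Zn_periodic_def line_avg_def by (simp add: add.assoc add.commute[of _ "_ *\<^sub>R k"]) 
    (simp add: add.assoc[symmetric])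

lemma line_avg_invariant:
  assumes "\<And>x. f (x + v) = f x" shows "line_avg k f (x + v) = line_avg k f x"
proof -
  have "f (x + v + t *\<^sub>R k) = f (x + t *\<^sub>R k)" for t
    using assms[of "x + t *\<^sub>R k"] by (simp add: algebra_simps)
  then show ?thesis by (simp add: line_avg_def)
qed

lemma norm_integral_unit_diff_le:
  fixes F G :: "real \<Rightarrow> 'b::banach"
  assumes "continuous_on {0..1} F" "continuous_on {0..1} G" "\<And>t. t \<in> {0..1} \<Longrightarrow> norm (F t - G t) \<le> e"
  shows "norm (integral {0..1} F - integral {0..1} G) \<le> e"
proof -
  have "integral {0..1} F - integral {0..1} G = integral {0..1} (\<lambda>t. F t - G t)"
    by (intro integral_diff[symmetric] integrable_continuous_real assms)
  also have "norm \<dots> \<le> e * (1 - 0)"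
    by (rule integral_bound) (use assms in \<open>auto intro!: continuous_intros\<close>)
  finally show ?thesis by simp
qed

lemma lipschitz_on_line_avg:
  fixes f :: "real^'n::finite \<Rightarrow> 'b::banach"
  assumes f: "L-lipschitz_on UNIV f"
  shows "L-lipschitz_on UNIV (line_avg k f)"
proof (rule lipschitz_onI)
  fix x y :: "real^'n"
  have c: "continuous_on UNIV f" by (rule lipschitz_on_continuous_on[OF f])
  show "dist (line_avg k f x) (line_avg k f y) \<le> L * dist x y"
    unfolding line_avg_def dist_norm[of "integral _ _"]
  proof (intro norm_integral_unit_diff_le continuous_on_line c)
    fix t :: real
    show "norm (f (x + t *\<^sub>R k) - f (y + t *\<^sub>R k)) \<le> L * dist x y"
      using lipschitz_onD[OF f, of "x + t *\<^sub>R k" "y + t *\<^sub>R k"] by (simp add: dist_norm)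
  qed
qed (use f in \<open>auto dest: lipschitz_on_nonneg\<close>)

text \<open>Averaging also over the shifts by \<open>s / M\<close> along \<open>k + M e\<close>, for \<open>s \<in> [0,1]\<close>, changes nothing; such a shift
  is \<open>s e\<close> up to an error of length at most \<open>|k| / M\<close>.\<close>
lemma line_avg_combination:
  fixes f :: "real^'n::finite \<Rightarrow> 'b::banach"
  assumes f: "L-lipschitz_on UNIV f" and k: "\<And>x. f (x + k) = f x" and e: "\<And>x. f (x + e) = f x"
    and M: "M > (0::nat)"
  shows "norm (line_avg (k + real M *\<^sub>R e) f x - line_avg k (line_avg e f) x) \<le> L * norm k / M"
proof -
  define v where "v = k + real M *\<^sub>R e"
  have c: "continuous_on UNIV f" by (rule lipschitz_on_continuous_on[OF f])
  have v: "f (x + v) = f x" for x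
    using k[of "x + of_int (int M) *\<^sub>R e"] periodic_int_multiple[of f e x "int M", OF e]
    by (simp add: v_def algebra_simps)
  define g where "g s t = f (x + t *\<^sub>R v + s *\<^sub>R e)" for s t
  have gc: "continuous_on UNIV (\<lambda>(s, t). g s t)"
    unfolding g_def split_beta by (rule continuous_on_compose2[OF c]) (auto intro!: continuous_intros)
  have gc1: "continuous_on A (\<lambda>s. g s t)" for t A
    using continuous_on_compose2[OF gc, of A "\<lambda>s. (s, t)"] by (simp add: continuous_on_Pair)
  have gc2: "continuous_on A (\<lambda>t. g s t)" for s A
    using continuous_on_compose2[OF gc, of A "\<lambda>t. (s, t)"] by (simp add: continuous_on_Pair)
  have "integral {0..1} (\<lambda>s. integral {0..1} (\<lambda>t. g s t)) = integral {0..1} (\<lambda>t. integral {0..1} (\<lambda>s. g s t))"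
    using integral_swap_continuous[OF continuous_on_subset[OF gc], of 0 0 1 1] by simp
  also have "\<dots> = integral {0..1} (\<lambda>t. line_avg e f (x + t *\<^sub>R v))"
    by (simp add: g_def line_avg_def)
  also have "\<dots> = integral {0..1} (\<lambda>t. line_avg e f (x + t *\<^sub>R k))"
  proof -
    \<comment> \<open>The two points differ by a multiple of \<open>e\<close>, and averages along
      \<open>e\<close> do not change in that direction.\<close>
    have "line_avg e f (x + t *\<^sub>R v) = line_avg e f (x + t *\<^sub>R k)" for t
      using line_avg_shift[OF c e, of "x + t *\<^sub>R k" "t * real M"] by (simp add: v_def algebra_simps)
    then show ?thesis by simp
  qed
  also have "\<dots> = line_avg k (line_avg e f) x" by (simp add: line_avg_def[of k])
  finally have 1: "integral {0..1} (\<lambda>s. integral {0..1} (\<lambda>t. g s t)) = line_avg k (line_avg e f) x" .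
  have "norm (integral {0..1} (\<lambda>s::real. line_avg v f x) - integral {0..1} (\<lambda>s. integral {0..1} (\<lambda>t. g s t)))
      \<le> L * norm k / M"
  proof (rule norm_integral_unit_diff_le)
    show "continuous_on {0..1} (\<lambda>s. integral {0..1} (\<lambda>t. g s t))"
      using integral_continuous_on_param[OF continuous_on_subset[OF gc], of "{0..1}" 0 1] by simp
    fix s :: real assume s: "s \<in> {0..1}"
    \<comment> \<open>The slide by \<open>s / M\<close> along \<open>v\<close> contains exactly
      \<open>s *\<^sub>R e\<close>; the rest, \<open>(s / M) *\<^sub>R k\<close>, is the
      error.\<close>
    have "line_avg v f x = line_avg v f (x + (s / M) *\<^sub>R v)" by (rule line_avg_shift[OF c v, symmetric])
    also have "norm (\<dots> - integral {0..1} (\<lambda>t. g s t)) \<le> L * norm k / M"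
      unfolding line_avg_def
    proof (intro norm_integral_unit_diff_le continuous_on_line c gc2)
      fix t :: real
      have "x + (s / M) *\<^sub>R v + t *\<^sub>R v - (x + t *\<^sub>R v + s *\<^sub>R e) = (s / M) *\<^sub>R k"
        using M by (simp add: v_def algebra_simps)
      then have "norm (f (x + (s / M) *\<^sub>R v + t *\<^sub>R v) - g s t) \<le> L * norm ((s / M) *\<^sub>R k)"
        using lipschitz_onD[OF f, of "x + (s / M) *\<^sub>R v + t *\<^sub>R v" "x + t *\<^sub>R v + s *\<^sub>R e"]
        by (simp add: g_def dist_norm)
      also have "\<dots> \<le> L * (norm k / M)"
      proof (rule mult_left_mono)
        have "norm ((s / M) *\<^sub>R k) = s * (norm k / M)" using s by simp
        also have "\<dots> \<le> 1 * (norm k / M)" using s by (intro mult_right_mono) auto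
        finally show "norm ((s / M) *\<^sub>R k) \<le> norm k / M" by simp
      qed (use f in \<open>auto dest: lipschitz_on_nonneg\<close>)
      finally show "norm (f (x + (s / M) *\<^sub>R v + t *\<^sub>R v) - g s t) \<le> L * norm k / M" by simp
    qed
    finally show "norm (line_avg v f x - integral {0..1} (\<lambda>t. g s t)) \<le> L * norm k / M" .
  qed auto
  then show ?thesis by (simp add: 1 v_def)
qed

text \<open>\<open>A\<close> is \<open>f\<close> averaged over the coordinates in \<open>S\<close>.
  An induction step first averages \<open>f\<close> along the new axis and applies the hypothesis to
  the result; the clause on \<open>v\<close> carries the invariance so gained over to
  \<open>A\<close>. Entries of \<open>k\<close> stay nonnegative so that adding a multiple of an
  axis vector cannot cancel, and being at least 1 on \<open>S\<close> finally shows that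
  \<open>k\<close> is nonzero.\<close>

lemma line_avg_approx_partial_mean:
  fixes f :: "real^'n::finite \<Rightarrow> 'b::banach"
  assumes "finite S" "L-lipschitz_on UNIV f" "Zn_periodic f"
  shows "\<exists>A. L-lipschitz_on UNIV A \<and> Zn_periodic A \<and> mean A = mean f
    \<and> (\<forall>j\<in>S. \<forall>s x. A (x + s *\<^sub>R axis j 1) = A x)
    \<and> (\<forall>v. (\<forall>x. f (x + v) = f x) \<longrightarrow> (\<forall>x. A (x + v) = A x))
    \<and> (\<forall>\<delta>>0. \<exists>k. (\<forall>i. k $ i \<in> \<int> \<and> k $ i \<ge> 0) \<and> (\<forall>i\<in>S. k $ i \<ge> 1) \<and> (\<forall>x. norm (line_avg k f x - A x) \<le> \<delta>))"
  using assms
proof (induction S arbitrary: f)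
  case empty
  have "line_avg 0 f x = f x" for x by (simp add: line_avg_def)
  then show ?case using empty by (intro exI[of _ f]) (auto intro!: exI[of _ 0])
next
  case (insert j S)
  define e :: "real^'n" where "e = axis j 1"
  have eint: "\<forall>i. e $ i \<in> \<int>" by (auto simp: e_def axis_def)
  have c: "continuous_on UNIV f" by (rule lipschitz_on_continuous_on[OF insert.prems(1)])
  have fe: "f (x + e) = f x" for x using insert.prems(2) eint by (auto simp: Zn_periodic_def)
  obtain A where A: "L-lipschitz_on UNIV A" "Zn_periodic A" "mean A = mean (line_avg e f)"
    "\<forall>j\<in>S. \<forall>s x. A (x + s *\<^sub>R axis j 1) = A x"
    "\<forall>v. (\<forall>x. line_avg e f (x + v) = line_avg e f x) \<longrightarrow> (\<forall>x. A (x + v) = A x)"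
    "\<forall>\<delta>>0. \<exists>k. (\<forall>i. k $ i \<in> \<int> \<and> k $ i \<ge> 0) \<and> (\<forall>i\<in>S. k $ i \<ge> 1) \<and>
      (\<forall>x. norm (line_avg k (line_avg e f) x - A x) \<le> \<delta>)"
    using insert.IH[OF lipschitz_on_line_avg[OF insert.prems(1)] Zn_periodic_line_avg[OF insert.prems(2)]]
    by blast
  have Aj: "A (x + s *\<^sub>R e) = A x" for x s
    using line_avg_shift[OF c fe] A(5) by blast
  have Av: "A (x + v) = A x" if "\<And>x. f (x + v) = f x" for v x
    using line_avg_invariant[of f v e] that A(5) by blast
  have "\<exists>k. (\<forall>i. k $ i \<in> \<int> \<and> k $ i \<ge> 0) \<and> (\<forall>i\<in>insert j S. k $ i \<ge> 1) \<and> (\<forall>x. norm (line_avg k f x - A x) \<le> \<delta>)"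
    if \<delta>: "\<delta> > 0" for \<delta>
  proof -
    obtain k where k: "\<And>i. k $ i \<in> \<int>" "\<And>i. k $ i \<ge> 0" "\<And>i. i \<in> S \<Longrightarrow> k $ i \<ge> 1"
      "\<And>x. norm (line_avg k (line_avg e f) x - A x) \<le> \<delta> / 2"
      using A(6)[rule_format, of "\<delta> / 2"] \<delta> by auto
    \<comment> \<open>Half of \<open>\<delta>\<close> is used by the induction hypothesis;
      \<open>M\<close> is so large that replacing the iterated average by a single closed line costs
      at most the other half.\<close>
    obtain M :: nat where M: "L * norm k / (\<delta> / 2) < M" using reals_Archimedean2 by blast
    have "0 \<le> L * norm k / (\<delta> / 2)" using \<delta> lipschitz_on_nonneg[OF insert.prems(1)] by simp
    then have M0: "real M > 0" using M by linarith
    have LM: "L * norm k / M \<le> \<delta> / 2" using M M0 \<delta> by (simp add: field_simps)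
    have fk: "f (x + k) = f x" for x using insert.prems(2) k(1) by (auto simp: Zn_periodic_def)
    show ?thesis
    proof (intro exI[of _ "k + real M *\<^sub>R e"] conjI allI ballI)
      fix i
      show "(k + real M *\<^sub>R e) $ i \<in> \<int>" using k(1) eint by (auto intro!: Ints_add Ints_mult)
      show "(k + real M *\<^sub>R e) $ i \<ge> 0" using k(2) by (auto simp: e_def axis_def)
    next
      fix i assume "i \<in> insert j S"
      then show "(k + real M *\<^sub>R e) $ i \<ge> 1" using k(2,3)[of i] M0 by (auto simp: e_def axis_def)
    next
      fix x
      have "norm (line_avg (k + real M *\<^sub>R e) f x - line_avg k (line_avg e f) x) \<le> L * norm k / M"
        using line_avg_combination[OF insert.prems(1) fk fe, of M x] M0 by simp
      moreover have "norm (line_avg (k + real M *\<^sub>R e) f x - A x)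
          \<le> norm (line_avg (k + real M *\<^sub>R e) f x - line_avg k (line_avg e f) x)
            + norm (line_avg k (line_avg e f) x - A x)"
        using norm_triangle_ineq[of "line_avg (k + real M *\<^sub>R e) f x - line_avg k (line_avg e f) x"
            "line_avg k (line_avg e f) x - A x"] by simp
      ultimately show "norm (line_avg (k + real M *\<^sub>R e) f x - A x) \<le> \<delta>"
        using k(4)[of x] LM by linarith
    qed
  qed
  then show ?case
    using A(1,2,3,4) Aj Av mean_line_avg[OF c insert.prems(2)]
    by (intro exI[of _ A]) (auto simp: e_def)
qed

lemma line_avg_approx_mean:
  fixes f :: "real^'n::finite \<Rightarrow> 'b::banach"
  assumes f: "L-lipschitz_on UNIV f" "Zn_periodic f" and \<delta>: "\<delta> > 0"
  obtains k where "\<forall>i. k $ i \<in> \<int>" "k \<noteq> 0" "\<And>x. norm (line_avg k f x - mean f) \<le> \<delta>"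
proof -
  obtain A where A: "mean A = mean f" "\<And>j s x. A (x + s *\<^sub>R axis j 1) = A x"
    "\<And>\<delta>. \<delta> > 0 \<Longrightarrow> \<exists>k. (\<forall>i. k $ i \<in> \<int> \<and> k $ i \<ge> 0) \<and> (\<forall>i. k $ i \<ge> 1) \<and> (\<forall>x. norm (line_avg k f x - A x) \<le> \<delta>)"
    using line_avg_approx_partial_mean[OF finite f, of UNIV] by auto
  \<comment> \<open>Invariance along every axis makes \<open>A\<close> constant, and the constant
    can only be the mean.\<close>
  have "A (\<Sum>j\<in>S. x $ j *\<^sub>R axis j 1) = A 0" if "finite S" for S x
    using that by induction (auto simp: A(2) add.commute[of "_ *\<^sub>R axis _ _"])
  from this[OF finite, where S = UNIV] have "A x = A 0" for x
  proof -
    have "(\<Sum>j\<in>UNIV. x $ j *\<^sub>R axis j 1) = x"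
      using basis_expansion[of x] by (simp add: scalar_mult_eq_scaleR)
    then show ?thesis using \<open>\<And>x. A (\<Sum>j\<in>UNIV. x $ j *\<^sub>R axis j 1) = A 0\<close>[of x] by simp
  qed
  then have A0: "A = (\<lambda>x. A 0)" by (rule ext)
  have "mean A = A 0" by (subst A0) (simp add: mean_def One_vec[symmetric])
  then have Am: "A x = mean f" for x using A0 A(1) by metis
  obtain k where k: "\<forall>i. k $ i \<in> \<int> \<and> k $ i \<ge> 0" "\<forall>i. k $ i \<ge> 1" "\<And>x. norm (line_avg k f x - A x) \<le> \<delta>"
    using A(3)[OF \<delta>] by auto
  have "k \<noteq> 0" using k(2) by (metis not_one_le_zero zero_index)
  then show ?thesis using that k Am by auto
qed

text \<open>The potential is the integral of \<open>t f(x + t k)\<close> over \<open>t \<in> [0,1]\<close>.\<close>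
lemma line_potential:
  fixes f :: "real^'n::finite \<Rightarrow> real"
  assumes f: "C1_with_gradient f g" and per: "\<And>x. f (x + k) = f x"
  obtains \<Psi> G where "C1_with_gradient \<Psi> G" "\<And>x. G x \<bullet> k = f x - line_avg k f x"
    "Zn_periodic f \<Longrightarrow> Zn_periodic \<Psi>" "Zn_periodic g \<Longrightarrow> Zn_periodic G"
proof -
  define \<Psi> where "\<Psi> x = integral {0..1} (\<lambda>t. t * f (x + t *\<^sub>R k))" for x
  define G where "G x = integral {0..1} (\<lambda>t. t *\<^sub>R g (x + t *\<^sub>R k))" for x
  have fc: "continuous_on UNIV f" by (rule C1_continuous[OF f])
  have gc: "continuous_on UNIV g" using f by (simp add: C1_with_gradient_def)
  have fd: "(f has_derivative (\<lambda>h. h \<bullet> g x)) (at x)" for x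
    using f by (auto simp: C1_with_gradient_def gderiv_def)
  have gi: "(\<lambda>t. t *\<^sub>R g (x + t *\<^sub>R k)) integrable_on {0..1}" for x
    by (intro integrable_continuous_real continuous_intros continuous_on_line gc)
  have gc2: "continuous_on (UNIV \<times> cbox 0 1) (\<lambda>(x, t::real). t *\<^sub>R g (x + t *\<^sub>R k))"
    unfolding split_beta by (intro continuous_intros continuous_on_compose2[OF gc]) auto
  have "GDERIV \<Psi> x :> G x" for x
  proof -
    have "(\<Psi> has_derivative integral {0..1} (\<lambda>t. blinfun_inner_left (t *\<^sub>R g (x + t *\<^sub>R k)))) (at x)"
      unfolding \<Psi>_def interval_cbox
    proof (rule leibniz_rule)
      fix x t
      have "((\<lambda>x. f (x + t *\<^sub>R k)) has_derivative (\<lambda>h. h \<bullet> g (x + t *\<^sub>R k))) (at x)"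
        by (rule has_derivative_compose[OF _ fd, of "\<lambda>x. x + t *\<^sub>R k" "\<lambda>h. h", simplified])
          (auto intro!: derivative_eq_intros)
      then show "((\<lambda>x. t * f (x + t *\<^sub>R k)) has_derivative
          blinfun_apply (blinfun_inner_left (t *\<^sub>R g (x + t *\<^sub>R k)))) (at x)"
        by (rule has_derivative_eq_rhs[OF has_derivative_mult_right]) (auto simp: fun_eq_iff)
    next
      fix x
      show "(\<lambda>t. t * f (x + t *\<^sub>R k)) integrable_on cbox 0 1"
        unfolding interval_cbox[symmetric]
        by (intro integrable_continuous_real continuous_intros continuous_on_line fc)
    next
      show "continuous_on (UNIV \<times> cbox 0 1) (\<lambda>(x, t). blinfun_inner_left (t *\<^sub>R g (x + t *\<^sub>R k)))"
        using bounded_linear.continuous_on[OF bounded_linear_blinfun_inner_left gc2]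
        by (simp add: split_beta)
    qed auto
    also have "integral {0..1} (\<lambda>t. blinfun_inner_left (t *\<^sub>R g (x + t *\<^sub>R k))) = blinfun_inner_left (G x)"
      using integral_linear[OF gi bounded_linear_blinfun_inner_left, of x] by (simp add: o_def G_def)
    finally show ?thesis by (simp add: gderiv_def)
  qed
  moreover have "continuous_on UNIV G"
    using integral_continuous_on_param[OF gc2] by (simp add: G_def[abs_def])
  ultimately have "C1_with_gradient \<Psi> G" by (simp add: C1_with_gradient_def)
  moreover have "G x \<bullet> k = f x - line_avg k f x" for x
  proof -
    have d: "((\<lambda>t. t * f (x + t *\<^sub>R k)) has_vector_derivative
        (f (x + t *\<^sub>R k) + (t *\<^sub>R g (x + t *\<^sub>R k)) \<bullet> k)) (at t within {0..1})" for t
    proof -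
      have "((\<lambda>t. x + t *\<^sub>R k) has_derivative (\<lambda>s. s *\<^sub>R k)) (at t within {0..1})"
        by (auto intro!: derivative_eq_intros)
      from has_derivative_compose[OF this fd]
      have "((\<lambda>t. f (x + t *\<^sub>R k)) has_derivative (\<lambda>s. (s *\<^sub>R k) \<bullet> g (x + t *\<^sub>R k))) (at t within {0..1})" .
      then show ?thesis
        unfolding has_vector_derivative_def
        by (intro has_derivative_eq_rhs[OF has_derivative_mult[OF has_derivative_ident]])
          (auto simp: fun_eq_iff inner_commute algebra_simps)
    qed
    \<comment> \<open>The integrand is the derivative of t f (x + t k). The weight t kills the
      boundary term at 0, and periodicity turns the one at 1 into \<open>f x\<close>; subtracting
      the line average leaves \<open>G x \<bullet> k\<close>.\<close>
    have "((\<lambda>t. f (x + t *\<^sub>R k) + (t *\<^sub>R g (x + t *\<^sub>R k)) \<bullet> k) has_integral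
        (1 * f (x + 1 *\<^sub>R k) - 0 * f (x + 0 *\<^sub>R k))) {0..1}"
      by (rule fundamental_theorem_of_calculus[OF _ d]) simp
    then have "integral {0..1} (\<lambda>t. f (x + t *\<^sub>R k) + (t *\<^sub>R g (x + t *\<^sub>R k)) \<bullet> k) = f x"
      using per by (simp add: integral_unique)
    moreover have "integral {0..1} (\<lambda>t. f (x + t *\<^sub>R k) + (t *\<^sub>R g (x + t *\<^sub>R k)) \<bullet> k)
        = line_avg k f x + integral {0..1} (\<lambda>t. (t *\<^sub>R g (x + t *\<^sub>R k)) \<bullet> k)"
      unfolding line_avg_def
      by (intro integral_add integrable_continuous_real continuous_intros continuous_on_line fc gc)
    moreover have "integral {0..1} (\<lambda>t. (t *\<^sub>R g (x + t *\<^sub>R k)) \<bullet> k) = G x \<bullet> k"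
      using integral_linear[OF gi[of x] bounded_linear_inner_left[of k]] by (simp add: o_def G_def)
    ultimately show ?thesis by simp
  qed
  moreover have "Zn_periodic \<Psi>" if "Zn_periodic f"
  proof -
    have "f (x + m + t *\<^sub>R k) = f (x + t *\<^sub>R k)" if "\<forall>i. m $ i \<in> \<int>" for x m t
      using \<open>Zn_periodic f\<close> that unfolding Zn_periodic_def by (metis add.assoc add.commute)
    then show ?thesis by (simp add: Zn_periodic_def \<Psi>_def)
  qed
  moreover have "Zn_periodic G" if "Zn_periodic g"
  proof -
    have "g (x + m + t *\<^sub>R k) = g (x + t *\<^sub>R k)" if "\<forall>i. m $ i \<in> \<int>" for x m t
      using \<open>Zn_periodic g\<close> that unfolding Zn_periodic_def by (metis add.assoc add.commute)
    then show ?thesis by (simp add: Zn_periodic_def G_def)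
  qed
  ultimately show ?thesis using that by blast
qed

section \<open>Trigonometric polynomials\<close>

lemma mean_add:
  fixes f g :: "real^'n::finite \<Rightarrow> 'b::banach"
  assumes "continuous_on UNIV f" "continuous_on UNIV g"
  shows "mean (\<lambda>x. f x + g x) = mean f + mean g"
  unfolding mean_def
  by (intro integral_add integrable_continuous continuous_on_subset[OF assms(1)] continuous_on_subset[OF assms(2)]) auto

lemma mean_linear:
  fixes f :: "real^'n::finite \<Rightarrow> 'b::banach" and T :: "'b \<Rightarrow> 'c::banach"
  assumes "continuous_on UNIV f" "bounded_linear T"
  shows "mean (\<lambda>x. T (f x)) = T (mean f)"
proof -
  have "f integrable_on cbox 0 1"
    by (intro integrable_continuous continuous_on_subset[OF assms(1)]) auto
  from integral_linear[OF this assms(2)] show ?thesis by (simp add: mean_def o_def)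
qed

lemma mean_sum:
  fixes f :: "'i \<Rightarrow> real^'n::finite \<Rightarrow> 'b::banach"
  assumes "finite I" "\<And>i. i \<in> I \<Longrightarrow> continuous_on UNIV (f i)"
  shows "mean (\<lambda>x. \<Sum>i\<in>I. f i x) = (\<Sum>i\<in>I. mean (f i))"
  unfolding mean_def
  by (intro integral_sum assms(1) integrable_continuous continuous_on_subset[OF assms(2)]) auto

text \<open>The phase \<open>\<theta>\<close> covers sines along with cosines, so every real Fourier
  mode is one generator, and linear identities for means need checking on single modes only.\<close>

inductive trig :: "(real^'n::finite \<Rightarrow> real) \<Rightarrow> bool" where
  cos: "(\<And>i. m $ i \<in> \<int>) \<Longrightarrow> trig (\<lambda>x. cos (2 * pi * (m \<bullet> x) + \<theta>))"
| add: "trig f \<Longrightarrow> trig g \<Longrightarrow> trig (\<lambda>x. f x + g x)"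
| scale: "trig f \<Longrightarrow> trig (\<lambda>x. c * f x)"

lemma trig_const: "trig (\<lambda>x. c)"
  using trig.scale[OF trig.cos[of 0 0], of c] by simp

lemma trig_cos_mult:
  assumes m: "\<And>i. m $ i \<in> \<int>" and g: "trig g"
  shows "trig (\<lambda>x. cos (2 * pi * (m \<bullet> x) + \<theta>) * g x)"
  using g
proof induction
  case (cos m' \<theta>')
  have "(\<lambda>x. cos (2 * pi * (m \<bullet> x) + \<theta>) * cos (2 * pi * (m' \<bullet> x) + \<theta>')) =
    (\<lambda>x. 1 / 2 * cos (2 * pi * ((m - m') \<bullet> x) + (\<theta> - \<theta>')) + 1 / 2 * cos (2 * pi * ((m + m') \<bullet> x) + (\<theta> + \<theta>')))"
  proof
    fix x
    have e: "2 * pi * ((m - m') \<bullet> x) + (\<theta> - \<theta>') = (2 * pi * (m \<bullet> x) + \<theta>) - (2 * pi * (m' \<bullet> x) + \<theta>')"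
      "2 * pi * ((m + m') \<bullet> x) + (\<theta> + \<theta>') = (2 * pi * (m \<bullet> x) + \<theta>) + (2 * pi * (m' \<bullet> x) + \<theta>')"
      by (simp_all add: inner_diff_left inner_add_left algebra_simps)
    show "cos (2 * pi * (m \<bullet> x) + \<theta>) * cos (2 * pi * (m' \<bullet> x) + \<theta>') =
      1 / 2 * cos (2 * pi * ((m - m') \<bullet> x) + (\<theta> - \<theta>')) + 1 / 2 * cos (2 * pi * ((m + m') \<bullet> x) + (\<theta> + \<theta>'))"
      unfolding e by (simp add: cos_times_cos add_divide_distrib)
  qed
  then show ?case by (simp only:, intro trig.add trig.scale trig.cos) (auto intro: Ints_add Ints_diff m cos)
next
  case (add f g)
  then show ?case using trig.add[OF add.IH] by (simp add: distrib_left)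
next
  case (scale f c)
  then show ?case using trig.scale[OF scale.IH, of c] by (simp add: mult.left_commute)
qed

lemma trig_mult:
  assumes "trig f" "trig g" shows "trig (\<lambda>x. f x * g x)"
  using assms(1)
proof induction
  case (cos m \<theta>)
  then show ?case by (rule trig_cos_mult[OF _ assms(2)])
next
  case (add f h)
  then show ?case using trig.add[OF add.IH] by (simp add: distrib_right)
next
  case (scale f c)
  then show ?case using trig.scale[OF scale.IH, of c] by (simp add: mult.assoc)
qed

lemma trig_power: "trig f \<Longrightarrow> trig (\<lambda>x. f x ^ N)"
  by (induction N) (auto intro: trig_const trig_mult)

lemma trig_sum: "finite I \<Longrightarrow> (\<And>i. i \<in> I \<Longrightarrow> trig (f i)) \<Longrightarrow> trig (\<lambda>x. \<Sum>i\<in>I. f i x)"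
  by (induction I rule: finite_induct) (auto intro: trig_const trig.add)

lemma trig_continuous: "trig f \<Longrightarrow> continuous_on S f"
  by (induction rule: trig.induct) (auto intro!: continuous_intros)

lemma cos_character_periodic:
  fixes m k :: "real^'n::finite"
  assumes "\<And>i. m $ i \<in> \<int>" "\<And>i. k $ i \<in> \<int>"
  shows "cos (2 * pi * (m \<bullet> (x + k)) + \<theta>) = cos (2 * pi * (m \<bullet> x) + \<theta>)"
proof -
  have "m \<bullet> k \<in> \<int>" using assms by (auto simp: inner_vec_def intro!: Ints_sum Ints_mult)
  then obtain z where "m \<bullet> k = of_int z" by (auto elim: Ints_cases)
  then have "2 * pi * (m \<bullet> (x + k)) + \<theta> = 2 * pi * (m \<bullet> x) + \<theta> + (2 * pi) * of_int z"
    by (simp add: inner_add_right algebra_simps)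
  then show ?thesis by (simp only: cos_add[of _ "(2 * pi) * of_int z"] cos_int_2pin sin_int_2pin mult_1_right mult_zero_right diff_0_right)
qed

lemma trig_periodic: "trig f \<Longrightarrow> Zn_periodic f"
proof (induction rule: trig.induct)
  case (cos m \<theta>)
  then show ?case unfolding Zn_periodic_def by (auto intro: cos_character_periodic)
qed (auto simp: Zn_periodic_def)

text \<open>Powers of the trigonometric polynomial \<open>Q\<close> below, which exceeds \<open>1\<close> only near the lattice, concentrate at \<open>x0\<close>.\<close>
lemma trig_orthogonal_imp_nonpos:
  fixes h :: "real^'n::finite \<Rightarrow> real"
  assumes h: "continuous_on UNIV h" "Zn_periodic h"
    and orth: "\<And>f. trig f \<Longrightarrow> mean (\<lambda>x. f x * h x) = 0"
  shows "h x0 \<le> 0"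
proof (rule ccontr)
  assume "\<not> ?thesis"
  then have pos: "h x0 > 0" by simp
  define \<gamma> where "\<gamma> = h x0 / 2"
  define n where "n = real CARD('n)"
  have n: "n > 0" by (simp add: n_def)
  \<comment> \<open>The sum of sin^2 (pi y_i): a periodic substitute for the squared distance,
    vanishing exactly on the lattice.\<close>
  define R where "R y = (\<Sum>i\<in>UNIV. (1 - cos (2 * pi * y $ i)) / 2)" for y :: "real^'n"
  have Rc: "continuous_on S R" for S unfolding R_def by (intro continuous_intros) auto
  have Rn: "R y \<le> n" for y
  proof -
    have "R y \<le> (\<Sum>i\<in>(UNIV::'n set). 1)"
      unfolding R_def
    proof (rule sum_mono)
      fix i
      show "(1 - cos (2 * pi * y $ i)) / 2 \<le> 1" using cos_ge_minus_one[of "2 * pi * y $ i"] by simp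
    qed
    then show ?thesis by (simp add: n_def)
  qed
  obtain B where B: "B > 0" "\<And>x. norm (h x) \<le> B" using Zn_periodic_bounded[OF h] by blast
  obtain \<delta> where \<delta>: "\<delta> > 0" "\<And>y. norm y < \<delta> \<Longrightarrow> h (x0 + y) > \<gamma>"
  proof -
    have "\<exists>\<delta>>0. \<forall>x'. dist x' x0 < \<delta> \<longrightarrow> dist (h x') (h x0) < \<gamma>"
      using h(1) pos unfolding continuous_on_iff \<gamma>_def by (metis UNIV_I half_gt_zero)
    then obtain \<delta> where d: "\<delta> > 0" "\<And>x'. dist x' x0 < \<delta> \<Longrightarrow> dist (h x') (h x0) < \<gamma>" by blast
    show ?thesis
    proof (rule that[OF d(1)])
      fix y :: "real^'n" assume "norm y < \<delta>"
      then have "\<bar>h (x0 + y) - h x0\<bar> < \<gamma>" using d(2)[of "x0 + y"] by (simp add: dist_norm)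
      then show "h (x0 + y) > \<gamma>" unfolding \<gamma>_def by linarith
    qed
  qed
  \<comment> \<open>A period cube centred at 0 has 0 as its only lattice point, so \<open>Q\<close>
    has a single peak in it.\<close>
  define c where "c = (- (1/2)) *\<^sub>R (1 :: real^'n)"
  define C where "C = cbox c (1 + c)"
  have Cc: "compact C" by (simp add: C_def)
  have CI: "\<bar>y $ i\<bar> \<le> 1 / 2" if "y \<in> C" for y i
  proof -
    have "- (1 / 2) \<le> y $ i" "y $ i \<le> 1 / 2" using that by (auto simp: C_def c_def mem_box_cart)
    then show ?thesis by linarith
  qed
  have Rpos: "R y > 0" if yC: "y \<in> C" and y0: "y \<noteq> 0" for y
  proof -
    obtain i where i: "y $ i \<noteq> 0" using y0 by (auto simp: vec_eq_iff)
    have "cos \<bar>2 * pi * y $ i\<bar> < cos 0"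
    proof (rule cos_monotone_0_pi)
      have "2 * pi * \<bar>y $ i\<bar> \<le> 2 * pi * (1 / 2)" using CI[OF yC, of i] by (intro mult_left_mono) auto
      then show "\<bar>2 * pi * y $ i\<bar> \<le> pi" by (simp add: abs_mult)
    qed (use i in auto)
    then have "0 < (1 - cos (2 * pi * y $ i)) / 2" by simp
    then show ?thesis unfolding R_def by (intro sum_pos2[where i=i]) auto
  qed
  \<comment> \<open>The minimum of \<open>R\<close> on the part of the cube away from the peak; if
    that part is empty, the value 1 is taken.\<close>
  obtain \<beta> where \<beta>: "\<beta> > 0" "\<And>y. y \<in> C \<Longrightarrow> norm y \<ge> \<delta> \<Longrightarrow> R y \<ge> \<beta>"
  proof (cases "C - ball 0 \<delta> = {}")
    case True
    have "R y \<ge> 1" if "y \<in> C" "norm y \<ge> \<delta>" for y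
    proof -
      have "y \<in> C - ball 0 \<delta>" using that by simp
      then show ?thesis using True by blast
    qed
    then show ?thesis using that[of 1] by simp
  next
    case False
    have "compact (C - ball 0 \<delta>)" using Cc by (intro compact_diff) auto
    then obtain y where y: "y \<in> C - ball 0 \<delta>" "\<And>z. z \<in> C - ball 0 \<delta> \<Longrightarrow> R y \<le> R z"
      using continuous_attains_inf[OF _ False Rc] by blast
    have "R y > 0" using y(1) \<delta>(1) by (intro Rpos) auto
    then show ?thesis using that[of "R y"] y(2) by auto
  qed
  define \<kappa> where "\<kappa> = \<beta> / (2 * n)"
  have \<kappa>: "\<kappa> > 0" using \<beta> n by (simp add: \<kappa>_def)
  \<comment> \<open>Calibrated so that \<open>R y \<ge> \<beta>\<close> gives
    \<open>Q y \<le> 1\<close>, \<open>R y < \<beta> / 2\<close> gives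
    \<open>Q y \<ge> 1 + \<kappa>\<close>, and \<open>R y \<le> n\<close> keeps \<open>Q\<close>
    nonnegative.\<close>
  define Q where "Q y = 1 + \<beta> / n - 1 / n * R y" for y
  have Q0: "Q y \<ge> 0" for y
  proof -
    have "1 / n * R y \<le> 1 / n * n" using Rn n by (intro mult_left_mono) auto
    then have "1 / n * R y \<le> 1" using n by simp
    moreover have "\<beta> / n > 0" using \<beta> n by simp
    ultimately show ?thesis by (simp add: Q_def)
  qed
  obtain r where r: "r > 0" "\<And>y. norm y < r \<Longrightarrow> R y < \<beta> / 2"
  proof -
    have "R 0 = 0" by (simp add: R_def)
    then have "\<exists>r>0. \<forall>x'. dist x' 0 < r \<longrightarrow> dist (R x') 0 < \<beta> / 2"
      using Rc[of UNIV] \<beta>(1) unfolding continuous_on_iff by (metis UNIV_I half_gt_zero)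
    then obtain r where r: "r > 0" "\<And>x'. dist x' 0 < r \<Longrightarrow> dist (R x') 0 < \<beta> / 2" by blast
    have "R y < \<beta> / 2" if "norm y < r" for y using r(2)[of y] that by simp
    then show ?thesis using that[OF r(1)] by blast
  qed
  obtain a b :: "real^'n" where ab: "cbox a b \<subseteq> ball 0 r \<inter> box c (1 + c)" "measure lborel (cbox a b) > 0"
  proof -
    have "open (ball (0::real^'n) r \<inter> box c (1 + c))" by (intro open_Int open_ball open_box)
    moreover have "(0::real^'n) \<in> ball 0 r \<inter> box c (1 + c)"
      using r(1) by (auto simp: c_def mem_box_cart)
    ultimately obtain a b where ab: "(0::real^'n) \<in> box a b" "cbox a b \<subseteq> ball 0 r \<inter> box c (1 + c)"
      using open_contains_cbox by metis
    then have "box a b \<noteq> {}" by blast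
    then have "measure lborel (cbox a b) > 0" using content_pos_lt_eq box_ne_empty by (metis (no_types, lifting))
    then show ?thesis using that ab(2) by blast
  qed
  have abC: "cbox a b \<subseteq> C" using ab(1) box_subset_cbox unfolding C_def by blast
  \<comment> \<open>Adding \<open>B\<close> makes the integrand nonnegative on the cube. By
    orthogonality its integral is then exactly \<open>B\<close>, while the small box near the peak
    alone contributes an amount growing geometrically in \<open>N\<close>.\<close>
  have key: "\<gamma> * (1 + \<kappa>) ^ N * measure lborel (cbox a b) \<le> B" for N
  proof -
    define K where "K x = Q (x - x0) ^ N * h x" for x
    have Qt: "trig (\<lambda>x. Q (x - x0))"
    proof -
      have e: "(\<lambda>x. Q (x - x0)) = (\<lambda>x. (1 + \<beta> / n) + (- (1 / n)) * (\<Sum>i\<in>UNIV. 1 / 2 + (- (1 / 2)) *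
        cos (2 * pi * (axis i 1 \<bullet> x) + (- 2 * pi * x0 $ i))))"
        by (simp add: fun_eq_iff Q_def R_def diff_divide_distrib inner_axis' algebra_simps)
      show ?thesis
        unfolding e by (intro trig.add trig.scale trig_const trig_sum finite trig.cos) (auto simp: axis_def)
    qed
    have Qc: "continuous_on UNIV (\<lambda>x. Q (x - x0))" by (rule trig_continuous[OF Qt])
    have Kc: "continuous_on UNIV K" unfolding K_def by (intro continuous_intros Qc h)
    have Kp: "Zn_periodic K" using trig_periodic[OF trig_power[OF Qt, of N]] h(2)
      by (auto simp: Zn_periodic_def K_def)
    have K0: "mean K = 0" unfolding K_def by (rule orth[OF trig_power[OF Qt]])
    have KC: "integral C (\<lambda>y. K (x0 + y)) = 0"
    proof -
      have "integral C (\<lambda>y. K (x0 + y)) = integral (cbox 0 1) ((\<lambda>y. K (x0 + y)) \<circ> (+) c)"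
        using integral_shift_cbox_plus[of 0 1 "\<lambda>y. K (x0 + y)" c] by (simp add: C_def)
      also have "\<dots> = mean (\<lambda>x. K (x + (x0 + c)))" by (simp add: mean_def o_def add_ac)
      also have "\<dots> = 0" by (simp add: mean_translate[OF Kc Kp] K0)
      finally show ?thesis .
    qed
    have Kx: "continuous_on S (\<lambda>y. K (x0 + y))" for S
      by (rule continuous_on_compose2[OF Kc]) (auto intro!: continuous_intros)
    have ge: "K (x0 + y) + B \<ge> 0" if y: "y \<in> C" for y
    proof (cases "norm y < \<delta>")
      case True
      have "h (x0 + y) \<ge> 0" using \<delta>(2)[OF True] pos by (simp add: \<gamma>_def)
      then have "K (x0 + y) \<ge> 0" using Q0 by (simp add: K_def)
      then show ?thesis using B by linarith
    next
      case False
      then have "R y \<ge> \<beta>" using \<beta>(2)[OF y] by simp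
      then have "1 / n * R y \<ge> \<beta> / n" using n by (simp add: field_simps)
      then have "Q y \<le> 1" by (simp add: Q_def)
      then have "Q y ^ N \<le> 1" "Q y ^ N \<ge> 0" using Q0 by (auto simp: power_le_one)
      then have "\<bar>K (x0 + y)\<bar> \<le> 1 * B"
        using mult_mono[of "Q y ^ N" 1 "\<bar>h (x0 + y)\<bar>" B] B(2)[of "x0 + y"] B(1) Q0[of y]
        by (simp add: K_def abs_mult)
      then show ?thesis by linarith
    qed
    have big: "\<gamma> * (1 + \<kappa>) ^ N \<le> K (x0 + y) + B" if y: "y \<in> cbox a b" for y
    proof -
      have "norm y < r" using ab(1) y by auto
      then have Ry: "R y < \<beta> / 2" by (rule r(2))
      then have "norm y < \<delta>" using \<beta>(1) \<beta>(2)[of y] subsetD[OF abC y] by (cases "norm y < \<delta>") auto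
      then have hy: "h (x0 + y) > \<gamma>" by (rule \<delta>(2))
      have "1 / n * R y \<le> 1 / n * (\<beta> / 2)" using Ry n by (intro mult_left_mono) auto
      then have "Q y \<ge> 1 + \<kappa>" using n by (simp add: Q_def \<kappa>_def field_simps)
      then have "(1 + \<kappa>) ^ N \<le> Q y ^ N" using \<kappa> by (intro power_mono) auto
      then have "(1 + \<kappa>) ^ N * \<gamma> \<le> Q y ^ N * h (x0 + y)"
        using hy \<kappa> Q0 pos by (intro mult_mono) (auto simp: \<gamma>_def)
      then show ?thesis using B(1) by (simp add: K_def mult.commute)
    qed
    have "\<gamma> * (1 + \<kappa>) ^ N * measure lborel (cbox a b) = integral (cbox a b) (\<lambda>y. \<gamma> * (1 + \<kappa>) ^ N)"
      by simp
    also have "\<dots> \<le> integral (cbox a b) (\<lambda>y. K (x0 + y) + B)"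
      by (intro integral_le integrable_continuous continuous_intros Kx) (use big in auto)
    also have "\<dots> \<le> integral C (\<lambda>y. K (x0 + y) + B)"
      by (intro integral_subset_le abC) (use ge in \<open>auto simp: C_def intro!: integrable_continuous continuous_intros Kx\<close>)
    also have "\<dots> = integral C (\<lambda>y. K (x0 + y)) + integral C (\<lambda>y. B)"
      unfolding C_def by (intro integral_add integrable_continuous continuous_intros Kx)
    also have "integral C (\<lambda>y. B) = B"
    proof -
      have "integral C (\<lambda>y. B) = integral (cbox 0 1) (\<lambda>y::real^'n. B)"
        using integral_shift_cbox_plus[of 0 1 "\<lambda>y. B" c, symmetric]
        by (simp only: C_def o_def add_0_left)
      also have "\<dots> = B" by (simp add: One_vec[symmetric])
      finally show ?thesis .
    qed
    finally show ?thesis using KC by simp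
  qed
  have \<gamma>c: "\<gamma> * measure lborel (cbox a b) > 0" using pos ab(2) by (simp add: \<gamma>_def)
  obtain N where "B / (\<gamma> * measure lborel (cbox a b)) < (1 + \<kappa>) ^ N" using real_arch_pow[of "1 + \<kappa>"] \<kappa> by auto
  then have "B < \<gamma> * (1 + \<kappa>) ^ N * measure lborel (cbox a b)" using \<gamma>c by (simp add: field_simps)
  then show False using key[of N] by linarith
qed

section \<open>Vector fields with nonpositive line averages\<close>

lemma C1_mult:
  assumes f: "C1_with_gradient f f'" and g: "C1_with_gradient g g'"
  shows "C1_with_gradient (\<lambda>x. f x * g x) (\<lambda>x. f x *\<^sub>R g' x + g x *\<^sub>R f' x)"
  unfolding C1_with_gradient_def
proof (intro conjI allI)
  fix x
  show "GDERIV (\<lambda>x. f x * g x) x :> f x *\<^sub>R g' x + g x *\<^sub>R f' x"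
    using f g by (intro GDERIV_mult) (auto simp: C1_with_gradient_def)
  show "continuous_on UNIV (\<lambda>x. f x *\<^sub>R g' x + g x *\<^sub>R f' x)"
    using f g C1_continuous[OF f] C1_continuous[OF g]
    by (intro continuous_intros) (auto simp: C1_with_gradient_def)
qed

lemma C1_sin:
  "C1_with_gradient (\<lambda>x. sin (a * (m \<bullet> x) + \<theta>)) (\<lambda>x. (a * cos (a * (m \<bullet> x) + \<theta>)) *\<^sub>R m)"
  unfolding C1_with_gradient_def gderiv_def
  by (auto intro!: continuous_intros derivative_eq_intros simp: inner_commute algebra_simps)

text \<open>The difference \<open>f (y + k) - f y\<close> is constantly 0, so every point is a
  maximum of it and the gradients agree.\<close>

lemma C1_gradient_periodic:
  assumes f: "C1_with_gradient f g" "Zn_periodic f"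
  shows "Zn_periodic g"
  unfolding Zn_periodic_def
proof (intro allI impI)
  fix x k :: "real^'a" assume k: "\<forall>i. k $ i \<in> \<int>"
  have "\<forall>\<^sub>F y in nhds x. f (y + k) - f y \<le> f (x + k) - f x"
    using f(2) k by (simp add: Zn_periodic_def)
  from C1_gradient_eq_at_max[OF C1_translate[OF f(1)] f(1) this] show "g (x + k) = g x" .
qed

text \<open>Along a closed line in direction \<open>e\<close> the derivative integrates to f (x + e)
  - f x = 0, and averaging along lines preserves the mean.\<close>

lemma mean_directional_derivative:
  fixes f :: "real^'n::finite \<Rightarrow> real"
  assumes f: "C1_with_gradient f g" "Zn_periodic f" and e: "\<And>i. e $ i \<in> \<int>"
  shows "mean (\<lambda>x. g x \<bullet> e) = 0"
proof -
  have gc: "continuous_on UNIV (\<lambda>x. g x \<bullet> e)"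
    using f(1) by (auto simp: C1_with_gradient_def intro!: continuous_intros)
  have gp: "Zn_periodic (\<lambda>x. g x \<bullet> e)"
    using C1_gradient_periodic[OF f] by (simp add: Zn_periodic_def)
  have "line_avg e (\<lambda>x. g x \<bullet> e) x = 0" for x
  proof -
    have d: "((\<lambda>t. f (x + t *\<^sub>R e)) has_vector_derivative (g (x + t *\<^sub>R e) \<bullet> e)) (at t within {0..1})" for t
    proof -
      have "((\<lambda>t. x + t *\<^sub>R e) has_derivative (\<lambda>s. s *\<^sub>R e)) (at t within {0..1})"
        by (auto intro!: derivative_eq_intros)
      moreover have "(f has_derivative (\<lambda>h. h \<bullet> g (x + t *\<^sub>R e))) (at (x + t *\<^sub>R e))"
        using f(1) by (auto simp: C1_with_gradient_def gderiv_def)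
      ultimately have "((\<lambda>t. f (x + t *\<^sub>R e)) has_derivative (\<lambda>s. (s *\<^sub>R e) \<bullet> g (x + t *\<^sub>R e))) (at t within {0..1})"
        by (rule has_derivative_compose)
      then show ?thesis
        unfolding has_vector_derivative_def by (simp add: inner_commute)
    qed
    have "((\<lambda>t. g (x + t *\<^sub>R e) \<bullet> e) has_integral (f (x + 1 *\<^sub>R e) - f (x + 0 *\<^sub>R e))) {0..1}"
      by (rule fundamental_theorem_of_calculus[OF _ d]) simp
    then show ?thesis
      using Zn_periodicD[OF f(2) e] by (simp add: line_avg_def integral_unique)
  qed
  then have "line_avg e (\<lambda>x. g x \<bullet> e) = (\<lambda>x. 0)" by (rule ext)
  then show ?thesis using mean_line_avg[OF gc gp, of e] by (simp add: mean_def)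
qed

text \<open>Links the Frechet partial derivatives behind \<open>smooth\<close> with the scalar
  notion \<open>C1_with_gradient\<close>.\<close>

lemma smooth_component_C1:
  fixes V :: "real^'n::finite \<Rightarrow> real^'n"
  assumes "smooth V"
  shows "C1_with_gradient (\<lambda>x. V x \<bullet> a) (\<lambda>x. \<chi> i. partial_deriv i V x \<bullet> a)"
  unfolding C1_with_gradient_def
proof (intro conjI allI)
  have "Ck (Suc 0) V" using assms unfolding smooth_def by blast
  then have dif: "V differentiable_on UNIV" and pc: "\<And>i. continuous_on UNIV (partial_deriv i V)"
    by auto
  show "continuous_on UNIV (\<lambda>x. \<chi> i. partial_deriv i V x \<bullet> a)"
    by (intro continuous_intros pc)
  fix x
  have D: "(V has_derivative frechet_derivative V (at x)) (at x)"
    using dif by (simp add: differentiable_on_def frechet_derivative_works)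
  have lin: "linear (frechet_derivative V (at x))" using D has_derivative_linear by blast
  have fr: "frechet_derivative V (at x) h = (\<Sum>i\<in>UNIV. h $ i *\<^sub>R partial_deriv i V x)" for h
  proof -
    have "frechet_derivative V (at x) h = frechet_derivative V (at x) (\<Sum>i\<in>UNIV. h $ i *\<^sub>R axis i 1)"
      using basis_expansion[of h] by (simp add: scalar_mult_eq_scaleR)
    also have "\<dots> = (\<Sum>i\<in>UNIV. h $ i *\<^sub>R partial_deriv i V x)"
      by (simp add: linear_sum[OF lin] linear_scale[OF lin] partial_deriv_def)
    finally show ?thesis .
  qed
  have "((\<lambda>x. V x \<bullet> a) has_derivative (\<lambda>h. frechet_derivative V (at x) h \<bullet> a)) (at x)"
    using D by (auto intro!: derivative_eq_intros)
  then show "GDERIV (\<lambda>x. V x \<bullet> a) x :> (\<chi> i. partial_deriv i V x \<bullet> a)"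
    unfolding gderiv_def
    by (rule has_derivative_eq_rhs) (simp add: fun_eq_iff fr inner_sum_left inner_vec_def[of _ "\<chi> i. _ i"])
qed

lemma smooth_continuous: "smooth V \<Longrightarrow> continuous_on UNIV V"
  unfolding smooth_def by (metis Ck.simps(1))

lemma smooth_periodic_lipschitz:
  fixes V :: "real^'n::finite \<Rightarrow> real^'n"
  assumes V: "smooth V" "Zn_periodic V"
  obtains L where "L-lipschitz_on UNIV V"
proof -
  have "\<exists>B>0. \<forall>x y. \<bar>V x \<bullet> axis i 1 - V y \<bullet> axis i 1\<bar> \<le> B * norm (x - y)" for i
  proof -
    define f where "f x = V x \<bullet> axis i 1" for x
    define g where "g x = (\<chi> j. partial_deriv j V x \<bullet> axis i 1)" for x
    have f: "C1_with_gradient f g" unfolding f_def g_def by (rule smooth_component_C1[OF V(1)])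
    have fp: "Zn_periodic f" using V(2) by (simp add: Zn_periodic_def f_def)
    have gc: "continuous_on UNIV g" using f by (simp add: C1_with_gradient_def)
    obtain B where B: "B > 0" "\<And>x. norm (g x) \<le> B"
      using Zn_periodic_bounded[OF gc C1_gradient_periodic[OF f fp]] by blast
    have "norm (f x - f y) \<le> B * norm (x - y)" for x y
    proof (rule differentiable_bound[of UNIV f "\<lambda>x h. h \<bullet> g x"])
      fix x
      show "(f has_derivative (\<lambda>h. h \<bullet> g x)) (at x within UNIV)"
        using f by (simp add: C1_with_gradient_def gderiv_def)
      show "onorm (\<lambda>h. h \<bullet> g x) \<le> B"
      proof (rule onorm_bound)
        fix h
        have "norm (h \<bullet> g x) \<le> norm h * norm (g x)" using Cauchy_Schwarz_ineq2 by simp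
        also have "\<dots> \<le> norm h * B" using B(2) by (intro mult_left_mono) auto
        finally show "norm (h \<bullet> g x) \<le> B * norm h" by (simp add: mult.commute)
      qed (use B in simp)
    qed auto
    then show ?thesis using B(1) by (auto simp: f_def)
  qed
  then obtain B where B: "\<And>i. B i > 0" "\<And>i x y. \<bar>V x \<bullet> axis i 1 - V y \<bullet> axis i 1\<bar> \<le> B i * norm (x - y)"
    by metis
  have "(\<Sum>i\<in>UNIV. B i)-lipschitz_on UNIV V"
  proof (rule lipschitz_onI)
    fix x y
    have "norm (V x - V y) \<le> (\<Sum>i\<in>UNIV. \<bar>(V x - V y) $ i\<bar>)" by (rule norm_le_l1_cart)
    also have "\<dots> \<le> (\<Sum>i\<in>UNIV. B i * norm (x - y))"
      using B(2) by (intro sum_mono) (simp add: cart_eq_inner_axis inner_diff_left)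
    finally show "dist (V x) (V y) \<le> (\<Sum>i\<in>UNIV. B i) * dist x y"
      by (simp add: dist_norm sum_distrib_right)
  qed (use B in \<open>simp add: sum_nonneg less_imp_le\<close>)
  then show ?thesis using that by blast
qed

text \<open>A closed line may be traversed backwards. For \<open>V x \<bullet> k\<close> this makes
  the averages for \<open>k\<close> and \<open>- k\<close> opposite, so nonpositivity for both
  forces them to vanish.\<close>

lemma line_avg_uminus:
  fixes f :: "real^'n::finite \<Rightarrow> 'b::banach"
  assumes f: "continuous_on UNIV f" and per: "\<And>x. f (x + k) = f x"
  shows "line_avg (- k) f x = line_avg k f x"
proof -
  have "line_avg k f x = integral {-1..0} (\<lambda>t. f (x + (- t) *\<^sub>R k))"
    using Henstock_Kurzweil_Integration.integral_reflect_real[of 1 0 "\<lambda>t. f (x + t *\<^sub>R k)"] by (simp add: line_avg_def)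
  also have "\<dots> = integral {0 - 1..1 - 1} (\<lambda>t. f (x - (t + 1) *\<^sub>R k))"
  proof -
    have "f (x + (- t) *\<^sub>R k) = f (x - (t + 1) *\<^sub>R k)" for t
      using per[of "x - (t + 1) *\<^sub>R k"] by (simp add: algebra_simps)
    then show ?thesis by simp
  qed
  also have "\<dots> = integral {0..1} (\<lambda>t. f (x - t *\<^sub>R k))"
    by (rule integral_shift_real_ivl)
  finally show ?thesis by (simp add: line_avg_def)
qed

text \<open>The integer vectors m_j e_i - m_i e_j are orthogonal to \<open>m\<close> and already
  force \<open>w\<close> to be parallel to \<open>m\<close>.\<close>

lemma integer_orthogonal_complement:
  fixes w m :: "real^'n::finite"
  assumes "m \<noteq> 0" "w \<bullet> m = 0" "\<And>i. m $ i \<in> \<int>"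
    and orth: "\<And>k. (\<forall>i. k $ i \<in> \<int>) \<Longrightarrow> m \<bullet> k = 0 \<Longrightarrow> w \<bullet> k = 0"
  shows "w = 0"
proof (rule vec_eq_iff[THEN iffD2], rule allI)
  fix i
  have ij: "w $ i * m $ j = w $ j * m $ i" for j
  proof -
    define k where "k = m $ j *\<^sub>R axis i 1 - m $ i *\<^sub>R (axis j 1 :: real^'n)"
    have "\<forall>l. k $ l \<in> \<int>" using assms(3) by (auto simp: k_def axis_def)
    moreover have "m \<bullet> k = 0" by (simp add: k_def inner_diff_right inner_axis)
    ultimately have "w \<bullet> k = 0" by (rule orth)
    then show ?thesis by (simp add: k_def inner_diff_right inner_axis mult.commute)
  qed
  have "w $ i * (m \<bullet> m) = (\<Sum>j\<in>UNIV. w $ i * m $ j * m $ j)"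
    by (simp add: inner_vec_def sum_distrib_left mult.assoc)
  also have "\<dots> = (\<Sum>j\<in>UNIV. w $ j * m $ j) * m $ i"
    by (simp only: ij sum_distrib_right) (simp only: mult_ac)
  also have "\<dots> = 0" using assms(2) by (simp add: inner_vec_def)
  finally show "w $ i = 0 $ i" using assms(1) by simp
qed

lemma nonpos_line_averages_imp_zero:
  fixes V :: "real^'n::finite \<Rightarrow> real^'n"
  assumes V: "smooth V" "Zn_periodic V" and div: "\<And>x. divergence V x = 0" and mean: "mean V = 0"
    and line: "\<And>k x. (\<forall>i. k $ i \<in> \<int>) \<Longrightarrow> line_avg k (\<lambda>x. V x \<bullet> k) x \<le> 0"
  shows "V x0 = 0"
proof -
  have Vc: "continuous_on UNIV V" by (rule smooth_continuous[OF V(1)])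
  have line0: "line_avg k (\<lambda>x. V x \<bullet> k) x = 0" if k: "\<forall>i. k $ i \<in> \<int>" for k x
  proof -
    have "line_avg (- k) (\<lambda>x. V x \<bullet> (- k)) x = - line_avg (- k) (\<lambda>x. V x \<bullet> k) x"
      by (simp add: line_avg_def)
    also have "line_avg (- k) (\<lambda>x. V x \<bullet> k) x = line_avg k (\<lambda>x. V x \<bullet> k) x"
      by (rule line_avg_uminus) (use k V(2) Vc in \<open>auto simp: Zn_periodic_def intro!: continuous_intros\<close>)
    finally show ?thesis using line[of k x] line[of "- k" x] k by auto
  qed
  have coeff: "mean (\<lambda>x. cos (2 * pi * (m \<bullet> x) + \<theta>) *\<^sub>R V x) = 0" if m: "\<And>i. m $ i \<in> \<int>" for m \<theta>
  proof (cases "m = 0")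
    case True
    then show ?thesis
      using mean_linear[OF Vc bounded_linear_scaleR_right, of "cos \<theta>"] mean by simp
  next
    case False
    define \<xi> where "\<xi> x = cos (2 * pi * (m \<bullet> x) + \<theta>)" for x
    define \<eta> where "\<eta> x = sin (2 * pi * (m \<bullet> x) + \<theta>)" for x
    have \<xi>c: "continuous_on UNIV \<xi>" and \<xi>p: "Zn_periodic \<xi>"
      using trig_continuous[OF trig.cos[OF m]] trig_periodic[OF trig.cos[OF m]] by (simp_all add: \<xi>_def[abs_def])
    have \<eta>p: "Zn_periodic \<eta>"
    proof -
      have "\<eta> = (\<lambda>x. cos (2 * pi * (m \<bullet> x) + (\<theta> - pi / 2)))"
        by (simp add: \<eta>_def fun_eq_iff cos_diff cos_add sin_add sin_diff)
      then show ?thesis using trig_periodic[OF trig.cos[OF m]] by simp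
    qed
    have \<xi>V: "continuous_on UNIV (\<lambda>x. \<xi> x *\<^sub>R V x)" by (intro continuous_intros \<xi>c Vc)
    define w where "w = mean (\<lambda>x. \<xi> x *\<^sub>R V x)"
    have wa: "w \<bullet> a = mean (\<lambda>x. \<xi> x * (V x \<bullet> a))" for a
      using mean_linear[OF \<xi>V bounded_linear_inner_left, of a] by (simp add: w_def)
    \<comment> \<open>The divergence of the field \<eta> V has mean zero, and since \<open>V\<close>
      is divergence-free it equals 2 pi \<xi> (V \<bullet> m).\<close>
    have "w \<bullet> m = 0"
    proof -
      define g where "g i x = (\<chi> j. partial_deriv j V x \<bullet> axis i 1)" for i x
      define G where "G i x = \<eta> x *\<^sub>R g i x + (V x \<bullet> axis i 1) *\<^sub>R ((2 * pi * \<xi> x) *\<^sub>R m)" for i x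
      have C: "C1_with_gradient (\<lambda>x. \<eta> x * (V x \<bullet> axis i 1)) (G i)" for i
        unfolding G_def g_def \<eta>_def \<xi>_def by (intro C1_mult C1_sin smooth_component_C1 V)
      have Gc: "continuous_on UNIV (\<lambda>x. G i x \<bullet> axis i 1)" for i
        using C[of i] by (auto simp: C1_with_gradient_def intro!: continuous_intros)
      have "mean (\<lambda>x. G i x \<bullet> axis i 1) = 0" for i
      proof (rule mean_directional_derivative[OF C])
        show "Zn_periodic (\<lambda>x. \<eta> x * (V x \<bullet> axis i 1))" using \<eta>p V(2) by (simp add: Zn_periodic_def)
      qed (auto simp: axis_def)
      then have "mean (\<lambda>x. \<Sum>i\<in>UNIV. G i x \<bullet> axis i 1) = 0"
        using mean_sum[of UNIV "\<lambda>i x. G i x \<bullet> axis i 1"] Gc by simp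
      also have "(\<lambda>x. \<Sum>i\<in>UNIV. G i x \<bullet> axis i 1) = (\<lambda>x. 2 * pi * (\<xi> x * (V x \<bullet> m)))"
      proof
        fix x
        have "(\<Sum>i\<in>UNIV. G i x \<bullet> axis i 1) = \<eta> x * divergence V x + 2 * pi * \<xi> x * (\<Sum>i\<in>UNIV. V x $ i * m $ i)"
          by (simp add: G_def g_def divergence_def inner_add_left inner_axis sum.distrib sum_distrib_left mult_ac)
        then show "(\<Sum>i\<in>UNIV. G i x \<bullet> axis i 1) = 2 * pi * (\<xi> x * (V x \<bullet> m))"
          by (simp add: div inner_vec_def)
      qed
      also have "mean \<dots> = 2 * pi * mean (\<lambda>x. \<xi> x * (V x \<bullet> m))"
        by (rule mean_linear[OF _ bounded_linear_mult_right]) (intro continuous_intros \<xi>c Vc)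
      finally show ?thesis by (simp add: wa)
    qed
    moreover have "w \<bullet> k = 0" if k: "\<forall>i. k $ i \<in> \<int>" and mk: "m \<bullet> k = 0" for k
    proof -
      \<comment> \<open>A mode with frequency orthogonal to \<open>k\<close> is constant along the
        \<open>k\<close>-lines, so it factors out of the line average of
        \<open>V x \<bullet> k\<close>, which is zero.\<close>
      have \<xi>k: "\<xi> (x + t *\<^sub>R k) = \<xi> x" for x t by (simp add: \<xi>_def inner_add_right mk)
      have "line_avg k (\<lambda>x. \<xi> x * (V x \<bullet> k)) x = \<xi> x * line_avg k (\<lambda>x. V x \<bullet> k) x" for x
        by (simp add: line_avg_def \<xi>k)
      then have z: "line_avg k (\<lambda>x. \<xi> x * (V x \<bullet> k)) = (\<lambda>x. 0)" by (simp add: fun_eq_iff line0[OF k])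
      have "mean (\<lambda>x. \<xi> x * (V x \<bullet> k)) = mean (line_avg k (\<lambda>x. \<xi> x * (V x \<bullet> k)))"
        by (rule mean_line_avg[symmetric])
          (use \<xi>p V(2) in \<open>auto simp: Zn_periodic_def intro!: continuous_intros \<xi>c Vc\<close>)
      then show ?thesis by (simp add: wa z) (simp add: mean_def)
    qed
    ultimately have "w = 0" by (rule integer_orthogonal_complement[OF False _ m])
    then show ?thesis by (simp add: w_def \<xi>_def)
  qed
  have trig0: "mean (\<lambda>x. f x *\<^sub>R V x) = 0" if "trig f" for f
    using that
  proof induction
    case (cos m \<theta>)
    then show ?case by (rule coeff)
  next
    case (add f g)
    then show ?case
      using mean_add[of "\<lambda>x. f x *\<^sub>R V x" "\<lambda>x. g x *\<^sub>R V x"]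
      by (auto simp: scaleR_add_left intro!: continuous_intros trig_continuous Vc)
  next
    case (scale f c)
    have "mean (\<lambda>x. c *\<^sub>R (f x *\<^sub>R V x)) = c *\<^sub>R mean (\<lambda>x. f x *\<^sub>R V x)"
      by (rule mean_linear[OF _ bounded_linear_scaleR_right])
        (intro continuous_intros trig_continuous scale Vc)
    then show ?case using scale by simp
  qed
  have "V x0 \<bullet> V x0 \<le> 0"
  \<comment> \<open>The concentration lemma is one-sided; pairing \<open>V\<close> with its own
    value at \<open>x0\<close> makes the one-sided bound decisive.\<close>
  proof (rule trig_orthogonal_imp_nonpos[of "\<lambda>x. V x \<bullet> V x0"])
    show "continuous_on UNIV (\<lambda>x. V x \<bullet> V x0)" by (intro continuous_intros Vc)
    show "Zn_periodic (\<lambda>x. V x \<bullet> V x0)" using V(2) by (simp add: Zn_periodic_def)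
    fix f :: "real^'n \<Rightarrow> real" assume f: "trig f"
    have "mean (\<lambda>x. (f x *\<^sub>R V x) \<bullet> V x0) = mean (\<lambda>x. f x *\<^sub>R V x) \<bullet> V x0"
      by (rule mean_linear[OF _ bounded_linear_inner_left]) (intro continuous_intros trig_continuous f Vc)
    then show "mean (\<lambda>x. f x * (V x \<bullet> V x0)) = 0" by (simp add: trig0[OF f])
  qed
  then show ?thesis by (metis inner_ge_zero inner_eq_zero_iff order_antisym)
qed

section \<open>The burning velocity\<close>

text \<open>The bounds come from \<open>(t * norm p - 1)\<^sup>2 \<ge> 0\<close>. Boundedness below
  is stated separately because lower estimates for a real infimum are usable termwise only with
  it.\<close>

lemma burning_velocity_bounds:
  fixes W :: "real^'n::finite \<Rightarrow> real^'n"
  assumes L: "L-lipschitz_on UNIV W" and per: "Zn_periodic W" and B: "\<And>x. norm (W x) \<le> B"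
  shows "t > 0 \<Longrightarrow> (2 - B) * norm p \<le> (1 + effective_Hamiltonian W (t *\<^sub>R p)) / t"
    and "bdd_below ((\<lambda>t. (1 + effective_Hamiltonian W (t *\<^sub>R p)) / t) ` {0<..})"
    and "(2 - B) * norm p \<le> burning_velocity W p"
proof -
  show 1: "(2 - B) * norm p \<le> (1 + effective_Hamiltonian W (t *\<^sub>R p)) / t" if t: "t > 0" for t
  proof -
    obtain u where u: "cell_problem_solution W (t *\<^sub>R p) (effective_Hamiltonian W (t *\<^sub>R p)) u"
      using effective_Hamiltonian_solution[OF L per] by blast
    have "(norm (t *\<^sub>R p))\<^sup>2 - B * norm (t *\<^sub>R p) \<le> effective_Hamiltonian W (t *\<^sub>R p)"
      by (rule cell_problem_lower_bound[OF u B])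
    moreover have "0 \<le> (t * norm p - 1)\<^sup>2" by simp
    ultimately have "(2 - B) * norm p * t \<le> 1 + effective_Hamiltonian W (t *\<^sub>R p)"
      using t by (simp add: power2_eq_square algebra_simps)
    then show ?thesis using t by (simp add: field_simps)
  qed
  show "bdd_below ((\<lambda>t. (1 + effective_Hamiltonian W (t *\<^sub>R p)) / t) ` {0<..})"
    using 1 by (intro bdd_belowI[of _ "(2 - B) * norm p"]) auto
  show "(2 - B) * norm p \<le> burning_velocity W p"
    unfolding burning_velocity_def by (rule cINF_greatest) (use 1 in auto)
qed

text \<open>Substituting \<open>t * s\<close> for \<open>t\<close> gives one inequality, and the
  other is the same with \<open>1 / s\<close>. Roundness speaks of a single level set; homogeneity
  carries it to the integer vectors.\<close>

lemma burning_velocity_homogeneous: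
  assumes bdd: "\<And>p. bdd_below ((\<lambda>t. (1 + effective_Hamiltonian W (t *\<^sub>R p)) / t) ` {0<..})"
    and s: "s > 0"
  shows "burning_velocity W (s *\<^sub>R p) = s * burning_velocity W p"
proof -
  have le: "s * burning_velocity W p \<le> burning_velocity W (s *\<^sub>R p)" if s: "s > 0" for s p
    unfolding burning_velocity_def[of W "s *\<^sub>R p"]
  proof (rule cINF_greatest)
    fix t :: real assume t: "t \<in> {0<..}"
    have "burning_velocity W p \<le> (1 + effective_Hamiltonian W ((t * s) *\<^sub>R p)) / (t * s)"
      unfolding burning_velocity_def by (rule cINF_lower[OF bdd]) (use t s in auto)
    then show "s * burning_velocity W p \<le> (1 + effective_Hamiltonian W (t *\<^sub>R s *\<^sub>R p)) / t"
      using s t by (simp add: field_simps)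
  qed auto
  have "1 / s * burning_velocity W (s *\<^sub>R p) \<le> burning_velocity W ((1 / s) *\<^sub>R s *\<^sub>R p)"
    by (rule le) (use s in simp)
  then have "burning_velocity W (s *\<^sub>R p) \<le> s * burning_velocity W p"
    using s by (simp add: field_simps)
  with le[OF s, of p] show ?thesis by simp
qed

lemma line_avg_inner:
  fixes V :: "real^'n::finite \<Rightarrow> real^'n"
  assumes "continuous_on UNIV V"
  shows "line_avg k (\<lambda>x. V x \<bullet> a) x = line_avg k V x \<bullet> a"
  using integral_linear[OF integrable_on_line[OF assms, of x k 0 1] bounded_linear_inner_left, of a]
  by (simp add: line_avg_def o_def)

lemma burning_velocity_upper_bound:
  fixes V :: "real^'n::finite \<Rightarrow> real^'n"
  assumes V: "smooth V" "Zn_periodic V" and k: "\<forall>i. k $ i \<in> \<int>" "k \<noteq> 0"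
    and avg: "\<And>x. norm (line_avg k V x) \<le> \<delta>"
  obtains C where "C > 0" "\<And>\<epsilon>. \<epsilon> > 0 \<Longrightarrow>
    burning_velocity (\<lambda>x. \<epsilon> *\<^sub>R V x) k \<le> norm k * (2 + \<epsilon> * \<delta> + \<epsilon>\<^sup>2 * C)"
proof -
  have Vc: "continuous_on UNIV V" by (rule smooth_continuous[OF V(1)])
  obtain B where B: "B > 0" "\<And>x. norm (V x) \<le> B" using Zn_periodic_bounded[OF Vc V(2)] by blast
  obtain L where L: "L-lipschitz_on UNIV V" using smooth_periodic_lipschitz[OF V] by blast
  have fk: "V (x + k) \<bullet> k = V x \<bullet> k" for x using V(2) k by (simp add: Zn_periodic_def)
  obtain \<Psi> G where \<Psi>: "C1_with_gradient \<Psi> G" "\<And>x. G x \<bullet> k = V x \<bullet> k - line_avg k (\<lambda>x. V x \<bullet> k) x"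
    "Zn_periodic \<Psi>"
    using line_potential[OF smooth_component_C1[OF V(1), of k] fk] V(2)
    by (metis (no_types, lifting) Zn_periodic_def)
  have Gc: "continuous_on UNIV G" using \<Psi>(1) by (simp add: C1_with_gradient_def)
  obtain D where D: "D > 0" "\<And>x. norm (G x) \<le> D"
    using Zn_periodic_bounded[OF Gc C1_gradient_periodic[OF \<Psi>(1,3)]] by blast
  \<comment> \<open>Bounds the coefficient of \<open>\<epsilon>\<^sup>2\<close> that remains after
    inserting the corrector; \<open>D\<close> bounds its gradient and \<open>B\<close> the
    field.\<close>
  define C where "C = D\<^sup>2 / 4 + B * D / 2"
  have C: "C > 0" using B D by (simp add: C_def add_pos_pos)
  have nk: "norm k > 0" using k by simp
  show ?thesis
  proof (rule that[OF C])
    fix \<epsilon> :: real assume \<epsilon>: "\<epsilon> > 0"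
    define W where "W x = \<epsilon> *\<^sub>R V x" for x
    have Wl: "(\<epsilon> * L)-lipschitz_on UNIV W"
      using lipschitz_on_cmult[OF L, of \<epsilon>] \<epsilon> by (simp add: W_def[abs_def])
    have Wp: "Zn_periodic W" using V(2) by (simp add: W_def Zn_periodic_def)
    have WB: "norm (W x) \<le> \<epsilon> * B" for x using B(2)[of x] \<epsilon> by (simp add: W_def)
    \<comment> \<open>The minimizer of (1 + t^2 |k|^2) / t, which is the case without flow.\<close>
    define t where "t = 1 / norm k"
    have t: "t > 0" "t * norm k = 1" using nk by (auto simp: t_def)
    obtain u where u: "cell_problem_solution W (t *\<^sub>R k) (effective_Hamiltonian W (t *\<^sub>R k)) u"
      using effective_Hamiltonian_solution[OF Wl Wp] by blast
    have "effective_Hamiltonian W (t *\<^sub>R k) \<le> 1 + \<epsilon> * \<delta> + \<epsilon>\<^sup>2 * C"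
    \<comment> \<open>With the factor - \<epsilon> / 2 the cross term of the square is - t
      \<epsilon> (G \<bullet> k). It replaces V \<bullet> k by its line average, so the first-order
      term no longer oscillates along the line.\<close>
    proof (rule cell_problem_upper_bound[OF u C1_scale[OF \<Psi>(1), of "- (\<epsilon> / 2)"]])
      show "Zn_periodic (\<lambda>x. - (\<epsilon> / 2) * \<Psi> x)" using \<Psi>(3) by (simp add: Zn_periodic_def)
      fix x
      define F where "F = line_avg k (\<lambda>x. V x \<bullet> k) x"
      have F: "t * F \<le> \<delta>"
      proof -
        have "F \<le> norm (line_avg k V x) * norm k"
          unfolding F_def line_avg_inner[OF Vc] by (rule norm_cauchy_schwarz)
        also have "\<dots> \<le> \<delta> * norm k" using avg by (intro mult_right_mono) auto
        finally have "t * F \<le> t * (\<delta> * norm k)" using t by (intro mult_left_mono) auto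
        also have "\<dots> = \<delta>" using t(2) by (simp add: mult.left_commute)
        finally show ?thesis .
      qed
      have "(norm (t *\<^sub>R k + - (\<epsilon> / 2) *\<^sub>R G x))\<^sup>2 + W x \<bullet> (t *\<^sub>R k + - (\<epsilon> / 2) *\<^sub>R G x) =
        (t * norm k)\<^sup>2 + t * \<epsilon> * (V x \<bullet> k - G x \<bullet> k) + \<epsilon>\<^sup>2 * ((norm (G x))\<^sup>2 / 4 - (V x \<bullet> G x) / 2)"
        unfolding power_mult_distrib power2_norm_eq_inner W_def
        by (simp add: inner_simps inner_commute power2_eq_square field_simps)
      also have "\<dots> = 1 + \<epsilon> * (t * F) + \<epsilon>\<^sup>2 * ((norm (G x))\<^sup>2 / 4 - (V x \<bullet> G x) / 2)"
        by (simp add: \<Psi>(2) F_def t(2))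
      also have "\<dots> \<le> 1 + \<epsilon> * \<delta> + \<epsilon>\<^sup>2 * C"
      proof (intro add_mono mult_left_mono F order_refl)
        have "(norm (G x))\<^sup>2 \<le> D\<^sup>2" using D by (intro power_mono) auto
        moreover have "- (V x \<bullet> G x) \<le> B * D"
        proof -
          have "- (V x \<bullet> G x) \<le> norm (V x) * norm (G x)"
            using Cauchy_Schwarz_ineq2[of "V x" "G x"] by linarith
          also have "\<dots> \<le> B * D" using B D by (intro mult_mono) (auto simp: less_imp_le)
          finally show ?thesis .
        qed
        ultimately show "(norm (G x))\<^sup>2 / 4 - (V x \<bullet> G x) / 2 \<le> C" by (simp add: C_def)
      qed (use \<epsilon> in auto)
      finally show "(norm (t *\<^sub>R k + - (\<epsilon> / 2) *\<^sub>R G x))\<^sup>2 + W x \<bullet> (t *\<^sub>R k + - (\<epsilon> / 2) *\<^sub>R G x)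
        \<le> 1 + \<epsilon> * \<delta> + \<epsilon>\<^sup>2 * C" .
    qed
    moreover have "burning_velocity W k \<le> (1 + effective_Hamiltonian W (t *\<^sub>R k)) / t"
      unfolding burning_velocity_def
      by (rule cINF_lower[OF burning_velocity_bounds(2)[OF Wl Wp WB]]) (use t in auto)
    ultimately have "burning_velocity W k \<le> (2 + \<epsilon> * \<delta> + \<epsilon>\<^sup>2 * C) / t"
      using t(1) by (smt (verit) divide_right_mono)
    then show "burning_velocity (\<lambda>x. \<epsilon> *\<^sub>R V x) k \<le> norm k * (2 + \<epsilon> * \<delta> + \<epsilon>\<^sup>2 * C)"
      by (simp add: t_def W_def[abs_def] mult.commute)
  qed
qed

lemma burning_velocity_lower_bound:
  fixes V :: "real^'n::finite \<Rightarrow> real^'n"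
  assumes V: "smooth V" "Zn_periodic V" and k: "\<forall>i. k $ i \<in> \<int>"
    and B: "\<And>x. norm (V x) \<le> B" and \<epsilon>: "\<epsilon> > 0" "\<epsilon> * B \<le> 2"
  shows "2 * norm k * (1 - \<epsilon>\<^sup>2 * B\<^sup>2 / 4) + \<epsilon> * line_avg k (\<lambda>x. V x \<bullet> k) x0
    \<le> burning_velocity (\<lambda>x. \<epsilon> *\<^sub>R V x) k"
proof -
  have Vc: "continuous_on UNIV V" by (rule smooth_continuous[OF V(1)])
  obtain L where L: "L-lipschitz_on UNIV V" using smooth_periodic_lipschitz[OF V] by blast
  define W where "W x = \<epsilon> *\<^sub>R V x" for x
  have Wl: "(\<epsilon> * L)-lipschitz_on UNIV W"
    using lipschitz_on_cmult[OF L, of \<epsilon>] \<epsilon> by (simp add: W_def[abs_def])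
  have Wp: "Zn_periodic W" using V(2) by (simp add: W_def Zn_periodic_def)
  have WB: "norm (W x) \<le> \<epsilon> * B" for x using B[of x] \<epsilon> by (simp add: W_def)
  have fk: "V (x + k) \<bullet> k = V x \<bullet> k" for x using V(2) k by (simp add: Zn_periodic_def)
  define F where "F = line_avg k (\<lambda>x. V x \<bullet> k)"
  obtain \<Psi> G where \<Psi>: "C1_with_gradient \<Psi> G" "\<And>x. G x \<bullet> k = V x \<bullet> k - line_avg k (\<lambda>x. V x \<bullet> k) x"
    "Zn_periodic \<Psi>"
    using line_potential[OF smooth_component_C1[OF V(1), of k] fk] V(2)
    by (metis (no_types, lifting) Zn_periodic_def)
  have \<Psi>': "Zn_periodic (\<lambda>x. \<epsilon> * \<Psi> x)" using \<Psi>(3) by (simp add: Zn_periodic_def)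
  have eq: "(\<epsilon> *\<^sub>R G x) \<bullet> k = W x \<bullet> k - \<epsilon> * F x" for x
    by (simp add: \<Psi>(2) W_def F_def right_diff_distrib)
  have Fl: "\<epsilon> * F (x0 + t *\<^sub>R k) = \<epsilon> * F x0" for t
  proof -
    have "F (x0 + t *\<^sub>R k) = F x0" unfolding F_def
      by (rule line_avg_shift[where f = "\<lambda>x. V x \<bullet> k", OF _ fk]) (intro continuous_intros Vc)
    then show ?thesis by simp
  qed
  \<comment> \<open>With 0 \<le> \<theta> \<le> 1 one has \<theta> + t^2 |k|^2 \<ge> \<theta> (1 +
    t^2 |k|^2) \<ge> 2 \<theta> t |k|, so the loss in the Hamiltonian becomes a factor, uniformly in
    t.\<close>
  define \<theta> where "\<theta> = 1 - (\<epsilon> * B)\<^sup>2 / 4"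
  have "B \<ge> 0" using B[of 0] norm_ge_zero[of "V 0"] by linarith
  then have "(\<epsilon> * B)\<^sup>2 \<le> 2\<^sup>2" using \<epsilon> by (intro power_mono) auto
  then have \<theta>: "0 \<le> \<theta>" "\<theta> \<le> 1" by (auto simp: \<theta>_def)
  have "2 * norm k * \<theta> + \<epsilon> * F x0 \<le> burning_velocity W k"
    unfolding burning_velocity_def
  proof (rule cINF_greatest)
    fix t :: real assume "t \<in> {0<..}"
    then have t: "t > 0" by simp
    obtain u where u: "cell_problem_solution W (t *\<^sub>R k) (effective_Hamiltonian W (t *\<^sub>R k)) u"
      using effective_Hamiltonian_solution[OF Wl Wp] by blast
    have "t\<^sup>2 * (norm k)\<^sup>2 + t * (\<epsilon> * F x0) - (\<epsilon> * B)\<^sup>2 / 4 \<le> effective_Hamiltonian W (t *\<^sub>R k)"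
      by (rule cell_problem_lower_bound_line[OF u _ WB Wl k C1_scale[OF \<Psi>(1)] \<Psi>' eq Fl]) (use t in simp)
    moreover have "\<theta> * (2 * (t * norm k)) \<le> \<theta> * (1 + (t * norm k)\<^sup>2)"
      using \<theta>(1) zero_le_power2[of "t * norm k - 1"]
      by (intro mult_left_mono) (auto simp: power2_eq_square algebra_simps)
    moreover have "\<theta> * (t * norm k)\<^sup>2 \<le> 1 * (t * norm k)\<^sup>2" using \<theta> by (intro mult_right_mono) auto
    ultimately have "t * (2 * norm k * \<theta> + \<epsilon> * F x0) \<le> 1 + effective_Hamiltonian W (t *\<^sub>R k)"
    proof -
      assume *: "t\<^sup>2 * (norm k)\<^sup>2 + t * (\<epsilon> * F x0) - (\<epsilon> * B)\<^sup>2 / 4 \<le> effective_Hamiltonian W (t *\<^sub>R k)"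
        "\<theta> * (2 * (t * norm k)) \<le> \<theta> * (1 + (t * norm k)\<^sup>2)"
        "\<theta> * (t * norm k)\<^sup>2 \<le> 1 * (t * norm k)\<^sup>2"
      have "t * (2 * norm k * \<theta> + \<epsilon> * F x0) = \<theta> * (2 * (t * norm k)) + t * (\<epsilon> * F x0)"
        "\<theta> * (1 + (t * norm k)\<^sup>2) = \<theta> + \<theta> * (t * norm k)\<^sup>2"
        "(t * norm k)\<^sup>2 = t\<^sup>2 * (norm k)\<^sup>2"
        by (simp_all add: power_mult_distrib algebra_simps)
      with * show ?thesis unfolding \<theta>_def by linarith
    qed
    then show "2 * norm k * \<theta> + \<epsilon> * F x0 \<le> (1 + effective_Hamiltonian W (t *\<^sub>R k)) / t"
      using t by (simp add: field_simps)
  qed auto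
  then show ?thesis by (simp add: \<theta>_def F_def W_def[abs_def] power_mult_distrib)
qed

theorem theorem1p1:
  fixes V :: "real^'n::finite \<Rightarrow> real^'n"
  assumes "smooth V"
    and "Zn_periodic V"
    and "\<forall>x. divergence V x = 0"
    and "torus_integral V = 0"
    and "\<exists>x. V x \<noteq> 0"
  shows "\<exists>\<epsilon>\<^sub>0>0. \<forall>\<epsilon>\<in>{0<..<\<epsilon>\<^sub>0::real}.
           \<not> round_set {p. burning_velocity (\<lambda>x. \<epsilon> *\<^sub>R V x) p = 1} \<and>
           \<not> Euclidean_fun (burning_velocity (\<lambda>x. \<epsilon> *\<^sub>R V x))"
proof -
  note V = assms(1,2)
  have m0: "mean V = 0" using assms(4) by (simp add: mean_def torus_integral_def)
  have "\<exists>k x. (\<forall>i. k $ i \<in> \<int>) \<and> line_avg k (\<lambda>x. V x \<bullet> k) x > 0"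
    using nonpos_line_averages_imp_zero[OF V _ m0] assms(3,5) by (meson not_le)
  then obtain k1 x1 where k1: "\<forall>i. k1 $ i \<in> \<int>" and pos: "line_avg k1 (\<lambda>x. V x \<bullet> k1) x1 > 0"
    by blast
  define a where "a = line_avg k1 (\<lambda>x. V x \<bullet> k1) x1"
  have "k1 \<noteq> 0" using pos by (auto simp: line_avg_def)
  then have n1: "norm k1 > 0" by simp
  \<comment> \<open>Per unit length the first-order coefficient is at least 2 \<delta> in direction
    \<open>k1\<close>; the direction \<open>k0\<close> will be chosen with coefficient at most
    \<delta>.\<close>
  define \<delta> where "\<delta> = a / (2 * norm k1)"
  have \<delta>: "\<delta> > 0" "a = 2 * \<delta> * norm k1" using pos n1 by (auto simp: \<delta>_def a_def)
  have Vc: "continuous_on UNIV V" by (rule smooth_continuous[OF V(1)])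
  obtain B where B: "B > 0" "\<And>x. norm (V x) \<le> B" using Zn_periodic_bounded[OF Vc V(2)] by blast
  obtain L where L: "L-lipschitz_on UNIV V" using smooth_periodic_lipschitz[OF V] by blast
  obtain k0 where k0: "\<forall>i. k0 $ i \<in> \<int>" "k0 \<noteq> 0" "\<And>x. norm (line_avg k0 V x) \<le> \<delta>"
    using line_avg_approx_mean[OF L V(2) \<delta>(1)] m0 by (metis diff_zero)
  have n0: "norm k0 > 0" using k0 by simp
  obtain C where C: "C > 0" and up: "\<And>\<epsilon>. \<epsilon> > 0 \<Longrightarrow>
      burning_velocity (\<lambda>x. \<epsilon> *\<^sub>R V x) k0 \<le> norm k0 * (2 + \<epsilon> * \<delta> + \<epsilon>\<^sup>2 * C)"
    using burning_velocity_upper_bound[OF V k0] by blast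
  \<comment> \<open>The first bound gives \<open>\<epsilon> * B < 1\<close>, as positivity and the
    lower estimate require. The second makes the two quadratic errors, \<open>C\<close> from above
    and \<open>B\<^sup>2 / 2\<close> from below, smaller than the gap \<delta>.\<close>
  define \<epsilon>\<^sub>0 where "\<epsilon>\<^sub>0 = min (1 / B) (\<delta> / (C + B\<^sup>2 / 2))"
  have D: "C + B\<^sup>2 / 2 > 0" using C by (simp add: add_pos_nonneg)
  have "\<epsilon>\<^sub>0 > 0" using B(1) \<delta>(1) D by (simp add: \<epsilon>\<^sub>0_def)
  moreover have "\<not> round_set {p. burning_velocity (\<lambda>x. \<epsilon> *\<^sub>R V x) p = 1} \<and>
           \<not> Euclidean_fun (burning_velocity (\<lambda>x. \<epsilon> *\<^sub>R V x))" if "\<epsilon> \<in> {0<..<\<epsilon>\<^sub>0}" for \<epsilon>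
  proof -
    define W where "W x = \<epsilon> *\<^sub>R V x" for x
    define \<alpha> where "\<alpha> = burning_velocity W"
    have \<epsilon>: "\<epsilon> > 0" "\<epsilon> < 1 / B" "\<epsilon> < \<delta> / (C + B\<^sup>2 / 2)" using that by (auto simp: \<epsilon>\<^sub>0_def)
    have \<epsilon>B: "\<epsilon> * B < 1" using \<epsilon>(2) B(1) by (simp add: field_simps)
    have Wl: "(\<epsilon> * L)-lipschitz_on UNIV W"
      using lipschitz_on_cmult[OF L, of \<epsilon>] \<epsilon> by (simp add: W_def[abs_def])
    have Wp: "Zn_periodic W" using V(2) by (simp add: W_def Zn_periodic_def)
    have WB: "norm (W x) \<le> \<epsilon> * B" for x using B(2)[of x] \<epsilon> by (simp add: W_def)
    have \<alpha>pos: "\<alpha> k > 0" if "norm k > 0" for k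
    proof -
      have "0 < (2 - \<epsilon> * B) * norm k" using that \<epsilon>B by simp
      then show ?thesis using burning_velocity_bounds(3)[OF Wl Wp WB, of k] by (simp add: \<alpha>_def)
    qed
    have hom: "\<alpha> (s *\<^sub>R p) = s * \<alpha> p" if "s > 0" for s p
      unfolding \<alpha>_def by (rule burning_velocity_homogeneous[OF burning_velocity_bounds(2)[OF Wl Wp WB] that])
    \<comment> \<open>Both conclusions reduce to this: proportionality to the norm at the two
      vectors \<open>k0\<close> and \<open>k1\<close> is already contradictory.\<close>
    have no: False if c: "\<alpha> k0 = c * norm k0" "\<alpha> k1 = c * norm k1" for c
    proof -
      have "norm k0 * c \<le> norm k0 * (2 + \<epsilon> * \<delta> + \<epsilon>\<^sup>2 * C)"
        using up[OF \<epsilon>(1)] c(1) by (simp add: \<alpha>_def W_def[abs_def] mult.commute)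
      then have 1: "c \<le> 2 + \<epsilon> * \<delta> + \<epsilon>\<^sup>2 * C" using n0 by simp
      have "2 * norm k1 * (1 - \<epsilon>\<^sup>2 * B\<^sup>2 / 4) + \<epsilon> * a \<le> c * norm k1"
        using burning_velocity_lower_bound[OF V k1 B(2) \<epsilon>(1), of x1] \<epsilon>B c(2)
        by (simp add: a_def \<alpha>_def W_def[abs_def])
      then have "norm k1 * (2 * (1 - \<epsilon>\<^sup>2 * B\<^sup>2 / 4) + 2 * \<epsilon> * \<delta>) \<le> norm k1 * c"
        unfolding \<delta>(2) by (simp add: algebra_simps)
      then have "2 * (1 - \<epsilon>\<^sup>2 * B\<^sup>2 / 4) + 2 * \<epsilon> * \<delta> \<le> c" using n1 by simp
      with 1 have "\<epsilon> * \<delta> \<le> \<epsilon> * (\<epsilon> * (C + B\<^sup>2 / 2))" by (simp add: power2_eq_square algebra_simps)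
      then have "\<delta> \<le> \<epsilon> * (C + B\<^sup>2 / 2)" using \<epsilon>(1) by simp
      then show False using \<epsilon>(3) D by (simp add: field_simps)
    qed
    have "\<not> round_set {p. \<alpha> p = 1}"
    proof
      assume "round_set {p. \<alpha> p = 1}"
      then obtain r where r: "r > 0" "{p. \<alpha> p = 1} = sphere 0 r" by (auto simp: round_set_def)
      have "\<alpha> k = 1 / r * norm k" if k: "norm k > 0" for k
      proof -
        \<comment> \<open>Positivity of \<open>\<alpha>\<close> allows scaling \<open>k\<close> onto
          the level set, where roundness fixes its length to be \<open>r\<close>.\<close>
        have "\<alpha> ((1 / \<alpha> k) *\<^sub>R k) = 1" using hom[of "1 / \<alpha> k" k] \<alpha>pos[OF k] by simp
        then have "(1 / \<alpha> k) *\<^sub>R k \<in> sphere 0 r" using r(2) by blast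
        then have "norm k / \<alpha> k = r" using \<alpha>pos[OF k] by simp
        then show ?thesis using \<alpha>pos[OF k] r(1) by (simp add: field_simps)
      qed
      then show False using no n0 n1 by blast
    qed
    moreover have "\<not> Euclidean_fun \<alpha>" using no by (auto simp: Euclidean_fun_def)
    ultimately show ?thesis by (simp add: \<alpha>_def W_def[abs_def])
  qed
  ultimately show ?thesis by blast
qed

end
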